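(* Let $r,s_1,s_2$ be integers with $1\le s_1,s_2<r$, let $\rho\ge r$ be an integer, and consider the cross-neighborhood growth dynamics of range $\rho$ with the zero-set $\mathcal Z$ given by the minimal counts $(0,r)$, $(s_1,s_2)$ and $(r,0)$, that is, $$\mathcal Z=\{(u,v)\in\mathbb Z_+^2:\ u<r,\ v<r,\ \text{and } (u<s_1\text{ or }v<s_2)\}.$$ 1. If $s_1=1$ and $s_2=s$ with $s\le r/2$, then the critical power exists, is pure, and equals $\gamma_c=r/2$. 2. If $s_1=s_2=2$ and $r\ge6$, then the critical power exists, is pure, and equals $\gamma_c=2r/3$. 3. If $s_1=s_2=s$, then a lower power and an upper power for $\mathcal Z$ are, respectively, $$\gamma_\ell=\frac{\widehat m(r-\widehat m+1)}{1+\widehat m},\quad\text{where }\widehat m=\min\left(\left\lfloor\frac{-1+\sqrt{4r+9}}{2}\right\rfloor,\left\lfloor\frac s2\right\rfloor\right),$$ and $$\gamma_u=\frac{rs}{s+1}.$$ 4. If $s_1=1$, $s_2=s$ and $s>r/2$, then $s-\frac sr$ is a lower power and $s+1-\frac{2s+1}{r+1}$ is an upper power for $\mathcal Z$, and these two numbers differ by at most $1/2$.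
   Context: Let $\mathbb Z_+=\{0,1,2,\dots\}$. A zero-set is a set $\mathcal Z\subseteq\mathbb Z_+^2$ such that $(u,v)\in\mathcal Z$ implies $([0,u]\times[0,v])\cap\mathbb Z_+^2\subseteq\mathcal Z$. Its minimal counts are the pairs $(u_0,v_0)\in\mathbb Z_+^2\setminus\mathcal Z$ such that both $(u_0-1,v_0)$ and $(u_0,v_0-1)$ lie in $\mathcal Z\cup(\mathbb Z_+^2)^c$. Given an integer range $\rho$, for $x\in\mathbb Z^2$ let $\mathcal N^h_x=x+([-\rho,\rho]\cap\mathbb Z)\times\{0\}$ and $\mathcal N^v_x=x+\{0\}\times([-\rho,\rho]\cap\mathbb Z)$. Given $\xi_0\subseteq\mathbb Z^2$, define recursively, for $t\in\mathbb Z_+$, $$\xi_{t+1}=\xi_t\cup\{x\in\mathbb Z^2:(|\mathcal N_x^h\cap\xi_t|,|\mathcal N_x^v\cap\xi_t|)\notin\mathcal Z\}.$$ Each $x\in\mathbb Z^2$ is included in $\xi_0$ independently with probability $p\in[0,1]$, and $T=\inf\{t\ge0:(0,0)\in\xi_t\}$. For a deterministic $a=a(p)$ and nonnegative random variables $X=X(p)$: $X\lesssim a$ means $\lim_{\lambda\to\infty}\limsup_{p\to0}\mathbb P(X\ge\lambda a)=0$; $X\gtrsim a$ means $\lim_{\lambda\to0}\limsup_{p\to0}\mathbb P(X\le\lambda a)=0$; $X\asymp a$ means both. A number $\gamma\ge0$ is a lower power (resp. upper power) for $\mathcal Z$ if for every $\epsilon>0$, $T\gtrsim p^{-(\gamma-\epsilon)}$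 (resp. $T\lesssim p^{-(\gamma+\epsilon)}$). The critical power $\gamma_c=\gamma_c(\mathcal Z)$ is a number that is both a lower and an upper power; it is pure if $T\asymp p^{-\gamma_c}$. *)

theory Defs
  imports "HOL-Probability.Probability" "HOL-Real_Asymp.Real_Asymp"
begin

section \<open>Zero-sets\<close>

definition zero_set :: "(nat \<times> nat) set \<Rightarrow> bool" where
  "zero_set Z \<longleftrightarrow> (\<forall>(u, v)\<in>Z. {0..u} \<times> {0..v} \<subseteq> Z)"

text \<open>
  A predecessor with a negative coordinate lies outside the quadrant and counts as being
  in the zero-set; since natural subtraction truncates, these cases are listed explicitly.
\<close>
definition minimal_counts :: "(nat \<times> nat) set \<Rightarrow> (nat \<times> nat) set" where
  "minimal_counts Z =
     {(u, v). (u, v) \<notin> Z \<and> (u = 0 \<or> (u - 1, v) \<in> Z) \<and> (v = 0 \<or> (u, v - 1) \<in> Z)}"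

text \<open>
  A zero-set is determined by its minimal counts; for the three counts below this gives the
  explicit form.
\<close>
lemma zero_set_minimal_below:
  assumes "(u, v) \<notin> Z"
  shows "\<exists>(a, b) \<in> minimal_counts Z. a \<le> u \<and> b \<le> v"
  using assms
proof (induction "u + v" arbitrary: u v rule: less_induct)
  case less
  show ?case
  proof (cases "(u, v) \<in> minimal_counts Z")
    case True
    then show ?thesis by auto
  next
    case False
    then have "(u > 0 \<and> (u - 1, v) \<notin> Z) \<or> (v > 0 \<and> (u, v - 1) \<notin> Z)"
      using less.prems by (auto simp: minimal_counts_def)
    then show ?thesis
    proof
      assume *: "u > 0 \<and> (u - 1, v) \<notin> Z"
      then obtain a b where "(a, b) \<in> minimal_counts Z" "a \<le> u - 1" "b \<le> v"
        using less.hyps[of "u - 1" v] by auto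
      then show ?thesis by (intro bexI[of _ "(a, b)"]) auto
    next
      assume *: "v > 0 \<and> (u, v - 1) \<notin> Z"
      then obtain a b where "(a, b) \<in> minimal_counts Z" "a \<le> u" "b \<le> v - 1"
        using less.hyps[of u "v - 1"] by auto
      then show ?thesis by (intro bexI[of _ "(a, b)"]) auto
    qed
  qed
qed

lemma zero_set_with_three_minimal_counts:
  assumes "1 \<le> s1" "s1 < r" "1 \<le> s2" "s2 < r"
  shows "zero_set Z \<and> minimal_counts Z = {(0, r), (s1, s2), (r, 0)} \<longleftrightarrow>
         Z = {(u, v). u < r \<and> v < r \<and> (u < s1 \<or> v < s2)}" (is "?L \<longleftrightarrow> Z = ?R")
proof
  assume L: ?L
  have up: "(u, v) \<notin> Z" if "(a, b) \<in> minimal_counts Z" "a \<le> u" "b \<le> v" for a b u v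
    using L that unfolding zero_set_def minimal_counts_def by fastforce
  show "Z = ?R"
  proof (intro set_eqI iffI; clarify)
    fix u v assume "(u, v) \<in> Z"
    then show "u < r \<and> v < r \<and> (u < s1 \<or> v < s2)"
      using up[of 0 r u v] up[of s1 s2 u v] up[of r 0 u v] L by force
  next
    fix u v assume "u < r" "v < r" "u < s1 \<or> v < s2"
    then show "(u, v) \<in> Z"
      using zero_set_minimal_below[of u v Z] L by fastforce
  qed
next
  assume "Z = ?R"
  then show ?L using assms by (auto simp: zero_set_def minimal_counts_def)
qed

section \<open>Growth dynamics\<close>

definition nbhd_h :: "nat \<Rightarrow> int \<times> int \<Rightarrow> (int \<times> int) set" where
  "nbhd_h \<rho> x = (\<lambda>i. x + (i, 0)) ` {- int \<rho>..int \<rho>}"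

definition nbhd_v :: "nat \<Rightarrow> int \<times> int \<Rightarrow> (int \<times> int) set" where
  "nbhd_v \<rho> x = (\<lambda>i. x + (0, i)) ` {- int \<rho>..int \<rho>}"

primrec growth ::
  "nat \<Rightarrow> (nat \<times> nat) set \<Rightarrow> (int \<times> int) set \<Rightarrow> nat \<Rightarrow> (int \<times> int) set" where
  "growth \<rho> Z \<xi>0 0 = \<xi>0"
| "growth \<rho> Z \<xi>0 (Suc t) = growth \<rho> Z \<xi>0 t \<union>
     {x. (card (nbhd_h \<rho> x \<inter> growth \<rho> Z \<xi>0 t), card (nbhd_v \<rho> x \<inter> growth \<rho> Z \<xi>0 t)) \<notin> Z}"

text \<open>The law of the initial configuration, encoded by its indicator.\<close>
definition initial_law :: "real \<Rightarrow> (int \<times> int \<Rightarrow> bool) measure" where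
  "initial_law p = (\<Pi>\<^sub>M x\<in>UNIV. measure_pmf (bernoulli_pmf p))"

text \<open>The value is \<open>\<infinity>\<close> (the infimum of the empty set) if the origin is never occupied.\<close>
definition occupation_time ::
  "nat \<Rightarrow> (nat \<times> nat) set \<Rightarrow> (int \<times> int \<Rightarrow> bool) \<Rightarrow> ereal" where
  "occupation_time \<rho> Z \<omega> = (INF t\<in>{t. (0, 0) \<in> growth \<rho> Z {x. \<omega> x} t}. ereal (real t))"

text \<open>
  \<^const>\<open>measure\<close> is \<open>0\<close> on non-measurable sets, so it matters that the first passage time
  is a random variable.
\<close>
lemma measurable_growth:
  "Measurable.pred (initial_law p) (\<lambda>\<omega>. x \<in> growth \<rho> Z {y. \<omega> y} t)"
proof (induction t arbitrary: x)
  case 0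
  have "(\<lambda>\<omega>. \<omega> x) \<in> initial_law p \<rightarrow>\<^sub>M measure_pmf (bernoulli_pmf p)"
    unfolding initial_law_def by (rule measurable_component_singleton) simp
  then show ?case by simp
next
  case (Suc t)
  have card: "(\<lambda>\<omega>. card (N \<inter> growth \<rho> Z {y. \<omega> y} t)) \<in> initial_law p \<rightarrow>\<^sub>M count_space UNIV"
    if "finite N" for N
  proof -
    have "card (N \<inter> growth \<rho> Z {y. \<omega> y} t) =
        (\<Sum>x\<in>N. if x \<in> growth \<rho> Z {y. \<omega> y} t then 1 else 0)" for \<omega>
      using that by (simp add: sum.If_cases)
    moreover have "(\<lambda>\<omega>. \<Sum>x\<in>N. if x \<in> growth \<rho> Z {y. \<omega> y} t then 1 else 0 :: nat)
        \<in> initial_law p \<rightarrow>\<^sub>M count_space UNIV"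
      using Suc.IH by measurable
    ultimately show ?thesis by simp
  qed
  have fin: "finite (nbhd_h \<rho> x)" "finite (nbhd_v \<rho> x)"
    by (auto simp: nbhd_h_def nbhd_v_def)
  note [measurable] = Suc.IH card[OF fin(1)] card[OF fin(2)]
  have "Measurable.pred (initial_law p) (\<lambda>\<omega>.
      (card (nbhd_h \<rho> x \<inter> growth \<rho> Z {y. \<omega> y} t), card (nbhd_v \<rho> x \<inter> growth \<rho> Z {y. \<omega> y} t)) \<in> Z)"
    by (rule measurable_compose_countable[where g = "\<lambda>\<omega>. card (nbhd_h \<rho> x \<inter> growth \<rho> Z {y. \<omega> y} t)"],
        rule measurable_compose_countable[where g = "\<lambda>\<omega>. card (nbhd_v \<rho> x \<inter> growth \<rho> Z {y. \<omega> y} t)"])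
       measurable
  then show ?case by simp
qed

lemma measurable_occupation_time [measurable]:
  "occupation_time \<rho> Z \<in> borel_measurable (initial_law p)"
proof -
  have "occupation_time \<rho> Z =
      (\<lambda>\<omega>. INF t. if (0, 0) \<in> growth \<rho> Z {x. \<omega> x} t then ereal (real t) else \<infinity>)"
  proof
    fix \<omega>
    let ?P = "\<lambda>t. (0, 0) \<in> growth \<rho> Z {x. \<omega> x} t"
    let ?f = "\<lambda>t. if ?P t then ereal (real t) else \<infinity>"
    have "(INF t\<in>{t. ?P t}. ereal (real t)) \<le> ?f t" for t
      by (auto intro: INF_lower)
    moreover have "(INF t. ?f t) \<le> ereal (real t)" if "?P t" for t
      using that by (intro INF_lower2[of t]) auto
    ultimately show "occupation_time \<rho> Z \<omega> = (INF t. ?f t)"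
      unfolding occupation_time_def by (intro antisym INF_greatest) auto
  qed
  also have "\<dots> \<in> borel_measurable (initial_law p)"
    using measurable_growth by measurable
  finally show ?thesis .
qed

section \<open>Asymptotics in probability as \<open>p\<close> tends to 0\<close>

definition prob_lesssim ::
  "(real \<Rightarrow> 'a measure) \<Rightarrow> (real \<Rightarrow> 'a \<Rightarrow> ereal) \<Rightarrow> (real \<Rightarrow> real) \<Rightarrow> bool" where
  "prob_lesssim M X a \<longleftrightarrow>
     ((\<lambda>l. Limsup (at_right 0)
             (\<lambda>p. ereal (measure (M p) {\<omega> \<in> space (M p). X p \<omega> \<ge> ereal (l * a p)})))
        \<longlongrightarrow> 0) at_top"

definition prob_gtrsim ::
  "(real \<Rightarrow> 'a measure) \<Rightarrow> (real \<Rightarrow> 'a \<Rightarrow> ereal) \<Rightarrow> (real \<Rightarrow> real) \<Rightarrow> bool" where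
  "prob_gtrsim M X a \<longleftrightarrow>
     ((\<lambda>l. Limsup (at_right 0)
             (\<lambda>p. ereal (measure (M p) {\<omega> \<in> space (M p). X p \<omega> \<le> ereal (l * a p)})))
        \<longlongrightarrow> 0) (at_right 0)"

definition prob_asymp ::
  "(real \<Rightarrow> 'a measure) \<Rightarrow> (real \<Rightarrow> 'a \<Rightarrow> ereal) \<Rightarrow> (real \<Rightarrow> real) \<Rightarrow> bool" where
  "prob_asymp M X a \<longleftrightarrow> prob_lesssim M X a \<and> prob_gtrsim M X a"

section \<open>Powers\<close>

definition lower_power :: "nat \<Rightarrow> (nat \<times> nat) set \<Rightarrow> real \<Rightarrow> bool" where
  "lower_power \<rho> Z \<gamma> \<longleftrightarrow> 0 \<le> \<gamma> \<and>
     (\<forall>\<epsilon>>0. prob_gtrsim initial_law (\<lambda>p. occupation_time \<rho> Z) (\<lambda>p. p powr (- (\<gamma> - \<epsilon>))))"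

definition upper_power :: "nat \<Rightarrow> (nat \<times> nat) set \<Rightarrow> real \<Rightarrow> bool" where
  "upper_power \<rho> Z \<gamma> \<longleftrightarrow> 0 \<le> \<gamma> \<and>
     (\<forall>\<epsilon>>0. prob_lesssim initial_law (\<lambda>p. occupation_time \<rho> Z) (\<lambda>p. p powr (- (\<gamma> + \<epsilon>))))"

definition is_critical_power :: "nat \<Rightarrow> (nat \<times> nat) set \<Rightarrow> real \<Rightarrow> bool" where
  "is_critical_power \<rho> Z \<gamma> \<longleftrightarrow> lower_power \<rho> Z \<gamma> \<and> upper_power \<rho> Z \<gamma>"

definition critical_power_exists :: "nat \<Rightarrow> (nat \<times> nat) set \<Rightarrow> bool" where
  "critical_power_exists \<rho> Z \<longleftrightarrow> (\<exists>\<gamma>. is_critical_power \<rho> Z \<gamma>)"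

text \<open>Only meaningful if a critical power exists; it is then unique, as shown below.\<close>
definition critical_power :: "nat \<Rightarrow> (nat \<times> nat) set \<Rightarrow> real" where
  "critical_power \<rho> Z = (THE \<gamma>. is_critical_power \<rho> Z \<gamma>)"

definition critical_power_pure :: "nat \<Rightarrow> (nat \<times> nat) set \<Rightarrow> bool" where
  "critical_power_pure \<rho> Z \<longleftrightarrow>
     prob_asymp initial_law (\<lambda>p. occupation_time \<rho> Z) (\<lambda>p. p powr (- critical_power \<rho> Z))"

lemma lower_power_le_upper_power:
  assumes "lower_power \<rho> Z \<gamma>'" "upper_power \<rho> Z \<gamma>"
  shows "\<gamma>' \<le> \<gamma>"
proof (rule ccontr)
  assume "\<not> \<gamma>' \<le> \<gamma>"
  define \<epsilon> where "\<epsilon> = (\<gamma>' - \<gamma>) / 4"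
  have \<epsilon>: "\<epsilon> > 0" "- (\<gamma>' - \<epsilon>) = - (\<gamma> + \<epsilon>) + - (2 * \<epsilon>)"
    using \<open>\<not> \<gamma>' \<le> \<gamma>\<close> by (auto simp: \<epsilon>_def field_simps)
  let ?a = "\<lambda>p::real. p powr (- (\<gamma> + \<epsilon>))" and ?b = "\<lambda>p::real. p powr (- (\<gamma>' - \<epsilon>))"
  let ?T = "occupation_time \<rho> Z"
  let ?U = "\<lambda>L p. {\<omega> \<in> space (initial_law p). ?T \<omega> \<ge> ereal (L * ?a p)}"
  let ?V = "\<lambda>l p. {\<omega> \<in> space (initial_law p). ?T \<omega> \<le> ereal (l * ?b p)}"
  have "prob_lesssim initial_law (\<lambda>p. ?T) ?a" "prob_gtrsim initial_law (\<lambda>p. ?T) ?b"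
    using assms \<epsilon>(1) unfolding lower_power_def upper_power_def by blast+
  then have
    "\<forall>\<^sub>F L in at_top. Limsup (at_right 0) (\<lambda>p. ereal (measure (initial_law p) (?U L p))) < ereal (1/3)"
    "\<forall>\<^sub>F l in at_right 0. Limsup (at_right 0) (\<lambda>p. ereal (measure (initial_law p) (?V l p))) < ereal (1/3)"
    unfolding prob_lesssim_def prob_gtrsim_def
    by (auto elim!: order_tendstoD)
  from eventually_happens'[OF _ this(1)] eventually_happens'[OF _ eventually_conj[OF this(2) eventually_at_right_less]]
  obtain L l where Ll: "l > 0"
    "Limsup (at_right 0) (\<lambda>p. ereal (measure (initial_law p) (?U L p))) < ereal (1/3)"
    "Limsup (at_right 0) (\<lambda>p. ereal (measure (initial_law p) (?V l p))) < ereal (1/3)"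
    by auto
  have "filterlim (\<lambda>p::real. p powr (- (2 * \<epsilon>))) at_top (at_right 0)"
    using \<epsilon>(1) by real_asymp
  then have ev: "\<forall>\<^sub>F p in at_right 0. p powr (- (2 * \<epsilon>)) \<ge> L / l"
    by (simp add: filterlim_at_top)
  have "\<forall>\<^sub>F p::real in at_right 0. False"
    using ev Limsup_lessD[OF Ll(2)] Limsup_lessD[OF Ll(3)]
  proof eventually_elim
    case (elim p)
    interpret prob_space "initial_law p"
      unfolding initial_law_def by (intro prob_space_PiM prob_space_measure_pmf)
    have "L \<le> l * p powr (- (2 * \<epsilon>))"
      using elim(1) Ll(1) by (simp add: field_simps)
    then have "L * ?a p \<le> (l * p powr (- (2 * \<epsilon>))) * ?a p"
      by (rule mult_right_mono) simp
    then have le: "L * ?a p \<le> l * ?b p"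
      by (simp only: \<epsilon>(2) powr_add mult_ac)
    have "space (initial_law p) \<subseteq> ?U L p \<union> ?V l p"
    proof
      fix \<omega> assume "\<omega> \<in> space (initial_law p)"
      moreover have "ereal (L * ?a p) \<le> ?T \<omega> \<or> ?T \<omega> \<le> ereal (l * ?b p)"
        using le by (meson ereal_less_eq(3) linear order_trans)
      ultimately show "\<omega> \<in> ?U L p \<union> ?V l p" by blast
    qed
    then have "1 \<le> prob (?U L p \<union> ?V l p)"
      by (subst prob_space[symmetric]) (intro finite_measure_mono, auto)
    also have "\<dots> \<le> prob (?U L p) + prob (?V l p)"
      by (intro measure_Un_le) auto
    finally show False using elim(2,3) by simp
  qed
  then show False by simp
qed

lemma is_critical_power_unique:
  "is_critical_power \<rho> Z \<gamma> \<Longrightarrow> is_critical_power \<rho> Z \<gamma>' \<Longrightarrow> \<gamma> = \<gamma>'"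
  unfolding is_critical_power_def by (meson antisym lower_power_le_upper_power)

lemma critical_power_eqI: "is_critical_power \<rho> Z \<gamma> \<Longrightarrow> critical_power \<rho> Z = \<gamma>"
  unfolding critical_power_def using is_critical_power_unique by blast

end

theory Submission
  imports Defs
begin

text \<open>
  Lower bounds. Up to time \<open>t = \<lambda> p powr (- \<gamma>)\<close> only sites within distance \<open>\<rho> t\<close> of the origin matter,
  and \<open>c\<close> coordinates can be chosen there in about \<open>t ^ c\<close> ways. So, with probability close to 1 if
  \<open>\<lambda>\<close> is small, any bounded number of sites near the grid spanned by \<open>c\<close> coordinates (not counting
  those of the origin) contains fewer than \<open>\<gamma> * c\<close> initially occupied ones. Growth over long
  distances happens only along rows and columns that contain a site with \<open>r\<close> occupied horizontal,
  respectively vertical, neighbours; away from these lines growth is confined to clusters of bounded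
  size. At the first time when \<open>m\<close> such rows are near each other, each has been created by
  \<open>r - m + 1\<close> sites that do not lie on good columns, which gives
  \<open>\<gamma> * (m + 1) = m * (r - m + 1)\<close>; for \<open>s1 = s2 = 2\<close> and \<open>m = 2\<close>, the sites on good columns can be taken
  into account as well and \<open>\<gamma> * 3 = 2 * r\<close>. If \<open>s1 = 1\<close>, all columns with \<open>s\<close> occupied neighbours are
  declared full, so that nothing grows off full lines. The energy of a set of lines, its number of
  initially occupied sites minus \<open>\<gamma>\<close> times its number of coordinates, then increases by a fixed
  amount with every line in the ancestry of a full line, and sparseness makes it negative.

  Upper bounds. The origin is reached from \<open>s\<close> adjacent rows and \<open>s\<close> adjacent columns that contain
  runs of \<open>r\<close> occupied sites, or from \<open>r\<close> adjacent columns one of which contains a run of \<open>r\<close> and the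
  others runs of \<open>s\<close> sites. Such nuclei exist because disjoint blocks of lines are independent.
\<close>

text \<open>All randomness of the lower bounds sits in the event \<open>sparse\<close>; once it
  holds, the rest is deterministic and valid for all times. A violation with c \<ge> 1 chosen
  coordinates has probability at most of order t^c p^(\<gamma> c) = \<lambda>^c, which is small with
  \<lambda> at the exponent \<gamma> itself. Hence critical powers come out pure. The obstacle
  throughout is that one initially occupied site may serve several lines, while sparseness counts it
  once; each argument has to exhibit enough distinct sites. For m rows this is a double count by
  columns. For s1 = s2 = 2 it is the proof that a helping column was created far from the row it
  helps. For s1 = 1 the crossing of two lines is credited to at most the older one. A second
  obstacle is that sparseness speaks only of a bounded number of coordinates, whereas cluster sizes
  and ancestries have no bound a priori. Both are bounded by the same bootstrap: one more step at
  most multiplies the size by a constant, sparseness still applies, and it brings the size back to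
  the original bound.\<close>

section \<open>Neighbour counts and the one-step rule\<close>

definition hcount :: "nat \<Rightarrow> (int \<times> int) set \<Rightarrow> int \<Rightarrow> int \<Rightarrow> nat" where
  "hcount \<rho> X x y = card {a. \<bar>a - x\<bar> \<le> int \<rho> \<and> (a, y) \<in> X}"

definition vcount :: "nat \<Rightarrow> (int \<times> int) set \<Rightarrow> int \<Rightarrow> int \<Rightarrow> nat" where
  "vcount \<rho> X x y = card {b. \<bar>b - y\<bar> \<le> int \<rho> \<and> (x, b) \<in> X}"

definition square :: "int \<Rightarrow> int \<Rightarrow> int \<Rightarrow> (int \<times> int) set" where
  "square K x y = {(a, b). \<bar>a - x\<bar> \<le> K \<and> \<bar>b - y\<bar> \<le> K}"

lemma finite_abs_le [simp]: "finite {a :: int. \<bar>a - x\<bar> \<le> K}" "finite {a :: int. \<bar>a - x\<bar> \<le> K \<and> P a}"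
proof -
  have "{a :: int. \<bar>a - x\<bar> \<le> K} \<subseteq> {x - K..x + K}" by auto
  then show *: "finite {a :: int. \<bar>a - x\<bar> \<le> K}" by (rule finite_subset) simp
  show "finite {a :: int. \<bar>a - x\<bar> \<le> K \<and> P a}" by (rule finite_subset[OF _ *]) auto
qed

lemma mem_square [simp]: "(a, b) \<in> square K x y \<longleftrightarrow> \<bar>a - x\<bar> \<le> K \<and> \<bar>b - y\<bar> \<le> K"
  by (simp add: square_def)

lemma square_eq: "square K x y = {x - K..x + K} \<times> {y - K..y + K}"
  by (auto simp: square_def)

lemma finite_square [simp]: "finite (square K x y)"
  by (simp add: square_eq)

lemma card_nbhd_h: "card (nbhd_h \<rho> (x, y) \<inter> X) = hcount \<rho> X x y"
proof -
  have "(a, y) \<in> nbhd_h \<rho> (x, y)" if "\<bar>a - x\<bar> \<le> int \<rho>" for a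
    using that unfolding nbhd_h_def by (intro image_eqI[of _ _ "a - x"]) auto
  then have "nbhd_h \<rho> (x, y) \<inter> X = (\<lambda>a. (a, y)) ` {a. \<bar>a - x\<bar> \<le> int \<rho> \<and> (a, y) \<in> X}"
    by (auto simp: nbhd_h_def)
  then show ?thesis
    by (simp add: hcount_def card_image inj_on_def)
qed

lemma card_nbhd_v: "card (nbhd_v \<rho> (x, y) \<inter> X) = vcount \<rho> X x y"
proof -
  have "(x, b) \<in> nbhd_v \<rho> (x, y)" if "\<bar>b - y\<bar> \<le> int \<rho>" for b
    using that unfolding nbhd_v_def by (intro image_eqI[of _ _ "b - y"]) auto
  then have "nbhd_v \<rho> (x, y) \<inter> X = (\<lambda>b. (x, b)) ` {b. \<bar>b - y\<bar> \<le> int \<rho> \<and> (x, b) \<in> X}"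
    by (auto simp: nbhd_v_def)
  then show ?thesis
    by (simp add: vcount_def card_image inj_on_def)
qed

definition cross_zero_set :: "nat \<Rightarrow> nat \<Rightarrow> nat \<Rightarrow> (nat \<times> nat) set" where
  "cross_zero_set r s1 s2 = {(u, v). u < r \<and> v < r \<and> (u < s1 \<or> v < s2)}"

lemma growth_Suc_iff:
  "(x, y) \<in> growth \<rho> (cross_zero_set r s1 s2) \<xi> (Suc t) \<longleftrightarrow>
     (let X = growth \<rho> (cross_zero_set r s1 s2) \<xi> t in
      (x, y) \<in> X \<or> r \<le> hcount \<rho> X x y \<or> r \<le> vcount \<rho> X x y \<or>
      s1 \<le> hcount \<rho> X x y \<and> s2 \<le> vcount \<rho> X x y)"
  by (auto simp: card_nbhd_h card_nbhd_v cross_zero_set_def Let_def not_less)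

lemma growth_mono: "growth \<rho> Z \<xi> t \<subseteq> growth \<rho> Z \<xi> (Suc t)"
  by simp

lemma growth_mono': "t \<le> t' \<Longrightarrow> growth \<rho> Z \<xi> t \<subseteq> growth \<rho> Z \<xi> t'"
  using lift_Suc_mono_le[of "growth \<rho> Z \<xi>", OF growth_mono] .

lemma hcount_mono: "X \<subseteq> Y \<Longrightarrow> hcount \<rho> X x y \<le> hcount \<rho> Y x y"
  unfolding hcount_def by (rule card_mono) auto

lemma vcount_mono: "X \<subseteq> Y \<Longrightarrow> vcount \<rho> X x y \<le> vcount \<rho> Y x y"
  unfolding vcount_def by (rule card_mono) auto

section \<open>Confinement of local growth\<close>

text \<open>Consecutive elements of X are at most g apart. The bound is required at every integer c
  between two elements, so that for a union one only has to locate c relative to the two close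
  elements x and y.\<close>

definition chain :: "int \<Rightarrow> int set \<Rightarrow> bool" where
  "chain g X \<longleftrightarrow> (\<forall>a\<in>X. \<forall>b\<in>X. \<forall>c. a \<le> c \<and> c < b \<longrightarrow> (\<exists>d\<in>X. c < d \<and> d \<le> c + g))"

lemma chain_union:
  assumes "chain g X" "chain g Y" "x \<in> X" "y \<in> Y" "\<bar>x - y\<bar> \<le> g"
  shows "chain g (X \<union> Y)"
  unfolding chain_def
proof (intro ballI allI impI)
  fix a b c assume ab: "a \<in> X \<union> Y" "b \<in> X \<union> Y" and c: "a \<le> c \<and> c < b"
  have X: "\<exists>d\<in>X \<union> Y. c < d \<and> d \<le> c + g" if "a' \<in> X" "b' \<in> X" "a' \<le> c" "c < b'" for a' b'
    using assms(1) that unfolding chain_def by blast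
  have Y: "\<exists>d\<in>X \<union> Y. c < d \<and> d \<le> c + g" if "a' \<in> Y" "b' \<in> Y" "a' \<le> c" "c < b'" for a' b'
    using assms(2) that unfolding chain_def by blast
  have *: "\<exists>d\<in>X \<union> Y. c < d \<and> d \<le> c + g" if "x \<le> c" "c < y"
    using assms that by (intro bexI[of _ y]) auto
  have **: "\<exists>d\<in>X \<union> Y. c < d \<and> d \<le> c + g" if "y \<le> c" "c < x"
    using assms that by (intro bexI[of _ x]) auto
  show "\<exists>d\<in>X \<union> Y. c < d \<and> d \<le> c + g"
    using ab c X Y * ** assms(3,4) by (metis Un_iff linorder_not_le)
qed

lemma chain_close: "X \<subseteq> {z - g..z + g} \<Longrightarrow> chain (2 * g) X"
  unfolding chain_def
proof (intro ballI allI impI)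
  fix a b c assume "X \<subseteq> {z - g..z + g}" and ab: "a \<in> X" "b \<in> X" and c: "a \<le> c \<and> c < b"
  then have "z - g \<le> a" "b \<le> z + g" by auto
  with ab c show "\<exists>d\<in>X. c < d \<and> d \<le> c + 2 * g"
    by (intro bexI[of _ b]) auto
qed

lemma chain_diameter_aux:
  assumes "chain g X" "finite X" "a \<in> X" "b \<in> X" "a \<le> b"
  shows "b - a \<le> g * int (card {d \<in> X. a < d \<and> d \<le> b})"
  using assms(3,5)
proof (induction "nat (b - a)" arbitrary: a rule: less_induct)
  case less
  show ?case
  proof (cases "a = b")
    case False
    then have "a < b" using less.prems by simp
    then obtain d where d: "d \<in> X" "a < d" "d \<le> a + g"
      using assms(1,4) less.prems unfolding chain_def by blast
    have fin: "finite {d \<in> X. a < d \<and> d \<le> b}" using assms(2) by simp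
    show ?thesis
    proof (cases "d < b")
      case True
      have "b - d \<le> g * int (card {e \<in> X. d < e \<and> e \<le> b})"
        using less.hyps[of d] d True by simp
      moreover have "insert d {e \<in> X. d < e \<and> e \<le> b} \<subseteq> {e \<in> X. a < e \<and> e \<le> b}"
        using d True by auto
      then have "card (insert d {e \<in> X. d < e \<and> e \<le> b}) \<le> card {e \<in> X. a < e \<and> e \<le> b}"
        by (rule card_mono[OF fin])
      then have "1 + int (card {e \<in> X. d < e \<and> e \<le> b}) \<le> int (card {e \<in> X. a < e \<and> e \<le> b})"
        using assms(2) by simp
      then have "g * (1 + int (card {e \<in> X. d < e \<and> e \<le> b})) \<le> g * int (card {e \<in> X. a < e \<and> e \<le> b})"
        using d by (intro mult_left_mono) auto
      ultimately show ?thesis using d(3) by (simp add: algebra_simps)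
    next
      case False
      have "card {b} \<le> card {e \<in> X. a < e \<and> e \<le> b}"
        using assms(4) \<open>a < b\<close> by (intro card_mono fin) auto
      then have "g * 1 \<le> g * int (card {e \<in> X. a < e \<and> e \<le> b})"
        using d by (intro mult_left_mono) auto
      then show ?thesis using d False by linarith
    qed
  next
    case True
    then have "{d \<in> X. a < d \<and> d \<le> b} = {}" by auto
    with True show ?thesis by (simp only: card.empty)
  qed
qed

lemma chain_diameter:
  assumes "chain g X" "finite X" "a \<in> X" "b \<in> X" "0 \<le> g"
  shows "\<bar>b - a\<bar> \<le> g * int (card X)"
proof -
  have "v - u \<le> g * int (card X)" if "u \<in> X" "v \<in> X" "u \<le> v" for u v
  proof -
    have "card {d \<in> X. u < d \<and> d \<le> v} \<le> card X"
      using assms(2) by (intro card_mono) auto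
    then have "g * int (card {d \<in> X. u < d \<and> d \<le> v}) \<le> g * int (card X)"
      using assms(5) by (intro mult_left_mono) auto
    with chain_diameter_aux[OF assms(1,2) that] show ?thesis by linarith
  qed
  from this[of a b] this[of b a] show ?thesis
    using assms(3,4) by linarith
qed

text \<open>A certificate that (x, y) was filled by local growth: a small cluster of initial sites
  without large gaps that holds enough of them in row y and in column x. The thresholds are those of
  places (x', y) and (x, y') with coordinates from A, because the certificate is inherited along a
  row or column from a site filled earlier.\<close>

definition local_witness ::
  "int \<Rightarrow> nat \<Rightarrow> (int \<Rightarrow> int \<Rightarrow> nat) \<Rightarrow> (int \<Rightarrow> int \<Rightarrow> nat) \<Rightarrow> (int \<times> int) set \<Rightarrow>
     int \<Rightarrow> int \<Rightarrow> (int \<times> int) set \<Rightarrow> bool" where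
  "local_witness g n kh kv S x y A \<longleftrightarrow>
     A \<subseteq> S \<and> finite A \<and> card A \<le> n \<and> chain g (fst ` A) \<and> chain g (snd ` A) \<and>
     x \<in> fst ` A \<and> y \<in> snd ` A \<and>
     ((x, y) \<in> A \<or>
      (\<exists>y'\<in>snd ` A. kv x y' \<le> card {b. (x, b) \<in> A}) \<and>
      (\<exists>x'\<in>fst ` A. kh x' y \<le> card {a. (a, y) \<in> A}))"

lemma local_witness_subset_square:
  assumes "local_witness g n kh kv S x y A" "0 \<le> g"
  shows "A \<subseteq> square (g * int n) x y"
proof
  fix z assume z: "z \<in> A"
  have *: "finite A" "card A \<le> n" "chain g (fst ` A)" "chain g (snd ` A)" "x \<in> fst ` A" "y \<in> snd ` A"
    using assms(1) by (auto simp: local_witness_def)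
  have "card (fst ` A) \<le> n" "card (snd ` A) \<le> n"
    using *(1,2) card_image_le order_trans by blast+
  then have "g * int (card (fst ` A)) \<le> g * int n" "g * int (card (snd ` A)) \<le> g * int n"
    using assms(2) by (auto intro: mult_left_mono)
  moreover have "\<bar>fst z - x\<bar> \<le> g * int (card (fst ` A))" "\<bar>snd z - y\<bar> \<le> g * int (card (snd ` A))"
    using z * assms(2) by (auto intro!: chain_diameter)
  ultimately show "z \<in> square (g * int n) x y"
    by (cases z) auto
qed

lemma card_fibre_mono:
  assumes "A \<subseteq> B" "finite B"
  shows "card {b. (x, b) \<in> A} \<le> card {b. (x, b) \<in> B}" "card {a. (a, y) \<in> A} \<le> card {a. (a, y) \<in> B}"
proof -
  have "{b. (x, b) \<in> B} \<subseteq> snd ` B" "{a. (a, y) \<in> B} \<subseteq> fst ` B" by force+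
  then have "finite {b. (x, b) \<in> B}" "finite {a. (a, y) \<in> B}"
    using assms(2) by (auto intro: finite_subset)
  then show "card {b. (x, b) \<in> A} \<le> card {b. (x, b) \<in> B}" "card {a. (a, y) \<in> A} \<le> card {a. (a, y) \<in> B}"
    using assms(1) by (auto intro: card_mono)
qed

lemma fst_converse: "fst ` (A\<inverse>) = snd ` A" and snd_converse: "snd ` (A\<inverse>) = fst ` A"
  by force+

lemma local_witness_converse:
  "local_witness g n (\<lambda>a b. kv b a) (\<lambda>a b. kh b a) (S\<inverse>) y x (A\<inverse>) \<longleftrightarrow> local_witness g n kh kv S x y A"
  unfolding local_witness_def fst_converse snd_converse by (auto simp: card_inverse)

lemma square_mono: "K + \<bar>x - x'\<bar> \<le> K' \<Longrightarrow> K + \<bar>y - y'\<bar> \<le> K' \<Longrightarrow> square K x y \<subseteq> square K' x' y'"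
  by (rule subsetI, unfold split_paired_all mem_square) linarith

text \<open>If some neighbour (a, y) is not initial, its own witness already has enough sites in row
  y and is taken over. Otherwise all neighbours in row y are initial and form the cluster
  themselves.\<close>

lemma local_witness_row:
  assumes n: "1 \<le> n" and k: "1 \<le> kh x y" "kh x y \<le> hcount \<rho> T x y"
    and IH: "\<And>a. (a, y) \<in> T \<Longrightarrow> \<exists>A. local_witness (2 * int \<rho>) n kh kv S a y A"
  shows "\<exists>A \<subseteq> S. finite A \<and> A \<subseteq> square (2 * int \<rho> * (int n + 1)) x y \<and>
    chain (2 * int \<rho>) (fst ` A) \<and> chain (2 * int \<rho>) (snd ` A) \<and> y \<in> snd ` A \<and>
    (\<exists>a\<in>fst ` A. \<bar>a - x\<bar> \<le> int \<rho>) \<and>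
    (\<exists>x'\<in>insert x (fst ` A). kh x' y \<le> card {a. (a, y) \<in> A})"
proof -
  let ?g = "2 * int \<rho>" and ?B = "square (2 * int \<rho> * (int n + 1)) x y"
  show ?thesis
  proof (cases "\<exists>a. \<bar>a - x\<bar> \<le> int \<rho> \<and> (a, y) \<in> T \<and> (a, y) \<notin> S")
    case True
    then obtain a where a: "\<bar>a - x\<bar> \<le> int \<rho>" "(a, y) \<in> T" "(a, y) \<notin> S" by blast
    obtain A where A: "local_witness ?g n kh kv S a y A" using IH[OF a(2)] by blast
    \<comment> \<open>A witness of at most n points reaches 2 \<rho> n from its site, and passing to
      a neighbour adds at most \<rho>; hence n + 1 in the radius.\<close>
    have "A \<subseteq> ?B"
      by (rule order_trans[OF local_witness_subset_square[OF A] square_mono]) (use a in \<open>auto simp: distrib_left\<close>)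
    moreover have "(a, y) \<notin> A" using A a(3) by (auto simp: local_witness_def)
    then have "A \<subseteq> S \<and> finite A \<and> chain ?g (fst ` A) \<and> chain ?g (snd ` A) \<and> y \<in> snd ` A \<and> a \<in> fst ` A"
      and "\<exists>x'\<in>insert x (fst ` A). kh x' y \<le> card {a. (a, y) \<in> A}"
      using A unfolding local_witness_def by blast+
    ultimately show ?thesis using a(1) by blast
  next
    case False
    define A where "A = (\<lambda>a. (a, y)) ` {a. \<bar>a - x\<bar> \<le> int \<rho> \<and> (a, y) \<in> T}"
    have fib: "{a. (a, y) \<in> A} = {a. \<bar>a - x\<bar> \<le> int \<rho> \<and> (a, y) \<in> T}"
      and fst: "fst ` A = {a. \<bar>a - x\<bar> \<le> int \<rho> \<and> (a, y) \<in> T}"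
      and snd: "snd ` A \<subseteq> {y}"
      by (auto simp: A_def image_iff)
    have card: "kh x y \<le> card {a. (a, y) \<in> A}"
      using k by (simp add: fib hcount_def)
    then obtain a where a: "(a, y) \<in> A"
      using k by (cases "{a. (a, y) \<in> A} = {}") auto
    then have "y \<in> snd ` A" by force
    moreover have "A \<subseteq> S" "finite A" using False by (auto simp: A_def)
    moreover have "A \<subseteq> square (int \<rho>) x y" by (auto simp: A_def)
    then have "A \<subseteq> ?B" by (rule order_trans[OF _ square_mono]) (use n in \<open>auto simp: distrib_left\<close>)
    moreover have "chain ?g (fst ` A)" by (rule chain_close[where z = x]) (auto simp: fst)
    moreover have "chain ?g (snd ` A)" by (rule chain_close[where z = y]) (use snd in force)
    moreover have "\<exists>a\<in>fst ` A. \<bar>a - x\<bar> \<le> int \<rho>" using a fst fib by blast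
    ultimately show ?thesis using card by blast
  qed
qed

text \<open>
  A union of two witnesses has at most \<open>2 * n\<close> points and therefore small diameter, hence at most
  \<open>n\<close> points by assumption; so the size bound is preserved for ever.
\<close>
lemma local_witness_exists:
  fixes S :: "nat \<Rightarrow> (int \<times> int) set"
  assumes grow: "\<And>t x y. (x, y) \<in> S (Suc t) \<Longrightarrow> (x, y) \<notin> S t \<Longrightarrow>
      1 \<le> kh x y \<and> kh x y \<le> hcount \<rho> (S t) x y \<and> 1 \<le> kv x y \<and> kv x y \<le> vcount \<rho> (S t) x y"
    and few: "\<And>x y. card (S 0 \<inter> square (2 * int \<rho> * (int n + 1)) x y) \<le> n"
    and n: "1 \<le> n"
    and "(x, y) \<in> S t"
  shows "\<exists>A. local_witness (2 * int \<rho>) n kh kv (S 0) x y A"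
  using \<open>(x, y) \<in> S t\<close>
proof (induction t arbitrary: x y)
  case 0
  then show ?case
    using n by (intro exI[of _ "{(x, y)}"]) (simp add: local_witness_def chain_def)
next
  case (Suc t)
  let ?g = "2 * int \<rho>" and ?B = "square (2 * int \<rho> * (int n + 1)) x y"
  show ?case
  proof (cases "(x, y) \<in> S t")
    case True
    then show ?thesis by (rule Suc.IH)
  next
    case False
    note k = grow[OF Suc.prems False]
    obtain A1 where A1: "A1 \<subseteq> S 0" "finite A1" "A1 \<subseteq> ?B"
        "chain ?g (fst ` A1)" "chain ?g (snd ` A1)" "y \<in> snd ` A1" "\<exists>x1\<in>fst ` A1. \<bar>x1 - x\<bar> \<le> int \<rho>"
        "\<exists>x'\<in>insert x (fst ` A1). kh x' y \<le> card {a. (a, y) \<in> A1}"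
      using local_witness_row[OF n, of kh x y \<rho> "S t" kv "S 0"] k Suc.IH by blast
    have IH': "\<exists>A. local_witness ?g n (\<lambda>a b. kv b a) (\<lambda>a b. kh b a) ((S 0)\<inverse>) b x A" if "(b, x) \<in> (S t)\<inverse>" for b
      using Suc.IH[of x b] that local_witness_converse by fastforce
    obtain A where A: "A \<subseteq> (S 0)\<inverse>" "finite A" "A \<subseteq> square (2 * int \<rho> * (int n + 1)) y x"
        "chain ?g (fst ` A)" "chain ?g (snd ` A)" "x \<in> snd ` A" "\<exists>y1\<in>fst ` A. \<bar>y1 - y\<bar> \<le> int \<rho>"
        "\<exists>y'\<in>insert y (fst ` A). kv x y' \<le> card {b. (b, x) \<in> A}"
      using local_witness_row[OF n, of "\<lambda>a b. kv b a" y x \<rho> "(S t)\<inverse>" "\<lambda>a b. kh b a" "(S 0)\<inverse>"] k IH'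
      by (auto simp: hcount_def vcount_def)
    define A2 where "A2 = A\<inverse>"
    have A2: "A2 \<subseteq> S 0" "finite A2" "A2 \<subseteq> ?B"
        "chain ?g (fst ` A2)" "chain ?g (snd ` A2)" "x \<in> fst ` A2" "\<exists>y1\<in>snd ` A2. \<bar>y1 - y\<bar> \<le> int \<rho>"
        "\<exists>y'\<in>insert y (snd ` A2). kv x y' \<le> card {b. (x, b) \<in> A2}"
      using A unfolding A2_def fst_converse snd_converse by (auto simp: square_def)
    \<comment> \<open>A1 contains the height y and A2 a height within \<rho> of it; for the
      abscissae the roles are exchanged. So joining the two clusters creates no gap beyond 2
      \<rho>.\<close>
    let ?A = "A1 \<union> A2"
    have fibres: "card {a. (a, y) \<in> A1} \<le> card {a. (a, y) \<in> ?A}"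
      "card {b. (x, b) \<in> A2} \<le> card {b. (x, b) \<in> ?A}"
      using card_fibre_mono[of _ ?A] A1(2) A2(2) by auto
    have "chain ?g (fst ` A1 \<union> fst ` A2)"
    proof -
      obtain x1 where "x1 \<in> fst ` A1" "\<bar>x1 - x\<bar> \<le> int \<rho>" using A1(7) by blast
      then show ?thesis by (intro chain_union[OF A1(4) A2(4) _ A2(6)]) auto
    qed
    moreover have "chain ?g (snd ` A1 \<union> snd ` A2)"
    proof -
      obtain y1 where "y1 \<in> snd ` A2" "\<bar>y1 - y\<bar> \<le> int \<rho>" using A2(7) by blast
      then show ?thesis by (intro chain_union[OF A1(5) A2(5) A1(6)]) auto
    qed
    moreover have "\<exists>y'\<in>snd ` ?A. kv x y' \<le> card {b. (x, b) \<in> ?A}"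
    proof -
      obtain y' where y': "y' \<in> insert y (snd ` A2)" "kv x y' \<le> card {b. (x, b) \<in> A2}"
        using A2(8) by blast
      have "y' \<in> snd ` ?A" using y'(1) A1(6) by (auto simp: image_Un)
      with y'(2) fibres(2) show ?thesis using order_trans by blast
    qed
    moreover have "\<exists>x'\<in>fst ` ?A. kh x' y \<le> card {a. (a, y) \<in> ?A}"
    proof -
      obtain x' where x': "x' \<in> insert x (fst ` A1)" "kh x' y \<le> card {a. (a, y) \<in> A1}"
        using A1(8) by blast
      have "x' \<in> fst ` ?A" using x'(1) A2(6) by (auto simp: image_Un)
      with x'(2) fibres(1) show ?thesis using order_trans by blast
    qed
    moreover have "card ?A \<le> card (S 0 \<inter> ?B)" using A1(1,3) A2(1,3) by (intro card_mono) auto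
    then have "card ?A \<le> n" using few[of x y] by (rule order_trans)
    ultimately have "local_witness ?g n kh kv (S 0) x y ?A"
      using A1(1,2,6) A2(1,2,6) unfolding local_witness_def by (auto simp: image_Un)
    then show ?thesis by blast
  qed
qed

section \<open>Sparse configurations\<close>

text \<open>
  A coordinate different from \<open>0\<close> can be chosen in about \<open>p powr (- \<gamma>)\<close> ways, which balances the
  probability of \<open>\<gamma>\<close> occupied sites; the coordinates of the origin are given and cost nothing.
\<close>
definition sparse :: "real \<Rightarrow> int \<Rightarrow> nat \<Rightarrow> (int \<times> int) set \<Rightarrow> bool" where
  "sparse \<gamma> K N X \<longleftrightarrow>
     (\<forall>LX LY. finite LX \<and> finite LY \<and> card LX \<le> N \<and> card LY \<le> N \<longrightarrow>
        (let n = card (X \<inter> (\<Union>x\<in>LX. \<Union>y\<in>LY. square K x y)) in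
         n = 0 \<or> real n < \<gamma> * real (card (LX - {0}) + card (LY - {0}))))"

text \<open>The arguments exhibit only some of the points near a grid, while \<open>sparse\<close>
  counts all of them; that A is nonempty excludes the first alternative there.\<close>

lemma sparse_less0:
  assumes "sparse \<gamma> K N X" "0 \<le> \<gamma>" "finite LX" "finite LY" "card LX \<le> N" "card LY \<le> N"
    and "A \<subseteq> X" "\<And>a b. (a, b) \<in> A \<Longrightarrow> \<exists>x\<in>LX. \<exists>y\<in>LY. \<bar>a - x\<bar> \<le> K \<and> \<bar>b - y\<bar> \<le> K" "A \<noteq> {}"
  shows "real (card A) < \<gamma> * real (card (LX - {0}) + card (LY - {0}))"
proof -
  define B where "B = X \<inter> (\<Union>x\<in>LX. \<Union>y\<in>LY. square K x y)"
  have fin: "finite B" using assms(3,4) by (auto simp: B_def)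
  have sub: "A \<subseteq> B"
  proof (rule subsetI, unfold split_paired_all)
    fix a b assume ab: "(a, b) \<in> A"
    then obtain x y where "x \<in> LX" "y \<in> LY" "(a, b) \<in> square K x y"
      using assms(8)[OF ab] by (auto simp: mem_square)
    then show "(a, b) \<in> B" using assms(7) ab unfolding B_def by blast
  qed
  then have "B \<noteq> {}" using assms(9) by blast
  then have "card B \<noteq> 0" using fin by simp
  then have "real (card B) < \<gamma> * real (card (LX - {0}) + card (LY - {0}))"
    using assms(1)[unfolded sparse_def Let_def, rule_format, of LX LY] assms(3-6) unfolding B_def by simp
  moreover have "card A \<le> card B" by (rule card_mono[OF fin sub])
  ultimately show ?thesis by linarith
qed

lemma sparse_less:
  assumes "sparse \<gamma> K N X" "0 \<le> \<gamma>" "finite LX" "finite LY" "card LX \<le> N" "card LY \<le> N"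
    and "A \<subseteq> X" "\<And>a b. (a, b) \<in> A \<Longrightarrow> \<exists>x\<in>LX. \<exists>y\<in>LY. \<bar>a - x\<bar> \<le> K \<and> \<bar>b - y\<bar> \<le> K" "A \<noteq> {}"
    and "card LX + card LY \<le> k"
  shows "real (card A) < \<gamma> * real k"
proof -
  have "card (LX - {0}) + card (LY - {0}) \<le> k"
    using assms(10) card_Diff1_le[of LX 0] card_Diff1_le[of LY 0] by linarith
  then have "\<gamma> * real (card (LX - {0}) + card (LY - {0})) \<le> \<gamma> * real k"
    using assms(2) by (intro mult_left_mono) auto
  with sparse_less0[OF assms(1-9)] show ?thesis by linarith
qed

text \<open>One square costs two coordinates and so holds fewer than 2 \<gamma> points; this is
  where the cluster size n comes from.\<close>

lemma sparse_square:
  assumes "sparse \<gamma> K N X" "0 \<le> \<gamma>" "1 \<le> N" "2 * \<gamma> \<le> real n" "K' \<le> K"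
  shows "card (X \<inter> square K' x y) \<le> n"
proof (cases "X \<inter> square K' x y = {}")
  case False
  have "real (card (X \<inter> square K' x y)) < \<gamma> * real 2"
    by (rule sparse_less[OF assms(1,2), of "{x}" "{y}"]) (use assms False in auto)
  with assms(4) show ?thesis by linarith
qed simp

lemma sparse_converse:
  assumes "sparse \<gamma> K N X"
  shows "sparse \<gamma> K N (X\<inverse>)"
  unfolding sparse_def Let_def
proof (intro allI impI)
  fix LX LY :: "int set"
  assume L: "finite LX \<and> finite LY \<and> card LX \<le> N \<and> card LY \<le> N"
  have "X\<inverse> \<inter> (\<Union>x\<in>LX. \<Union>y\<in>LY. square K x y) = (X \<inter> (\<Union>x\<in>LY. \<Union>y\<in>LX. square K x y))\<inverse>"
    by (auto simp: square_eq)
  then show "card (X\<inverse> \<inter> (\<Union>x\<in>LX. \<Union>y\<in>LY. square K x y)) = 0 \<or>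
     real (card (X\<inverse> \<inter> (\<Union>x\<in>LX. \<Union>y\<in>LY. square K x y))) < \<gamma> * real (card (LX - {0}) + card (LY - {0}))"
    using assms[unfolded sparse_def Let_def, rule_format, of LY LX] L
    by (simp add: card_inverse add.commute)
qed

section \<open>Good rows and columns\<close>

text \<open>Strictly earlier times, because a site with r neighbours at time t' is occupied only at
  t' + 1. An occupied site that is off the good lines at time t is therefore either initial or was
  filled by the mixed rule with s1 and s2.\<close>

definition good_rows :: "nat \<Rightarrow> nat \<Rightarrow> (nat \<Rightarrow> (int \<times> int) set) \<Rightarrow> nat \<Rightarrow> int set" where
  "good_rows \<rho> r \<xi> t = {y. \<exists>t'<t. \<exists>x. r \<le> hcount \<rho> (\<xi> t') x y}"

definition good_cols :: "nat \<Rightarrow> nat \<Rightarrow> (nat \<Rightarrow> (int \<times> int) set) \<Rightarrow> nat \<Rightarrow> int set" where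
  "good_cols \<rho> r \<xi> t = {x. \<exists>t'<t. \<exists>y. r \<le> vcount \<rho> (\<xi> t') x y}"

definition near :: "int \<Rightarrow> int set \<Rightarrow> int \<Rightarrow> int set" where
  "near K L x = {a. \<bar>a - x\<bar> \<le> K \<and> a \<in> L}"

lemma finite_near [simp]: "finite (near K L x)"
  by (simp add: near_def)

lemma card_near_mono: "L \<subseteq> L' \<Longrightarrow> K \<le> K' \<Longrightarrow> card (near K L x) \<le> card (near K' L' x)"
  by (rule card_mono) (auto simp: near_def)

lemma hcount_converse [simp]: "hcount \<rho> (X\<inverse>) x y = vcount \<rho> X y x"
  and vcount_converse [simp]: "vcount \<rho> (X\<inverse>) x y = hcount \<rho> X y x"
  by (simp_all add: hcount_def vcount_def)

lemma good_rows_converse [simp]: "good_rows \<rho> r (\<lambda>t. (\<xi> t)\<inverse>) t = good_cols \<rho> r \<xi> t"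
  and good_cols_converse [simp]: "good_cols \<rho> r (\<lambda>t. (\<xi> t)\<inverse>) t = good_rows \<rho> r \<xi> t"
  by (simp_all add: good_rows_def good_cols_def)

locale cross_growth =
  fixes \<rho> r s1 s2 :: nat and \<xi> :: "nat \<Rightarrow> (int \<times> int) set"
  assumes mono: "\<xi> t \<subseteq> \<xi> (Suc t)"
    and step: "(x, y) \<in> \<xi> (Suc t) \<Longrightarrow> (x, y) \<in> \<xi> t \<or> r \<le> hcount \<rho> (\<xi> t) x y \<or>
        r \<le> vcount \<rho> (\<xi> t) x y \<or> s1 \<le> hcount \<rho> (\<xi> t) x y \<and> s2 \<le> vcount \<rho> (\<xi> t) x y"
begin

abbreviation "R \<equiv> good_rows \<rho> r \<xi>"
abbreviation "C \<equiv> good_cols \<rho> r \<xi>"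

definition off :: "nat \<Rightarrow> (int \<times> int) set" where
  "off t = {(x, y). x \<notin> C t \<and> y \<notin> R t}"

definition limited :: "int \<Rightarrow> nat \<Rightarrow> nat \<Rightarrow> bool" where
  "limited W m t \<longleftrightarrow> (\<forall>a. card (near W (R t) a) < m \<and> card (near W (C t) a) < m)"

text \<open>Transposition exchanges rows with columns and s1 with s2, so that most statements are
  proved for rows only.\<close>

lemma converse_growth: "cross_growth \<rho> r s2 s1 (\<lambda>t. (\<xi> t)\<inverse>)"
proof
  fix x y t
  show "(\<xi> t)\<inverse> \<subseteq> (\<xi> (Suc t))\<inverse>" using mono[of t] by auto
  assume "(x, y) \<in> (\<xi> (Suc t))\<inverse>"
  then show "(x, y) \<in> (\<xi> t)\<inverse> \<or> r \<le> hcount \<rho> ((\<xi> t)\<inverse>) x y \<or> r \<le> vcount \<rho> ((\<xi> t)\<inverse>) x y \<or>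
      s2 \<le> hcount \<rho> ((\<xi> t)\<inverse>) x y \<and> s1 \<le> vcount \<rho> ((\<xi> t)\<inverse>) x y"
    using step[of y x t] by auto
qed

lemma mono': "t \<le> t' \<Longrightarrow> \<xi> t \<subseteq> \<xi> t'"
  using lift_Suc_mono_le[of \<xi>, OF mono] .

lemma R_mono: "t \<le> t' \<Longrightarrow> R t \<subseteq> R t'"
  unfolding good_rows_def by force

lemma C_mono: "t \<le> t' \<Longrightarrow> C t \<subseteq> C t'"
  unfolding good_cols_def by force

lemma R_birth: "y \<in> R t \<Longrightarrow> \<exists>t'<t. y \<notin> R t' \<and> y \<in> R (Suc t')"
proof -
  assume "y \<in> R t"
  moreover have "y \<notin> R 0" by (simp add: good_rows_def)
  ultimately show ?thesis using ex_least_nat_less[of "\<lambda>t. y \<in> R t" t] by blast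
qed

lemma C_birth: "x \<in> C t \<Longrightarrow> \<exists>t'<t. x \<notin> C t' \<and> x \<in> C (Suc t')"
proof -
  assume "x \<in> C t"
  moreover have "x \<notin> C 0" by (simp add: good_cols_def)
  ultimately show ?thesis using ex_least_nat_less[of "\<lambda>t. x \<in> C t" t] by blast
qed

lemma limited_0: "1 \<le> m \<Longrightarrow> limited W m 0"
  by (simp add: limited_def good_rows_def good_cols_def near_def)

text \<open>What is left of the threshold s1 when every good column near x supplies an occupied
  neighbour.\<close>

definition kh :: "nat \<Rightarrow> int \<Rightarrow> int \<Rightarrow> nat" where
  "kh t x y = s1 - card (near (int \<rho>) (C t) x)"

definition kv :: "nat \<Rightarrow> int \<Rightarrow> int \<Rightarrow> nat" where
  "kv t x y = s2 - card (near (int \<rho>) (R t) y)"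

lemma witness:
  assumes few: "\<And>x y. card (\<xi> 0 \<inter> square (2 * int \<rho> * (int n + 1)) x y) \<le> n" and "1 \<le> n"
    and lim: "\<And>a. card (near (int \<rho>) (R t) a) < s2" "\<And>a. card (near (int \<rho>) (C t) a) < s1"
    and xy: "(x, y) \<in> \<xi> t" "(x, y) \<in> off t"
  shows "\<exists>A. local_witness (2 * int \<rho>) n (kh t) (kv t) (\<xi> 0 \<inter> off t) x y A"
proof -
  \<comment> \<open>The good lines of the final time t are removed at every stage, and the growth is
    frozen at t. The thresholds \<open>kh t\<close> and \<open>kv t\<close> are then the same at all
    stages, and \<open>lim\<close> makes them positive.\<close>
  define S where "S i = \<xi> (min i t) \<inter> off t" for i
  have "\<exists>A. local_witness (2 * int \<rho>) n (kh t) (kv t) (S 0) x y A"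
  proof (rule local_witness_exists)
    show "(x, y) \<in> S t" using xy by (simp add: S_def)
    show "card (S 0 \<inter> square (2 * int \<rho> * (int n + 1)) x y) \<le> n" for x y
    proof -
      have "card (S 0 \<inter> square (2 * int \<rho> * (int n + 1)) x y) \<le> card (\<xi> 0 \<inter> square (2 * int \<rho> * (int n + 1)) x y)"
        by (rule card_mono) (auto simp: S_def)
      then show ?thesis using few[of x y] by (rule order_trans)
    qed
    fix i a b assume ab: "(a, b) \<in> S (Suc i)" "(a, b) \<notin> S i"
    then have i: "i < t" using mono'[of t i] by (cases "i < t") (auto simp: S_def)
    with ab have new: "(a, b) \<in> \<xi> (Suc i)" "(a, b) \<notin> \<xi> i" and off: "a \<notin> C t" "b \<notin> R t"
      by (auto simp: S_def off_def)
    have "\<not> r \<le> hcount \<rho> (\<xi> i) a b" "\<not> r \<le> vcount \<rho> (\<xi> i) a b"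
      using off i unfolding good_cols_def good_rows_def by blast+
    then have s: "s1 \<le> hcount \<rho> (\<xi> i) a b" "s2 \<le> vcount \<rho> (\<xi> i) a b"
      using step[OF new(1)] new(2) by auto
    have Si: "S i = \<xi> i \<inter> off t" using i by (simp add: S_def)
    have "hcount \<rho> (\<xi> i) a b \<le>
        card ({a'. \<bar>a' - a\<bar> \<le> int \<rho> \<and> (a', b) \<in> S i} \<union> near (int \<rho>) (C t) a)"
      unfolding hcount_def by (rule card_mono) (use off in \<open>auto simp: near_def Si off_def\<close>)
    also have "\<dots> \<le> hcount \<rho> (S i) a b + card (near (int \<rho>) (C t) a)"
      unfolding hcount_def by (rule card_Un_le)
    finally have h: "hcount \<rho> (\<xi> i) a b \<le> hcount \<rho> (S i) a b + card (near (int \<rho>) (C t) a)" .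
    have "vcount \<rho> (\<xi> i) a b \<le>
        card ({b'. \<bar>b' - b\<bar> \<le> int \<rho> \<and> (a, b') \<in> S i} \<union> near (int \<rho>) (R t) b)"
      unfolding vcount_def by (rule card_mono) (use off in \<open>auto simp: near_def Si off_def\<close>)
    also have "\<dots> \<le> vcount \<rho> (S i) a b + card (near (int \<rho>) (R t) b)"
      unfolding vcount_def by (rule card_Un_le)
    finally have v: "vcount \<rho> (\<xi> i) a b \<le> vcount \<rho> (S i) a b + card (near (int \<rho>) (R t) b)" .
    show "1 \<le> kh t a b \<and> kh t a b \<le> hcount \<rho> (S i) a b \<and>
        1 \<le> kv t a b \<and> kv t a b \<le> vcount \<rho> (S i) a b"
      using h v s lim(1)[of b] lim(2)[of a] unfolding kh_def kv_def by linarith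
  qed fact
  then show ?thesis by (simp add: S_def)
qed

text \<open>The part of the witness that concerns column x. The birth of a row uses r sites in
  different columns, so counting by columns is what is needed.\<close>

lemma off_witness:
  assumes few: "\<And>x y. card (\<xi> 0 \<inter> square (2 * int \<rho> * (int n + 1)) x y) \<le> n" and "1 \<le> n"
    and lim: "\<And>a. card (near (int \<rho>) (R t) a) < s2" "\<And>a. card (near (int \<rho>) (C t) a) < s1"
    and xy: "(x, y) \<in> \<xi> t" "(x, y) \<in> off t"
  defines "D \<equiv> 2 * int \<rho> * int n"
  shows "\<exists>b. \<bar>b - y\<bar> \<le> D \<and> (x, b) \<in> \<xi> 0 \<inter> off t"
    and "(x, y) \<in> \<xi> 0 \<or> (\<exists>y'. \<bar>y' - y\<bar> \<le> D \<and>
            kv t x y' \<le> card {b. \<bar>b - y\<bar> \<le> D \<and> (x, b) \<in> \<xi> 0 \<inter> off t})"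
proof -
  obtain A where A: "local_witness (2 * int \<rho>) n (kh t) (kv t) (\<xi> 0 \<inter> off t) x y A"
    using witness[OF assms(1-6)] by blast
  have sub: "A \<subseteq> \<xi> 0 \<inter> off t" and x: "x \<in> fst ` A" using A by (auto simp: local_witness_def)
  have square: "A \<subseteq> square D x y" using local_witness_subset_square[OF A] by (simp add: D_def)
  have ball: "\<bar>b - y\<bar> \<le> D" if "(a, b) \<in> A" for a b using square that by auto
  show "\<exists>b. \<bar>b - y\<bar> \<le> D \<and> (x, b) \<in> \<xi> 0 \<inter> off t"
  proof -
    obtain b where "(x, b) \<in> A" using x by force
    then show ?thesis using sub ball by blast
  qed
  show "(x, y) \<in> \<xi> 0 \<or> (\<exists>y'. \<bar>y' - y\<bar> \<le> D \<and>
            kv t x y' \<le> card {b. \<bar>b - y\<bar> \<le> D \<and> (x, b) \<in> \<xi> 0 \<inter> off t})"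
  proof (cases "(x, y) \<in> A")
    case False
    then obtain y' where y': "y' \<in> snd ` A" "kv t x y' \<le> card {b. (x, b) \<in> A}"
      using A unfolding local_witness_def by blast
    have "card {b. (x, b) \<in> A} \<le> card {b. \<bar>b - y\<bar> \<le> D \<and> (x, b) \<in> \<xi> 0 \<inter> off t}"
      using sub ball by (intro card_mono) auto
    then have "kv t x y' \<le> card {b. \<bar>b - y\<bar> \<le> D \<and> (x, b) \<in> \<xi> 0 \<inter> off t}"
      using y'(2) by (rule order_trans[rotated])
    moreover have "\<bar>y' - y\<bar> \<le> D" using y'(1) ball by auto
    ultimately show ?thesis by blast
  qed (use sub in auto)
qed

text \<open>As y is not yet good, a neighbour in row y is off the good lines unless its column is
  good.\<close>

lemma row_birth:
  assumes "y \<in> R (Suc t)" "y \<notin> R t"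
  shows "\<exists>x. r \<le> card {c. \<bar>c - x\<bar> \<le> int \<rho> \<and> (c, y) \<in> \<xi> t \<inter> off t} + card (near (int \<rho>) (C t) x)"
proof -
  obtain x where x: "r \<le> hcount \<rho> (\<xi> t) x y"
    using assms unfolding good_rows_def by (auto simp: less_Suc_eq)
  note x
  also have "hcount \<rho> (\<xi> t) x y \<le> card ({c. \<bar>c - x\<bar> \<le> int \<rho> \<and> (c, y) \<in> \<xi> t \<inter> off t} \<union> near (int \<rho>) (C t) x)"
    unfolding hcount_def by (rule card_mono) (use assms in \<open>auto simp: near_def off_def\<close>)
  also note card_Un_le
  finally show ?thesis by blast
qed

end

section \<open>Limited numbers of good lines\<close>

text \<open>n bounds the points in one square, and K leaves room for two clusters of radius 2 \<rho>
  n and a few steps of length \<rho>. With fewer than m good lines near a place, m \<le> s1 and m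
  \<le> s2 keep the reduced thresholds positive, and m \<le> r keeps r + 1 - m positive.\<close>

locale sparse_growth = cross_growth +
  fixes \<gamma> :: real and K :: int and N n m :: nat
  assumes sparse: "sparse \<gamma> K N (\<xi> 0)"
    and \<gamma>: "0 \<le> \<gamma>" and N: "1 \<le> N" and n: "2 * \<gamma> \<le> real n" "1 \<le> n"
    and K: "4 * int \<rho> * (int n + 1) \<le> K"
    and m: "1 \<le> m" "m \<le> s1" "m \<le> s2" "m \<le> r"
begin

definition D :: int where "D = 2 * int \<rho> * int n"

lemma D: "0 \<le> D" "int \<rho> \<le> D" "2 * D + 4 * int \<rho> \<le> K"
proof -
  have "2 * int \<rho> * 1 \<le> 2 * int \<rho> * int n" using n(2) by (intro mult_left_mono) auto
  then show "0 \<le> D" "int \<rho> \<le> D" by (auto simp: D_def)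
  show "2 * D + 4 * int \<rho> \<le> K" using K by (simp add: D_def distrib_left)
qed

lemma converse_sparse: "sparse_growth \<rho> r s2 s1 (\<lambda>t. (\<xi> t)\<inverse>) \<gamma> K N n m"
proof -
  interpret T: cross_growth \<rho> r s2 s1 "\<lambda>t. (\<xi> t)\<inverse>" by (rule converse_growth)
  show ?thesis by standard (use sparse_converse[OF sparse] \<gamma> N n K m in auto)
qed

lemma few: "card (\<xi> 0 \<inter> square (2 * int \<rho> * (int n + 1)) x y) \<le> n"
proof (rule sparse_square[OF sparse \<gamma> N n(1)])
  have "0 \<le> 2 * int \<rho> * (int n + 1)" by simp
  then show "2 * int \<rho> * (int n + 1) \<le> K" using K by linarith
qed

lemma limited_near:
  assumes "limited (int \<rho>) m t"
  shows "card (near (int \<rho>) (R t) a) < s2" "card (near (int \<rho>) (C t) a) < s1"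
proof -
  have "card (near (int \<rho>) (R t) a) < m" "card (near (int \<rho>) (C t) a) < m"
    using assms unfolding limited_def by blast+
  then show "card (near (int \<rho>) (R t) a) < s2" "card (near (int \<rho>) (C t) a) < s1"
    using m by linarith+
qed

lemma off_points:
  assumes "limited (int \<rho>) m t" "(x, y) \<in> \<xi> t" "(x, y) \<in> off t"
  shows "\<exists>b. \<bar>b - y\<bar> \<le> D \<and> (x, b) \<in> \<xi> 0 \<inter> off t"
    and "(x, y) \<in> \<xi> 0 \<or> (\<exists>y'. \<bar>y' - y\<bar> \<le> D \<and>
            s2 - card (near (int \<rho>) (R t) y') \<le> card {b. \<bar>b - y\<bar> \<le> D \<and> (x, b) \<in> \<xi> 0 \<inter> off t})"
  using off_witness[OF few n(2) limited_near(1)[OF assms(1)] limited_near(2)[OF assms(1)] assms(2,3)]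
  unfolding D_def kv_def by blast+

text \<open>Q stands for the sites of row y that made it good and do not lie on good columns. Each
  of their columns holds an initial site near y, and, where (c, y) itself is not initial, as many as
  remain of s2 after subtracting the good rows near some y'.\<close>

definition row_source :: "nat \<Rightarrow> int \<Rightarrow> int \<Rightarrow> int set \<Rightarrow> bool" where
  "row_source t y x Q \<longleftrightarrow> finite Q \<and> r \<le> card Q + card (near (int \<rho>) (C t) x) \<and>
     (\<forall>c\<in>Q. \<bar>c - x\<bar> \<le> int \<rho> \<and> c \<notin> C t \<and>
       (\<exists>b. \<bar>b - y\<bar> \<le> D \<and> (c, b) \<in> \<xi> 0 \<inter> off t) \<and>
       ((c, y) \<in> \<xi> 0 \<or> (\<exists>y'. \<bar>y' - y\<bar> \<le> D \<and>
          s2 - card (near (int \<rho>) (R t) y') \<le> card {b. \<bar>b - y\<bar> \<le> D \<and> (c, b) \<in> \<xi> 0 \<inter> off t})))"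

lemma row_source_exists:
  assumes "limited (int \<rho>) m t" "y \<in> R (Suc t)" "y \<notin> R t"
  shows "\<exists>x Q. row_source t y x Q"
proof -
  obtain x where x: "r \<le> card {c. \<bar>c - x\<bar> \<le> int \<rho> \<and> (c, y) \<in> \<xi> t \<inter> off t} + card (near (int \<rho>) (C t) x)"
    using row_birth[OF assms(2,3)] by blast
  have "row_source t y x {c. \<bar>c - x\<bar> \<le> int \<rho> \<and> (c, y) \<in> \<xi> t \<inter> off t}"
    unfolding row_source_def
  proof (intro conjI ballI)
    fix c assume "c \<in> {c. \<bar>c - x\<bar> \<le> int \<rho> \<and> (c, y) \<in> \<xi> t \<inter> off t}"
    then have c: "\<bar>c - x\<bar> \<le> int \<rho>" "(c, y) \<in> \<xi> t" "(c, y) \<in> off t" by auto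
    show "\<bar>c - x\<bar> \<le> int \<rho>" by fact
    show "c \<notin> C t" using c(3) by (simp add: off_def)
    note p = off_points[OF assms(1) c(2,3)]
    show "\<exists>b. \<bar>b - y\<bar> \<le> D \<and> (c, b) \<in> \<xi> 0 \<inter> off t" by (fact p(1))
    show "(c, y) \<in> \<xi> 0 \<or> (\<exists>y'. \<bar>y' - y\<bar> \<le> D \<and>
          s2 - card (near (int \<rho>) (R t) y') \<le> card {b. \<bar>b - y\<bar> \<le> D \<and> (c, b) \<in> \<xi> 0 \<inter> off t})"
      by (fact p(2))
  qed (use x in auto)
  then show ?thesis by blast
qed

lemma row_source_card:
  assumes "limited (int \<rho>) m t" "row_source t y x Q"
  shows "r + 1 - m \<le> card Q"
proof -
  have "card (near (int \<rho>) (C t) x) < m" using assms(1) unfolding limited_def by blast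
  moreover have "r \<le> card Q + card (near (int \<rho>) (C t) x)" using assms(2) unfolding row_source_def by blast
  ultimately show ?thesis by linarith
qed

text \<open>One initial site is chosen in each column of Q; sites in different columns are
  distinct.\<close>

lemma row_source_points:
  assumes "row_source t y x Q"
  obtains A where "A \<subseteq> \<xi> 0 \<inter> off t" "finite A" "card A = card Q" "fst ` A = Q"
    "\<And>a b. (a, b) \<in> A \<Longrightarrow> \<bar>a - x\<bar> \<le> int \<rho> \<and> \<bar>b - y\<bar> \<le> D"
proof -
  have "\<forall>c\<in>Q. \<exists>b. \<bar>b - y\<bar> \<le> D \<and> (c, b) \<in> \<xi> 0 \<inter> off t"
    using assms unfolding row_source_def by blast
  then obtain f where f: "\<forall>c\<in>Q. \<bar>f c - y\<bar> \<le> D \<and> (c, f c) \<in> \<xi> 0 \<inter> off t"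
    using bchoice[of Q "\<lambda>c b. \<bar>b - y\<bar> \<le> D \<and> (c, b) \<in> \<xi> 0 \<inter> off t"] by blast
  have Q: "finite Q" "\<forall>c\<in>Q. \<bar>c - x\<bar> \<le> int \<rho>" using assms unfolding row_source_def by blast+
  show thesis
  proof (rule that)
    show "card ((\<lambda>c. (c, f c)) ` Q) = card Q" by (rule card_image) (simp add: inj_on_def)
    show "fst ` (\<lambda>c. (c, f c)) ` Q = Q" by (simp add: image_image)
  qed (use f Q in auto)
qed

text \<open>Its witness would put an initial site into column 0 at bounded height, hence near the
  coordinates of the origin, which cost nothing.\<close>

lemma origin_off:
  assumes "limited (int \<rho>) m t" "(0, 0) \<in> \<xi> t" "(0, 0) \<in> off t"
  shows False
proof -
  obtain b where b: "\<bar>b - 0\<bar> \<le> D" "(0, b) \<in> \<xi> 0 \<inter> off t"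
    using off_points(1)[OF assms] by blast
  have "real (card {(0 :: int, b)}) < \<gamma> * real (card ({0 :: int} - {0}) + card ({0 :: int} - {0}))"
    by (rule sparse_less0[OF sparse \<gamma>]) (use b N D in auto)
  then show False by simp
qed

text \<open>The height 0 is free, so the birth of row 0 costs only the coordinate x, and yet it
  needs r + 1 - m initial sites.\<close>

lemma zero_not_in_R:
  assumes lim: "\<And>t'. t' < t \<Longrightarrow> limited (int \<rho>) m t'" and \<gamma>r: "\<gamma> \<le> real (r + 1 - m)"
  shows "0 \<notin> R t"
proof
  assume "0 \<in> R t"
  then obtain t' where t': "t' < t" "0 \<notin> R t'" "0 \<in> R (Suc t')" using R_birth by blast
  obtain x Q where Q: "row_source t' 0 x Q" using row_source_exists[OF lim t'(3,2)] t'(1) by blast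
  obtain A where A: "A \<subseteq> \<xi> 0 \<inter> off t'" "finite A" "card A = card Q"
    "\<And>a b. (a, b) \<in> A \<Longrightarrow> \<bar>a - x\<bar> \<le> int \<rho> \<and> \<bar>b - 0\<bar> \<le> D"
    using row_source_points[OF Q] by blast
  have card: "r + 1 - m \<le> card A" using row_source_card[OF lim[OF t'(1)] Q] A(3) by simp
  moreover have "1 \<le> r + 1 - m" using m by linarith
  ultimately have "A \<noteq> {}" by auto
  have "real (card A) < \<gamma> * real (card ({x} - {0}) + card ({0 :: int} - {0}))"
  proof (rule sparse_less0[OF sparse \<gamma>])
    fix a b assume "(a, b) \<in> A"
    then show "\<exists>x'\<in>{x}. \<exists>y\<in>{0}. \<bar>a - x'\<bar> \<le> K \<and> \<bar>b - y\<bar> \<le> K" using A(4)[of a b] D by auto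
  qed (use A N \<open>A \<noteq> {}\<close> in auto)
  also have "\<dots> \<le> \<gamma> * 1" using \<gamma> by (intro mult_left_mono) (auto simp: card_Diff_singleton_if)
  finally show False using card \<gamma>r by linarith
qed

end

lemma card_Sigma_swap:
  assumes "finite M" "\<And>y. y \<in> M \<Longrightarrow> finite (Q y)"
  shows "(\<Sum>y\<in>M. card (Q y)) = (\<Sum>c\<in>(\<Union>y\<in>M. Q y). card {y \<in> M. c \<in> Q y})"
proof -
  have "(\<Sum>c\<in>(\<Union>y\<in>M. Q y). card {y \<in> M. c \<in> Q y}) = card (SIGMA c:(\<Union>y\<in>M. Q y). {y \<in> M. c \<in> Q y})"
    using assms by (intro card_SigmaI[symmetric]) auto
  also have "(SIGMA c:(\<Union>y\<in>M. Q y). {y \<in> M. c \<in> Q y}) = (Sigma M Q)\<inverse>" by auto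
  also have "card ((Sigma M Q)\<inverse>) = card (Sigma M Q)" by simp
  also have "\<dots> = (\<Sum>y\<in>M. card (Q y))" using assms by (intro card_SigmaI) auto
  finally show ?thesis by (rule sym)
qed

context sparse_growth
begin

text \<open>
  A site \<open>(c, y)\<close> used by one of the \<open>m\<close> rows is either initially occupied, or its column contains
  at least \<open>m\<close> initially occupied sites nearby.  Either way the column \<open>c\<close> contains as many of them
  as there are rows using it.
\<close>
lemma rows_limited_Suc:
  assumes m2: "2 * m \<le> s1 + 1" "2 * m \<le> s2 + 1" and mN: "m \<le> N"
    and \<gamma>m: "\<gamma> * real (m + 1) \<le> real (m * (r + 1 - m))"
    and lim: "\<And>t'. t' \<le> t \<Longrightarrow> limited (int \<rho>) m t'"
  shows "card (near (int \<rho>) (R (Suc t)) y0) < m"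
proof (rule ccontr)
  assume "\<not> ?thesis"
  then have "m \<le> card (near (int \<rho>) (R (Suc t)) y0)" by simp
  then obtain M where M: "M \<subseteq> near (int \<rho>) (R (Suc t)) y0" "card M = m"
    by (rule obtain_subset_with_card_n)
  have finM: "finite M" using M(1) finite_near finite_subset by blast
  define P where "P y x Q \<longleftrightarrow> finite Q \<and> r + 1 - m \<le> card Q \<and> (\<forall>c\<in>Q. \<bar>c - x\<bar> \<le> int \<rho> \<and>
       ((c, y) \<in> \<xi> 0 \<or> m \<le> card {b. \<bar>b - y\<bar> \<le> D \<and> (c, b) \<in> \<xi> 0}))" for y x :: int and Q
  have "\<exists>x Q. P y x Q" if "y \<in> M" for y
  proof -
    have "y \<in> R (Suc t)" using that M(1) by (auto simp: near_def)
    then obtain t' where t': "t' < Suc t" "y \<notin> R t'" "y \<in> R (Suc t')" using R_birth by blast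
    then have l: "limited (int \<rho>) m t'" by (intro lim) simp
    obtain x Q where Q: "row_source t' y x Q" using row_source_exists[OF l t'(3,2)] by blast
    have "P y x Q" unfolding P_def
    proof (intro conjI ballI)
      fix c assume c: "c \<in> Q"
      show "\<bar>c - x\<bar> \<le> int \<rho>" using Q c unfolding row_source_def by blast
      show "(c, y) \<in> \<xi> 0 \<or> m \<le> card {b. \<bar>b - y\<bar> \<le> D \<and> (c, b) \<in> \<xi> 0}"
      proof (cases "(c, y) \<in> \<xi> 0")
        case False
        then obtain y' where y': "s2 - card (near (int \<rho>) (R t') y') \<le>
            card {b. \<bar>b - y\<bar> \<le> D \<and> (c, b) \<in> \<xi> 0 \<inter> off t'}"
          using Q c unfolding row_source_def by blast
        have "card (near (int \<rho>) (R t') y') < m" using l unfolding limited_def by blast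
        \<comment> \<open>At most m - 1 good rows are near, and s2 - (m - 1) \<ge> m by
          \<open>m2\<close>: as many sites as there are rows in M.\<close>
        then have "m \<le> s2 - card (near (int \<rho>) (R t') y')" using m2 by linarith
        also note y'
        also have "card {b. \<bar>b - y\<bar> \<le> D \<and> (c, b) \<in> \<xi> 0 \<inter> off t'} \<le> card {b. \<bar>b - y\<bar> \<le> D \<and> (c, b) \<in> \<xi> 0}"
          by (rule card_mono) auto
        finally show ?thesis by blast
      qed simp
    qed (use Q row_source_card[OF l Q] in \<open>auto simp: row_source_def\<close>)
    then show ?thesis by blast
  qed
  then have "\<forall>y\<in>M. \<exists>p. P y (fst p) (snd p)" by simp
  then obtain f where f: "\<forall>y\<in>M. P y (fst (f y)) (snd (f y))"
    using bchoice[of M "\<lambda>y p. P y (fst p) (snd p)"] by blast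
  define X where "X y = fst (f y)" for y
  define Q where "Q y = snd (f y)" for y
  have P: "P y (X y) (Q y)" if "y \<in> M" for y using f that by (simp add: X_def Q_def)
  define U where "U = (\<Union>y\<in>M. Q y)"
  \<comment> \<open>All rows of M are within \<rho> of y0, so one window around y0 contains the
    windows of radius \<open>D\<close> around them.\<close>
  define F where "F c = {b. \<bar>b - y0\<bar> \<le> int \<rho> + D \<and> (c, b) \<in> \<xi> 0}" for c
  have finU: "finite U" using finM P by (auto simp: U_def P_def)
  have finF: "finite (F c)" for c by (simp add: F_def)
  have demand: "card {y \<in> M. c \<in> Q y} \<le> card (F c)" for c
  proof (cases "\<forall>y\<in>M. c \<in> Q y \<longrightarrow> (c, y) \<in> \<xi> 0")
    case True
    have "{y \<in> M. c \<in> Q y} \<subseteq> F c"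
    proof
      fix y assume y: "y \<in> {y \<in> M. c \<in> Q y}"
      then have "\<bar>y - y0\<bar> \<le> int \<rho>" using M(1) by (auto simp: near_def)
      moreover have "(c, y) \<in> \<xi> 0" using y True by blast
      ultimately show "y \<in> F c" using D by (simp add: F_def)
    qed
    then show ?thesis by (rule card_mono[OF finF])
  next
    case False
    then obtain y where y: "y \<in> M" "c \<in> Q y" "(c, y) \<notin> \<xi> 0" by blast
    have "card {y \<in> M. c \<in> Q y} \<le> card M" by (rule card_mono[OF finM]) auto
    also have "\<dots> = m" by fact
    also have "m \<le> card {b. \<bar>b - y\<bar> \<le> D \<and> (c, b) \<in> \<xi> 0}" using P[OF y(1)] y(2,3) unfolding P_def by blast
    also have "\<dots> \<le> card (F c)"
    proof (rule card_mono[OF finF])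
      have "\<bar>y - y0\<bar> \<le> int \<rho>" using M(1) y(1) by (auto simp: near_def)
      then show "{b. \<bar>b - y\<bar> \<le> D \<and> (c, b) \<in> \<xi> 0} \<subseteq> F c" by (auto simp: F_def)
    qed
    finally show ?thesis .
  qed
  have "m * (r + 1 - m) = (\<Sum>y\<in>M. r + 1 - m)" using M(2) by simp
  also have "\<dots> \<le> (\<Sum>y\<in>M. card (Q y))" using P by (intro sum_mono) (simp add: P_def)
  also have "\<dots> = (\<Sum>c\<in>U. card {y \<in> M. c \<in> Q y})"
    unfolding U_def using P by (intro card_Sigma_swap finM) (simp add: P_def)
  also have "\<dots> \<le> (\<Sum>c\<in>U. card (F c))" by (intro sum_mono demand)
  also have "\<dots> = card (Sigma U F)" using finU finF by (intro card_SigmaI[symmetric]) auto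
  finally have big: "m * (r + 1 - m) \<le> card (Sigma U F)" .
  moreover have "1 \<le> m * (r + 1 - m)" using m by simp
  ultimately have ne: "Sigma U F \<noteq> {}" by auto
  have cards: "card (X ` M) \<le> m" using card_image_le[OF finM] M(2) by metis
  \<comment> \<open>The m abscissae \<open>X y\<close> and the single height y0: m + 1
    coordinates.\<close>
  have "real (card (Sigma U F)) < \<gamma> * real (m + 1)"
  proof (rule sparse_less[OF sparse \<gamma>])
    show "finite (X ` M)" "finite {y0}" using finM by auto
    show "card (X ` M) \<le> N" "card {y0} \<le> N" using cards mN N by auto
    show "card (X ` M) + card {y0} \<le> m + 1" using cards by simp
    show "Sigma U F \<subseteq> \<xi> 0" by (auto simp: F_def)
    show "Sigma U F \<noteq> {}" by fact
    fix a b assume "(a, b) \<in> Sigma U F"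
    then obtain y where y: "y \<in> M" "a \<in> Q y" "\<bar>b - y0\<bar> \<le> int \<rho> + D" by (auto simp: U_def F_def)
    then have "\<bar>a - X y\<bar> \<le> int \<rho>" using P unfolding P_def by blast
    then have "\<bar>a - X y\<bar> \<le> K" "\<bar>b - y0\<bar> \<le> K" using y(3) D by linarith+
    then show "\<exists>x\<in>X ` M. \<exists>y\<in>{y0}. \<bar>a - x\<bar> \<le> K \<and> \<bar>b - y\<bar> \<le> K" using y(1) by blast
  qed
  also note \<gamma>m
  also have "real (m * (r + 1 - m)) \<le> real (card (Sigma U F))" using big by (rule of_nat_mono)
  finally show False by simp
qed

lemma origin_never_occupied:
  assumes m2: "2 * m \<le> s1 + 1" "2 * m \<le> s2 + 1" and mN: "m \<le> N"
    and \<gamma>m: "\<gamma> * real (m + 1) \<le> real (m * (r + 1 - m))"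
  shows "(0, 0) \<notin> \<xi> t"
proof
  interpret T: sparse_growth \<rho> r s2 s1 "\<lambda>t. (\<xi> t)\<inverse>" \<gamma> K N n m by (rule converse_sparse)
  have TR: "T.limited W k i \<longleftrightarrow> limited W k i" for W k i
    unfolding T.limited_def limited_def by auto
  have lim: "limited (int \<rho>) m i" for i
  proof (induction i rule: less_induct)
    case (less i)
    show ?case
    proof (cases i)
      case 0
      then show ?thesis using limited_0 m(1) by simp
    next
      case (Suc j)
      have "card (near (int \<rho>) (R (Suc j)) a) < m" for a
        by (rule rows_limited_Suc[OF m2 mN \<gamma>m]) (use less Suc in auto)
      moreover have "card (near (int \<rho>) (good_rows \<rho> r (\<lambda>t. (\<xi> t)\<inverse>) (Suc j)) a) < m" for a
        by (rule T.rows_limited_Suc[OF m2(2,1) mN \<gamma>m]) (use less Suc TR in auto)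
      ultimately show ?thesis unfolding limited_def Suc by simp
    qed
  qed
  have \<gamma>r: "\<gamma> \<le> real (r + 1 - m)"
  proof (rule ccontr)
    assume "\<not> ?thesis"
    then have "real (r + 1 - m) * real (m + 1) < \<gamma> * real (m + 1)"
      by (intro mult_strict_right_mono) auto
    also note \<gamma>m
    finally have "real ((r + 1 - m) * (m + 1)) < real (m * (r + 1 - m))" by (simp only: of_nat_mult)
    then have "(r + 1 - m) * (m + 1) < m * (r + 1 - m)" by (simp only: of_nat_less_iff)
    moreover have "\<not> d * (m + 1) < m * d" for d :: nat by (simp add: algebra_simps)
    ultimately show False by blast
  qed
  assume 0: "(0, 0) \<in> \<xi> t"
  have "0 \<notin> R t" by (rule zero_not_in_R[OF lim \<gamma>r])
  moreover have "0 \<notin> C t" using T.zero_not_in_R[of t] \<gamma>r lim TR by simp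
  ultimately show False using origin_off[OF lim 0] by (simp add: off_def)
qed

end

section \<open>The case \<open>s1 = s2 = 2\<close>\<close>

text \<open>For s1 = s2 = 2 the count in \<open>rows_limited_Suc\<close> allows only m = 1, and its
  formula with m = 2 would give 2 (r - 1) / 3. The difference to 2 r / 3 is the site that a good
  column may supply to each row, so these columns have to be charged too. W exceeds 2 D + 3 \<rho>,
  hence points within \<open>D\<close> of two columns more than W apart are distinct.\<close>

locale two_two_growth = sparse_growth +
  fixes W :: int
  assumes s: "s1 = 2" "s2 = 2" "m = 2" and r: "6 \<le> r" and \<gamma>r: "\<gamma> = 2 * real r / 3"
    and N3: "3 \<le> N" and W: "2 * D + 3 * int \<rho> \<le> W" and KW: "4 * W \<le> K"
begin

lemma W0: "0 \<le> W" "int \<rho> \<le> W" "D \<le> W" "D + int \<rho> \<le> W"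
  using W D by linarith+

lemma limited_\<rho>: "limited W 2 t \<Longrightarrow> limited (int \<rho>) m t"
  unfolding limited_def s(3)
  using card_near_mono[OF order_refl W0(2)] by (meson le_less_trans)

lemma limited_unique:
  assumes "limited W 2 t" "\<bar>a - b\<bar> \<le> W"
  shows "a \<in> R t \<Longrightarrow> b \<in> R t \<Longrightarrow> a = b" and "a \<in> C t \<Longrightarrow> b \<in> C t \<Longrightarrow> a = b"
proof -
  have *: "card {a, b} < 2" if "a \<in> L" "b \<in> L" "card (near W L a) < 2" for L
  proof -
    have "{a, b} \<subseteq> near W L a" using that(1,2) assms(2) W0(1) by (auto simp: near_def abs_minus_commute)
    then have "card {a, b} \<le> card (near W L a)" by (rule card_mono[rotated]) simp
    with that(3) show ?thesis by linarith
  qed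
  have "card {a, b} < 2 \<Longrightarrow> a = b" by (cases "a = b") auto
  then show "a \<in> R t \<Longrightarrow> b \<in> R t \<Longrightarrow> a = b" and "a \<in> C t \<Longrightarrow> b \<in> C t \<Longrightarrow> a = b"
    using * assms(1) unfolding limited_def by blast+
qed

text \<open>The transposed \<open>row_source\<close>, spelled out because rows and columns occur
  together below.\<close>

definition col_source :: "nat \<Rightarrow> int \<Rightarrow> int \<Rightarrow> int set \<Rightarrow> bool" where
  "col_source t x y P \<longleftrightarrow> finite P \<and> r \<le> card P + card (near (int \<rho>) (R t) y) \<and>
     (\<forall>c\<in>P. \<bar>c - y\<bar> \<le> int \<rho> \<and> c \<notin> R t \<and>
       (\<exists>a. \<bar>a - x\<bar> \<le> D \<and> (a, c) \<in> \<xi> 0 \<inter> off t) \<and>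
       ((x, c) \<in> \<xi> 0 \<or> (\<exists>x'. \<bar>x' - x\<bar> \<le> D \<and>
          s1 - card (near (int \<rho>) (C t) x') \<le> card {a. \<bar>a - x\<bar> \<le> D \<and> (a, c) \<in> \<xi> 0 \<inter> off t})))"

lemma converse_two_two: "two_two_growth \<rho> r s2 s1 (\<lambda>t. (\<xi> t)\<inverse>) \<gamma> K N n m W"
proof -
  interpret T: sparse_growth \<rho> r s2 s1 "\<lambda>t. (\<xi> t)\<inverse>" \<gamma> K N n m by (rule converse_sparse)
  show ?thesis by standard (use s r \<gamma>r N3 W KW in \<open>auto\<close>)
qed

end

context two_two_growth
begin

interpretation T: two_two_growth \<rho> r s2 s1 "\<lambda>t. (\<xi> t)\<inverse>" \<gamma> K N n m W
  by (rule converse_two_two)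

lemma T_off: "T.off t = (off t)\<inverse>"
  by (auto simp: T.off_def off_def)

lemma T_limited: "T.limited U k t \<longleftrightarrow> limited U k t"
  unfolding T.limited_def limited_def by auto

lemma T_row_source: "T.row_source t x y P \<longleftrightarrow> col_source t x y P"
  by (simp add: T.row_source_def col_source_def T_off)

lemma T_col_source: "T.col_source t y x Q \<longleftrightarrow> row_source t y x Q"
  by (simp add: T.col_source_def row_source_def T_off)

lemma col_source_exists:
  "limited (int \<rho>) m t \<Longrightarrow> x \<in> C (Suc t) \<Longrightarrow> x \<notin> C t \<Longrightarrow> \<exists>y P. col_source t x y P"
  using T.row_source_exists[of t x] T_limited T_row_source by simp

lemma col_source_card: "limited (int \<rho>) m t \<Longrightarrow> col_source t x y P \<Longrightarrow> r + 1 - m \<le> card P"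
  using T.row_source_card[of t x y P] T_limited T_row_source by simp

lemma col_source_points:
  assumes "col_source t x y P"
  obtains A where "A \<subseteq> \<xi> 0 \<inter> off t" "finite A" "card A = card P" "snd ` A = P"
    "\<And>a b. (a, b) \<in> A \<Longrightarrow> \<bar>a - x\<bar> \<le> D \<and> \<bar>b - y\<bar> \<le> int \<rho>"
proof -
  obtain A where A: "A \<subseteq> (\<xi> 0)\<inverse> \<inter> T.off t" "finite A" "card A = card P" "fst ` A = P"
    "\<And>a b. (a, b) \<in> A \<Longrightarrow> \<bar>a - y\<bar> \<le> int \<rho> \<and> \<bar>b - x\<bar> \<le> T.D"
    using T.row_source_points[of t x y P] assms T_row_source by metis
  show thesis
  proof (rule that[of "A\<inverse>"])
    show "A\<inverse> \<subseteq> \<xi> 0 \<inter> off t" using A(1) by (auto simp: T_off)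
    show "snd ` A\<inverse> = P" unfolding A(4)[symmetric] by force
  qed (use A in auto)
qed

text \<open>
  An initially empty site of the new column was filled with the help of two initially occupied
  sites in its row, as no good column was near.  Both inequalities behind the claim bound
  \<open>card (Y \<union> A)\<close> from below: the first counts the points of \<open>Y\<close>, the second those of \<open>A\<close> and of
  \<open>Y\<close> in the column \<open>x\<close>.
\<close>
lemma col_source_double_count:
  assumes src: "col_source t x y P" and x: "x \<notin> C t"
    and noC: "\<And>a. a \<in> C t \<Longrightarrow> D + int \<rho> < \<bar>a - x\<bar>"
    and A: "finite A" "x \<notin> fst ` A"
  defines "Y \<equiv> {(a, b). (a, b) \<in> \<xi> 0 \<inter> off t \<and> \<bar>a - x\<bar> \<le> D \<and> b \<in> P}"
  shows "finite Y" "2 * card P + card A \<le> 2 * card (Y \<union> A)"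
proof -
  have finP: "finite P" and P: "\<And>c. c \<in> P \<Longrightarrow> c \<notin> R t" using src unfolding col_source_def by blast+
  define F where "F c = {a. \<bar>a - x\<bar> \<le> D \<and> (a, c) \<in> \<xi> 0 \<inter> off t}" for c
  define J where "J = {c \<in> P. (x, c) \<in> \<xi> 0}"
  have Y: "Y = (Sigma P F)\<inverse>" by (auto simp: Y_def F_def)
  have finF: "finite (F c)" for c by (simp add: F_def)
  show finY: "finite Y" unfolding Y using finP finF by auto
  have xF: "x \<in> F c" if "c \<in> J" for c
    using that x P[of c] D by (auto simp: J_def F_def off_def)
  have F2: "2 - (if c \<in> J then 1 else 0) \<le> card (F c)" if c: "c \<in> P" for c
  proof (cases "c \<in> J")
    case True
    then have "card (F c) \<noteq> 0" using xF[OF True] finF[of c] by auto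
    then show ?thesis using True by simp
  next
    case False
    then have "(x, c) \<notin> \<xi> 0" using c by (simp add: J_def)
    then obtain x' where x': "\<bar>x' - x\<bar> \<le> D" "s1 - card (near (int \<rho>) (C t) x') \<le> card (F c)"
      using src c unfolding col_source_def F_def by blast
    have "near (int \<rho>) (C t) x' = {}"
    proof (rule ccontr)
      assume "near (int \<rho>) (C t) x' \<noteq> {}"
      then obtain a where "a \<in> C t" "\<bar>a - x'\<bar> \<le> int \<rho>" by (auto simp: near_def)
      then show False using noC[of a] x'(1) by linarith
    qed
    then show ?thesis using x'(2) s(1) False by simp
  qed
  have "2 * card P = (\<Sum>c\<in>P. 2 - (if c \<in> J then 1 else 0)) + card J"
  proof -
    have "(\<Sum>c\<in>P. 2 - (if c \<in> J then 1 else 0)) + card J =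
        (\<Sum>c\<in>P. 2 - (if c \<in> J then 1 else 0)) + (\<Sum>c\<in>P. if c \<in> J then 1 else 0)"
      using finP by (simp add: J_def sum.If_cases Int_def)
    also have "\<dots> = (\<Sum>c\<in>P. (2 - (if c \<in> J then 1 else 0)) + (if c \<in> J then 1 else 0))"
      by (rule sum.distrib[symmetric])
    also have "\<dots> = (\<Sum>c\<in>P. 2)" by (rule sum.cong) auto
    finally show ?thesis by simp
  qed
  also have "(\<Sum>c\<in>P. 2 - (if c \<in> J then 1 else 0)) \<le> (\<Sum>c\<in>P. card (F c))"
    by (rule sum_mono) (rule F2)
  also have "(\<Sum>c\<in>P. card (F c)) = card Y"
    unfolding Y using finP finF by (simp add: card_SigmaI)
  also have "card Y \<le> card (Y \<union> A)" using finY A(1) by (intro card_mono) auto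
  finally have 1: "2 * card P \<le> card (Y \<union> A) + card J" by simp
  have finJ: "finite J" using finP by (simp add: J_def)
  have "card J + card A = card (({x} \<times> J) \<union> A)"
    using finJ A by (subst card_Un_disjoint) (auto simp: image_iff)
  also have "\<dots> \<le> card (Y \<union> A)"
    using finY A(1) xF by (intro card_mono) (auto simp: Y J_def)
  finally show "2 * card P + card A \<le> 2 * card (Y \<union> A)" using 1 by linarith
qed

text \<open>Two crossing lines cannot be created at the same place. With A the source of the other
  line, double counting gives at least (3 r - 1) / 2 points, while two coordinates allow fewer than
  2 \<gamma> = 4 r / 3.\<close>

lemma no_second_line_at_column:
  assumes src: "col_source t x y P" and x: "x \<notin> C t"
    and noC: "\<And>a. a \<in> C t \<Longrightarrow> D + int \<rho> < \<bar>a - x\<bar>" and noR: "near (int \<rho>) (R t) y = {}"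
    and A: "finite A" "x \<notin> fst ` A" "A \<subseteq> \<xi> 0" "r - 1 \<le> card A"
      "\<And>a b. (a, b) \<in> A \<Longrightarrow> \<bar>a - x\<bar> \<le> K \<and> \<bar>b - y\<bar> \<le> K"
  shows False
proof -
  define Y where "Y = {(a, b). (a, b) \<in> \<xi> 0 \<inter> off t \<and> \<bar>a - x\<bar> \<le> D \<and> b \<in> P}"
  note count = col_source_double_count[OF src x noC A(1,2), folded Y_def]
  have P: "r \<le> card P" "\<And>c. c \<in> P \<Longrightarrow> \<bar>c - y\<bar> \<le> int \<rho>"
    using src noR unfolding col_source_def by auto
  have "A \<noteq> {}" using A(4) r by auto
  have "real (card (Y \<union> A)) < \<gamma> * real 2"
  proof (rule sparse_less[OF sparse \<gamma>, of "{x}" "{y}"])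
    fix a b assume "(a, b) \<in> Y \<union> A"
    then show "\<exists>x\<in>{x}. \<exists>y\<in>{y}. \<bar>a - x\<bar> \<le> K \<and> \<bar>b - y\<bar> \<le> K"
    proof
      assume "(a, b) \<in> Y"
      then have "\<bar>a - x\<bar> \<le> D" "\<bar>b - y\<bar> \<le> int \<rho>" using P(2) by (auto simp: Y_def)
      then show ?thesis using D by auto
    qed (use A(5) in auto)
  qed (use N A(3) \<open>A \<noteq> {}\<close> in \<open>auto simp: Y_def\<close>)
  then have "3 * card (Y \<union> A) < 4 * r" unfolding \<gamma>r by simp
  then show False using count(2) P(1) A(4) r by linarith
qed

end

context two_two_growth
begin

interpretation T: two_two_growth \<rho> r s2 s1 "\<lambda>t. (\<xi> t)\<inverse>" \<gamma> K N n m W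
  by (rule converse_two_two)

lemma no_second_line_at_row:
  assumes src: "row_source t y x Q" and y: "y \<notin> R t"
    and noR: "\<And>b. b \<in> R t \<Longrightarrow> D + int \<rho> < \<bar>b - y\<bar>" and noC: "near (int \<rho>) (C t) x = {}"
    and A: "finite A" "y \<notin> snd ` A" "A \<subseteq> \<xi> 0" "r - 1 \<le> card A"
      "\<And>a b. (a, b) \<in> A \<Longrightarrow> \<bar>a - x\<bar> \<le> K \<and> \<bar>b - y\<bar> \<le> K"
  shows False
proof (rule T.no_second_line_at_column[of t y x Q "A\<inverse>"])
  show "T.col_source t y x Q" using src by (simp add: T_col_source)
qed (use assms in \<open>auto simp: image_iff\<close>)

text \<open>Were y' close to y, the sources of the row y and of its helper x' would meet. This is
  excluded at once unless a good row z helped to create x'. In that case z is traced back as well: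
  it was created either near x', where again two sources meet, or away from it, where its points are
  new and cost only one more coordinate.\<close>

lemma helper_is_far:
  assumes lim: "\<And>i. i \<le> t \<Longrightarrow> limited W 2 i"
    and src: "row_source t y x Q"
    and x': "x' \<in> C t" "\<bar>x' - x\<bar> \<le> int \<rho>"
    and t': "t' < t" "x' \<notin> C t'" "x' \<in> C (Suc t')" and src': "col_source t' x' y' P"
  shows "3 * W < \<bar>y' - y\<bar>"
proof (rule ccontr)
  assume "\<not> ?thesis"
  then have close: "\<bar>y' - y\<bar> \<le> 3 * W" by simp
  obtain A where A: "A \<subseteq> \<xi> 0 \<inter> off t" "finite A" "card A = card Q" "fst ` A = Q"
    "\<And>a b. (a, b) \<in> A \<Longrightarrow> \<bar>a - x\<bar> \<le> int \<rho> \<and> \<bar>b - y\<bar> \<le> D"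
    using row_source_points[OF src] by blast
  have cardA: "r - 1 \<le> card A"
    using row_source_card[OF limited_\<rho>[OF lim[of t]] src] A(3) s by simp
  have x'A: "x' \<notin> fst ` A" using A(1) x'(1) by (auto simp: off_def)
  have A': "\<bar>a - x'\<bar> \<le> 2 * int \<rho> \<and> \<bar>b - y'\<bar> \<le> D + 3 * W" if "(a, b) \<in> A" for a b
    using A(5)[OF that] x'(2) close by linarith
  have A'K: "\<bar>a - x'\<bar> \<le> K \<and> \<bar>b - y'\<bar> \<le> K" if "(a, b) \<in> A" for a b
    using A'[OF that] D W0 KW by linarith
  have noC: "D + int \<rho> < \<bar>a - x'\<bar>" if "a \<in> C t'" for a
  proof (rule ccontr)
    assume "\<not> ?thesis"
    then have "\<bar>a - x'\<bar> \<le> W" using W0 by linarith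
    moreover have "a \<in> C (Suc t')" using that C_mono[of t' "Suc t'"] by auto
    ultimately have "a = x'" using limited_unique(2)[OF lim[of "Suc t'"]] t' by simp
    then show False using that t'(2) by simp
  qed
  have P: "r - 1 \<le> card P" "\<And>c. c \<in> P \<Longrightarrow> \<bar>c - y'\<bar> \<le> int \<rho> \<and> c \<notin> R t'"
    using col_source_card[OF limited_\<rho>[OF lim[of t']] src'] t'(1) s src' unfolding col_source_def by auto
  show False
  proof (cases "near (int \<rho>) (R t') y' = {}")
    case True
    show ?thesis
      by (rule no_second_line_at_column[OF src' t'(2) noC True A(2) x'A]) (use A cardA A'K in auto)
  next
    case False
    then obtain z where z: "z \<in> R t'" "\<bar>z - y'\<bar> \<le> int \<rho>" by (auto simp: near_def)
    obtain t0 where t0: "t0 < t'" "z \<notin> R t0" "z \<in> R (Suc t0)" using R_birth[OF z(1)] by blast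
    have lim0: "limited (int \<rho>) m t0" using limited_\<rho> lim t0(1) t'(1) by simp
    obtain x0 Q0 where src0: "row_source t0 z x0 Q0" using row_source_exists[OF lim0 t0(3,2)] by blast
    show False
    proof (cases "\<bar>x0 - x'\<bar> \<le> 2 * D + int \<rho>")
      case True
      obtain B where B: "B \<subseteq> \<xi> 0 \<inter> off t'" "finite B" "card B = card P" "snd ` B = P"
        "\<And>a b. (a, b) \<in> B \<Longrightarrow> \<bar>a - x'\<bar> \<le> D \<and> \<bar>b - y'\<bar> \<le> int \<rho>"
        using col_source_points[OF src'] by blast
      have noR: "D + int \<rho> < \<bar>b - z\<bar>" if "b \<in> R t0" for b
      proof (rule ccontr)
        assume "\<not> ?thesis"
        then have "\<bar>b - z\<bar> \<le> W" using W0 by linarith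
        moreover have "b \<in> R (Suc t0)" using that R_mono[of t0 "Suc t0"] by auto
        ultimately have "b = z" using limited_unique(1)[OF lim[of "Suc t0"]] t0 t'(1) by simp
        then show False using that t0(2) by simp
      qed
      \<comment> \<open>A good column near x0 would be within W of x', hence equal to x', which did
        not exist yet.\<close>
      have noC0: "near (int \<rho>) (C t0) x0 = {}"
      proof (rule ccontr)
        assume "\<not> ?thesis"
        then obtain a where a: "a \<in> C t0" "\<bar>a - x0\<bar> \<le> int \<rho>" by (auto simp: near_def)
        have "\<bar>a - x'\<bar> \<le> W" using a(2) True W by linarith
        moreover have "a \<in> C t'" using a(1) C_mono[of t0 t'] t0(1) by auto
        then have "a \<in> C t" using C_mono[of t' t] t'(1) by auto
        ultimately have "a = x'" using limited_unique(2)[OF lim[of t]] x'(1) by simp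
        then show False using \<open>a \<in> C t'\<close> t'(2) by simp
      qed
      show False
      proof (rule no_second_line_at_row[OF src0 t0(2) noR noC0 B(2)])
        show "z \<notin> snd ` B" using B(4) P(2) z(1) by blast
        show "r - 1 \<le> card B" using B(3) P(1) by simp
        show "B \<subseteq> \<xi> 0" using B(1) by auto
        fix a b assume "(a, b) \<in> B"
        then have "\<bar>a - x'\<bar> \<le> D" "\<bar>b - y'\<bar> \<le> int \<rho>" using B(5) by auto
        then show "\<bar>a - x0\<bar> \<le> K \<and> \<bar>b - z\<bar> \<le> K" using True z(2) D W W0 KW by linarith
      qed
    next
      case False
      obtain B where B: "B \<subseteq> \<xi> 0 \<inter> off t0" "finite B" "card B = card Q0"
        "\<And>a b. (a, b) \<in> B \<Longrightarrow> \<bar>a - x0\<bar> \<le> int \<rho> \<and> \<bar>b - z\<bar> \<le> D"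
        using row_source_points[OF src0] by blast
      have cardB: "r - 1 \<le> card B" using row_source_card[OF lim0 src0] B(3) s by simp
      define Y where "Y = {(a, b). (a, b) \<in> \<xi> 0 \<inter> off t' \<and> \<bar>a - x'\<bar> \<le> D \<and> b \<in> P}"
      note count = col_source_double_count[OF src' t'(2) noC A(2) x'A, folded Y_def]
      have YA: "\<bar>a - x'\<bar> \<le> D + int \<rho>" if "(a, b) \<in> Y \<union> A" for a b
        using that
      proof
        assume "(a, b) \<in> Y"
        then have "\<bar>a - x'\<bar> \<le> D" by (auto simp: Y_def)
        then show ?thesis by linarith
      qed (use A' D in force)
      have "(Y \<union> A) \<inter> B = {}"
      proof (rule ccontr)
        assume "\<not> ?thesis"
        then obtain a b where ab: "(a, b) \<in> Y \<union> A" "(a, b) \<in> B" by auto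
        show False using YA[OF ab(1)] B(4)[OF ab(2)] False D by linarith
      qed
      then have card: "card (Y \<union> A \<union> B) = card (Y \<union> A) + card B"
        using count(1) A(2) B(2) by (intro card_Un_disjoint) auto
      have "A \<noteq> {}" using cardA r by auto
      \<comment> \<open>Three coordinates allow fewer than 2 r points, but there are at least 3 (r -
        1) / 2 in Y and A together and r - 1 more in B.\<close>
      have "real (card (Y \<union> A \<union> B)) < \<gamma> * real 3"
      proof (rule sparse_less[OF sparse \<gamma>, of "{x', x0}" "{y'}"])
        fix a b assume "(a, b) \<in> Y \<union> A \<union> B"
        then consider "(a, b) \<in> Y" | "(a, b) \<in> A" | "(a, b) \<in> B" by blast
        then show "\<exists>x\<in>{x', x0}. \<exists>y\<in>{y'}. \<bar>a - x\<bar> \<le> K \<and> \<bar>b - y\<bar> \<le> K"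
        proof cases
          case 1
          then have "\<bar>a - x'\<bar> \<le> D" "\<bar>b - y'\<bar> \<le> int \<rho>" using P(2) by (auto simp: Y_def)
          then have "\<bar>a - x'\<bar> \<le> K" "\<bar>b - y'\<bar> \<le> K" using D by linarith+
          then show ?thesis by blast
        next
          case 2
          then show ?thesis using A'K by blast
        next
          case 3
          have "\<bar>a - x0\<bar> \<le> K" "\<bar>b - y'\<bar> \<le> K" using B(4)[OF 3] z(2) D by linarith+
          then show ?thesis by blast
        qed
      next
        show "card {x', x0} + card {y'} \<le> 3" by (cases "x' = x0") auto
        show "card {x', x0} \<le> N" using N3 by (cases "x' = x0") auto
      qed (use N A(1) B(1) \<open>A \<noteq> {}\<close> in \<open>auto simp: Y_def\<close>)
      then have "card (Y \<union> A \<union> B) < 2 * r" unfolding \<gamma>r by simp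
      then show False using card cardB count(2) cardA P(1) r by linarith
    qed
  qed
qed

text \<open>At most one good column is near x. If there is one, its own source provides r - 1
  further points, and these are far from the row by \<open>helper_is_far\<close>.\<close>

lemma row_energy:
  assumes lim: "\<And>i. i \<le> t \<Longrightarrow> limited W 2 i" and src: "row_source t y x Q"
  obtains "r \<le> card Q" |
    x' y' A where "r - 1 \<le> card Q" "x' \<in> C t" "\<bar>x' - x\<bar> \<le> int \<rho>"
      "A \<subseteq> \<xi> 0" "finite A" "r - 1 \<le> card A" "3 * W < \<bar>y' - y\<bar>"
      "\<And>a b. (a, b) \<in> A \<Longrightarrow> \<bar>a - x'\<bar> \<le> D \<and> \<bar>b - y'\<bar> \<le> int \<rho>"
proof (cases "near (int \<rho>) (C t) x = {}")
  case True
  then have "r \<le> card Q" using src unfolding row_source_def by simp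
  then show thesis by (rule that(1))
next
  case False
  then obtain x' where x': "x' \<in> C t" "\<bar>x' - x\<bar> \<le> int \<rho>" by (auto simp: near_def)
  obtain t' where t': "t' < t" "x' \<notin> C t'" "x' \<in> C (Suc t')" using C_birth[OF x'(1)] by blast
  have l': "limited (int \<rho>) m t'" using limited_\<rho> lim t'(1) by simp
  obtain y' P where src': "col_source t' x' y' P" using col_source_exists[OF l' t'(3,2)] by blast
  obtain A where A: "A \<subseteq> \<xi> 0 \<inter> off t'" "finite A" "card A = card P" "snd ` A = P"
    "\<And>a b. (a, b) \<in> A \<Longrightarrow> \<bar>a - x'\<bar> \<le> D \<and> \<bar>b - y'\<bar> \<le> int \<rho>"
    using col_source_points[OF src'] by blast
  have Q: "r - 1 \<le> card Q" using row_source_card[OF limited_\<rho>[OF lim[of t]] src] s by simp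
  have cA: "r - 1 \<le> card A" using col_source_card[OF l' src'] A(3) s by simp
  have far: "3 * W < \<bar>y' - y\<bar>" by (rule helper_is_far[OF lim src x' t' src'])
  show thesis by (rule that(2)[OF Q x' _ A(2) cA far A(5)]) (use A(1) in auto)
qed

text \<open>
  Each of the two rows needs \<open>r\<close> sites, at most one of them in a good column.  Such a column was
  created far away and accounts for \<open>r - 1\<close> further points and one further coordinate, a net gain
  of \<open>r / 3 - 1 \<ge> 1\<close> over the point that it replaces; this is where \<open>6 \<le> r\<close> enters.
\<close>
lemma no_two_rows:
  assumes lim: "\<And>i. i \<le> t \<Longrightarrow> limited W 2 i" and t12: "t1 \<le> t" "t2 \<le> t"
    and src1: "row_source t1 y1 x1 Q1" and src2: "row_source t2 y2 x2 Q2"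
    and y12: "y1 \<noteq> y2" "\<bar>y1 - y2\<bar> \<le> 2 * W"
    and no1: "\<And>b. b \<in> R t1 \<Longrightarrow> D + int \<rho> < \<bar>b - y1\<bar>"
    and no2: "y1 \<in> R t2 \<or> (\<forall>b\<in>R t2. D + int \<rho> < \<bar>b - y2\<bar>)"
  shows False
proof -
  define G where "G b \<longleftrightarrow> \<bar>b - y1\<bar> \<le> D \<or> \<bar>b - y2\<bar> \<le> D" for b
  define F where "F c = {b. (c, b) \<in> \<xi> 0 \<and> G b}" for c
  define U where "U = Q1 \<union> Q2"
  define Y where "Y = Sigma U F"
  have finQ: "finite Q1" "finite Q2" using src1 src2 unfolding row_source_def by blast+
  have finF: "finite (F c)" for c
    by (rule finite_subset[of _ "{b. \<bar>b - y1\<bar> \<le> D} \<union> {b. \<bar>b - y2\<bar> \<le> D}"]) (auto simp: F_def G_def)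
  have Q: "\<bar>c - x1\<bar> \<le> int \<rho>" if "c \<in> Q1" for c using src1 that unfolding row_source_def by blast
  have Q': "\<bar>c - x2\<bar> \<le> int \<rho>" if "c \<in> Q2" for c using src2 that unfolding row_source_def by blast
  have two_points: "(c, y) \<in> \<xi> 0 \<or> 2 \<le> card (F c)"
    if src: "row_source i y x Q" and no: "\<And>b. b \<in> R i \<Longrightarrow> D + int \<rho> < \<bar>b - y\<bar>"
      and y: "y = y1 \<or> y = y2" and c: "c \<in> Q" for i y x Q c
  proof (rule disjCI)
    assume "\<not> 2 \<le> card (F c)"
    show "(c, y) \<in> \<xi> 0"
    proof (rule ccontr)
      assume "(c, y) \<notin> \<xi> 0"
      then obtain y' where y': "\<bar>y' - y\<bar> \<le> D"
        "s2 - card (near (int \<rho>) (R i) y') \<le> card {b. \<bar>b - y\<bar> \<le> D \<and> (c, b) \<in> \<xi> 0 \<inter> off i}"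
        using src c unfolding row_source_def by blast
      have "near (int \<rho>) (R i) y' = {}"
      proof (rule ccontr)
        assume "\<not> ?thesis"
        then obtain b where "b \<in> R i" "\<bar>b - y'\<bar> \<le> int \<rho>" by (auto simp: near_def)
        then show False using no[of b] y'(1) by linarith
      qed
      then have "2 \<le> card {b. \<bar>b - y\<bar> \<le> D \<and> (c, b) \<in> \<xi> 0 \<inter> off i}" using y'(2) s by simp
      also have "\<dots> \<le> card (F c)" by (rule card_mono[OF finF]) (use y in \<open>auto simp: F_def G_def\<close>)
      finally show False using \<open>\<not> 2 \<le> card (F c)\<close> by simp
    qed
  qed
  have one: "1 \<le> card (F c)" if "c \<in> U" for c
  proof -
    have "\<exists>b. (c, b) \<in> \<xi> 0 \<and> G b"
      using that src1 src2 unfolding U_def row_source_def G_def by blast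
    then have "F c \<noteq> {}" by (auto simp: F_def)
    then have "card (F c) \<noteq> 0" using finF[of c] by simp
    then show ?thesis by simp
  qed
  \<comment> \<open>A column used by both rows has to count twice. If y1 was good before y2, the
    second witness avoids row y1 and gives another point than (c, y1); otherwise a column with a
    single point would have to contain both (c, y1) and (c, y2).\<close>
  have two: "2 \<le> card (F c)" if c: "c \<in> Q1 \<inter> Q2" for c
  proof (rule ccontr)
    assume not2: "\<not> ?thesis"
    then have c1: "(c, y1) \<in> \<xi> 0" using two_points[OF src1 no1] c by blast
    have "\<exists>b. b \<noteq> y1 \<and> (c, b) \<in> \<xi> 0 \<and> G b"
      using no2
    proof
      assume y1: "y1 \<in> R t2"
      obtain b where b: "\<bar>b - y2\<bar> \<le> D" "(c, b) \<in> \<xi> 0 \<inter> off t2"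
        using src2 c unfolding row_source_def by blast
      then have "b \<noteq> y1" using y1 by (auto simp: off_def)
      then show ?thesis using b by (auto simp: G_def)
    next
      assume "\<forall>b\<in>R t2. D + int \<rho> < \<bar>b - y2\<bar>"
      then have "(c, y2) \<in> \<xi> 0" using two_points[OF src2] c not2 by blast
      then show ?thesis using y12(1) D(1) by (auto simp: G_def)
    qed
    then obtain b where b: "b \<noteq> y1" "(c, b) \<in> \<xi> 0" "G b" by blast
    have "{y1, b} \<subseteq> F c" using b c1 D(1) by (auto simp: F_def G_def)
    then have "card {y1, b} \<le> card (F c)" by (rule card_mono[OF finF])
    then show False using b(1) not2 by simp
  qed
  have cardY: "card Q1 + card Q2 \<le> card Y"
  proof -
    have "card Q1 + card Q2 = card U + card (Q1 \<inter> Q2)"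
      unfolding U_def by (rule card_Un_Int[OF finQ])
    also have "\<dots> = (\<Sum>c\<in>U. 1 + (if c \<in> Q1 \<inter> Q2 then 1 else 0))"
    proof -
      have fin: "finite U" using finQ by (simp add: U_def)
      have "U \<inter> {c. c \<in> Q1 \<inter> Q2} = Q1 \<inter> Q2" by (auto simp: U_def)
      then have "(\<Sum>c\<in>U. if c \<in> Q1 \<inter> Q2 then 1 else 0) = card (Q1 \<inter> Q2)"
        using fin by (simp only: sum.If_cases) simp
      then show ?thesis by (simp only: sum.distrib) simp
    qed
    also have "\<dots> \<le> (\<Sum>c\<in>U. card (F c))"
      by (rule sum_mono) (use one two in \<open>force simp: numeral_2_eq_2\<close>)
    also have "\<dots> = card Y" unfolding Y_def using finQ finF by (simp add: U_def card_SigmaI)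
    finally show ?thesis .
  qed
  have finY: "finite Y" unfolding Y_def U_def using finQ finF by blast
  have Ysub: "Y \<subseteq> \<xi> 0" by (auto simp: Y_def F_def)
  have YG: "G b" if "(a, b) \<in> Y" for a b using that by (auto simp: Y_def F_def)
  have Gy1: "\<bar>b - y1\<bar> \<le> D + 2 * W" if "G b" for b using that y12(2) W0 D(1) unfolding G_def by linarith
  have Yx: "\<exists>x\<in>{x1, x2}. \<bar>a - x\<bar> \<le> int \<rho>" if "(a, b) \<in> Y" for a b
    using that Q Q' by (auto simp: Y_def U_def)
  have YK: "\<exists>x\<in>{x1, x2}. \<exists>y\<in>insert y1 V. \<bar>a - x\<bar> \<le> K \<and> \<bar>b - y\<bar> \<le> K" if ab: "(a, b) \<in> Y" for a b V
  proof -
    obtain x where x: "x \<in> {x1, x2}" "\<bar>a - x\<bar> \<le> int \<rho>" using Yx[OF ab] by blast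
    have "\<bar>b - y1\<bar> \<le> K" using Gy1[OF YG[OF ab]] W0 KW D by linarith
    moreover have "\<bar>a - x\<bar> \<le> K" using x(2) D by linarith
    ultimately show ?thesis using x(1) by blast
  qed
  have disj: "Y \<inter> A = {}" if A: "\<And>a b. (a, b) \<in> A \<Longrightarrow> \<bar>a - x'\<bar> \<le> D \<and> \<bar>b - y'\<bar> \<le> int \<rho>"
    and y': "3 * W < \<bar>y' - y1\<bar> \<or> 3 * W < \<bar>y' - y2\<bar>" for A x' y'
  proof (rule ccontr)
    assume "Y \<inter> A \<noteq> {}"
    then obtain a b where ab: "(a, b) \<in> Y" "(a, b) \<in> A" by auto
    show False using YG[OF ab(1)] A[OF ab(2)] y' y12(2) W0 unfolding G_def by linarith
  qed
  have card12: "card {x1, x2} \<le> 2" by (cases "x1 = x2") auto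
  have lim1: "limited W 2 i" if "i \<le> t1" for i using lim t12 that by simp
  have lim2: "limited W 2 i" if "i \<le> t2" for i using lim t12 that by simp
  have one_helper: False
    if A: "A \<subseteq> \<xi> 0" "finite A" "r - 1 \<le> card A" "3 * W < \<bar>y' - y1\<bar> \<or> 3 * W < \<bar>y' - y2\<bar>"
      "\<And>a b. (a, b) \<in> A \<Longrightarrow> \<bar>a - x'\<bar> \<le> D \<and> \<bar>b - y'\<bar> \<le> int \<rho>"
      and x': "\<bar>x' - x\<bar> \<le> int \<rho>" "x \<in> {x1, x2}" and QQ: "2 * r - 1 \<le> card Q1 + card Q2"
    for A x' y' x
  proof -
    have "card (Y \<union> A) = card Y + card A"
      using disj[OF A(5,4)] finY A(2) by (intro card_Un_disjoint) auto
    then have big: "3 * r - 2 \<le> card (Y \<union> A)" using cardY A(3) QQ by linarith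
    then have "Y \<union> A \<noteq> {}" using r by auto
    \<comment> \<open>One helper: at least 3 r - 2 points against 4 \<gamma> = 8 r / 3, a
      contradiction precisely from r = 6 on.\<close>
    have "real (card (Y \<union> A)) < \<gamma> * real 4"
    proof (rule sparse_less[OF sparse \<gamma>, of "{x1, x2}" "{y1, y'}"])
      have "card {y1, y'} \<le> 2" by (cases "y1 = y'") auto
      then show "card {x1, x2} + card {y1, y'} \<le> 4" "card {x1, x2} \<le> N" "card {y1, y'} \<le> N"
        using card12 N3 by linarith+
      fix a b assume "(a, b) \<in> Y \<union> A"
      then show "\<exists>x\<in>{x1, x2}. \<exists>y\<in>{y1, y'}. \<bar>a - x\<bar> \<le> K \<and> \<bar>b - y\<bar> \<le> K"
      proof
        assume "(a, b) \<in> A"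
        from A(5)[OF this] have "\<bar>a - x\<bar> \<le> K" "\<bar>b - y'\<bar> \<le> K" using x'(1) D by linarith+
        then show ?thesis using x'(2) by blast
      qed (use YK in auto)
    qed (use Ysub A(1) \<open>Y \<union> A \<noteq> {}\<close> in auto)
    then have "3 * card (Y \<union> A) < 8 * r" unfolding \<gamma>r by simp
    then show False using big r by linarith
  qed
  show False
  proof (rule row_energy[OF lim1 src1]; rule row_energy[OF lim2 src2])
    assume Q12: "r \<le> card Q1" "r \<le> card Q2"
    then have "Y \<noteq> {}" using cardY r by auto
    \<comment> \<open>No helper: 2 r points near x1, x2 and y1. This case determines the
      exponent.\<close>
    have "real (card Y) < \<gamma> * real 3"
      by (rule sparse_less[OF sparse \<gamma>, of "{x1, x2}" "{y1}"])
        (use YK[of _ _ "{}"] card12 N N3 Ysub \<open>Y \<noteq> {}\<close> in auto)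
    then have "card Y < 2 * r" unfolding \<gamma>r by simp
    then show False using cardY Q12 by linarith
  next
    fix x' y' A
    assume h: "r \<le> card Q1" "r - 1 \<le> card Q2" "\<bar>x' - x2\<bar> \<le> int \<rho>" "A \<subseteq> \<xi> 0" "finite A" "r - 1 \<le> card A"
      "3 * W < \<bar>y' - y2\<bar>" "\<And>a b. (a, b) \<in> A \<Longrightarrow> \<bar>a - x'\<bar> \<le> D \<and> \<bar>b - y'\<bar> \<le> int \<rho>"
    show False
      by (rule one_helper[OF h(4,5,6) _ h(8,3)]) (use h(1,2,7) r in auto)
  next
    fix x' y' A
    assume h: "r \<le> card Q2" "r - 1 \<le> card Q1" "\<bar>x' - x1\<bar> \<le> int \<rho>" "A \<subseteq> \<xi> 0" "finite A" "r - 1 \<le> card A"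
      "3 * W < \<bar>y' - y1\<bar>" "\<And>a b. (a, b) \<in> A \<Longrightarrow> \<bar>a - x'\<bar> \<le> D \<and> \<bar>b - y'\<bar> \<le> int \<rho>"
    show False
      by (rule one_helper[OF h(4,5,6) _ h(8,3)]) (use h(1,2,7) r in auto)
  next
    fix x1' y1' A1 x2' y2' A2
    assume h1: "r - 1 \<le> card Q1" "x1' \<in> C t1" "\<bar>x1' - x1\<bar> \<le> int \<rho>" "A1 \<subseteq> \<xi> 0" "finite A1" "r - 1 \<le> card A1"
      "3 * W < \<bar>y1' - y1\<bar>" "\<And>a b. (a, b) \<in> A1 \<Longrightarrow> \<bar>a - x1'\<bar> \<le> D \<and> \<bar>b - y1'\<bar> \<le> int \<rho>"
    assume h2: "r - 1 \<le> card Q2" "x2' \<in> C t2" "\<bar>x2' - x2\<bar> \<le> int \<rho>" "A2 \<subseteq> \<xi> 0" "finite A2" "r - 1 \<le> card A2"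
      "3 * W < \<bar>y2' - y2\<bar>" "\<And>a b. (a, b) \<in> A2 \<Longrightarrow> \<bar>a - x2'\<bar> \<le> D \<and> \<bar>b - y2'\<bar> \<le> int \<rho>"
    have "Y \<noteq> {}" using cardY h1(1) r by auto
    show False
    proof (cases "x1' = x2'")
      case True
      \<comment> \<open>A common helper brings x1 and x2 together, so that 2 r - 2 points cost only
        two coordinates.\<close>
      have "real (card Y) < \<gamma> * real 2"
      proof (rule sparse_less[OF sparse \<gamma>, of "{x1'}" "{y1}"])
        fix a b assume ab: "(a, b) \<in> Y"
        have "\<bar>a - x1'\<bar> \<le> 2 * int \<rho>"
          using Yx[OF ab] h1(3) h2(3) True by (auto simp: abs_le_iff)
        then have "\<bar>a - x1'\<bar> \<le> K" "\<bar>b - y1\<bar> \<le> K" using Gy1[OF YG[OF ab]] W0 KW D by linarith+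
        then show "\<exists>x\<in>{x1'}. \<exists>y\<in>{y1}. \<bar>a - x\<bar> \<le> K \<and> \<bar>b - y\<bar> \<le> K" by blast
      qed (use N Ysub \<open>Y \<noteq> {}\<close> in auto)
      then have "3 * card Y < 4 * r" unfolding \<gamma>r by simp
      then show False using cardY h1(1) h2(1) r by linarith
    next
      case False
      have "x1' \<in> C t" "x2' \<in> C t" using h1(2) h2(2) t12 C_mono by blast+
      then have "W < \<bar>x1' - x2'\<bar>" using limited_unique(2)[OF lim[of t], of x1' x2'] False by force
      have A12: "A1 \<inter> A2 = {}"
      proof (rule ccontr)
        assume "A1 \<inter> A2 \<noteq> {}"
        then obtain a b where ab: "(a, b) \<in> A1" "(a, b) \<in> A2" by auto
        show False using h1(8)[OF ab(1)] h2(8)[OF ab(2)] \<open>W < \<bar>x1' - x2'\<bar>\<close> W by linarith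
      qed
      have cA: "card (A1 \<union> A2) = card A1 + card A2"
        by (rule card_Un_disjoint[OF h1(5) h2(5) A12])
      have "Y \<inter> A1 = {}" by (rule disj[OF h1(8) disjI1[OF h1(7)]])
      moreover have "Y \<inter> A2 = {}" by (rule disj[OF h2(8) disjI2[OF h2(7)]])
      ultimately have "card (Y \<union> (A1 \<union> A2)) = card Y + card (A1 \<union> A2)"
        using finY h1(5) h2(5) by (intro card_Un_disjoint) auto
      with cA have big: "4 * r - 4 \<le> card (Y \<union> (A1 \<union> A2))"
        using cardY h1(1,6) h2(1,6) r by linarith
      \<comment> \<open>Two helpers: at least 4 r - 4 points against 5 \<gamma> = 10 r / 3, again
        enough precisely from r = 6 on.\<close>
      have "real (card (Y \<union> (A1 \<union> A2))) < \<gamma> * real 5"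
      proof (rule sparse_less[OF sparse \<gamma>, of "{x1, x2}" "{y1, y1', y2'}"])
        have "card {y1, y1', y2'} \<le> 3" by (rule card_insert_le_m1) (auto intro: card_insert_le_m1)
        then show "card {x1, x2} + card {y1, y1', y2'} \<le> 5" "card {x1, x2} \<le> N" "card {y1, y1', y2'} \<le> N"
          using card12 N3 by linarith+
        fix a b assume "(a, b) \<in> Y \<union> (A1 \<union> A2)"
        then consider "(a, b) \<in> Y" | "(a, b) \<in> A1" | "(a, b) \<in> A2" by blast
        then show "\<exists>x\<in>{x1, x2}. \<exists>y\<in>{y1, y1', y2'}. \<bar>a - x\<bar> \<le> K \<and> \<bar>b - y\<bar> \<le> K"
        proof cases
          case 1
          then show ?thesis by (rule YK)
        next
          case 2
          have "\<bar>a - x1\<bar> \<le> K" "\<bar>b - y1'\<bar> \<le> K" using h1(8)[OF 2] h1(3) D by linarith+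
          then show ?thesis by blast
        next
          case 3
          have "\<bar>a - x2\<bar> \<le> K" "\<bar>b - y2'\<bar> \<le> K" using h2(8)[OF 3] h2(3) D by linarith+
          then show ?thesis by blast
        qed
      qed (use Ysub h1(4) h2(4) \<open>Y \<noteq> {}\<close> in auto)
      then have "3 * card (Y \<union> (A1 \<union> A2)) < 10 * r" unfolding \<gamma>r by simp
      then show False using big r by linarith
    qed
  qed
qed

text \<open>Two rows in one window are at most 2 W apart. If one of them is older, it had no good
  row near it at its birth; if both are new, the first case shows that no older row is near either
  of them. In both cases \<open>no_two_rows\<close> applies.\<close>

lemma at_most_one_row_Suc:
  assumes lim: "\<And>i. i \<le> t \<Longrightarrow> limited W 2 i"
  shows "card (near W (R (Suc t)) a) < 2"
proof (rule ccontr)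
  assume "\<not> ?thesis"
  then have "2 \<le> card (near W (R (Suc t)) a)" by simp
  then obtain M where M: "M \<subseteq> near W (R (Suc t)) a" "card M = 2"
    by (rule obtain_subset_with_card_n)
  then obtain y1 y2 where y12: "M = {y1, y2}" "y1 \<noteq> y2" by (auto simp: card_2_iff)
  then have y: "y1 \<in> R (Suc t)" "y2 \<in> R (Suc t)" "\<bar>y1 - a\<bar> \<le> W" "\<bar>y2 - a\<bar> \<le> W"
    using M(1) by (auto simp: near_def)
  have src: "\<exists>x Q. row_source i y x Q" if "i \<le> t" "y \<in> R (Suc i)" "y \<notin> R i" for i y
    by (rule row_source_exists[OF limited_\<rho>[OF lim] that(2,3)]) fact
  have no_old: False if y1: "y1 \<in> R t" and y2: "y2 \<in> R (Suc t)" "y2 \<notin> R t"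
    and c: "\<bar>y1 - y2\<bar> \<le> 2 * W" for y1 y2
  proof -
    obtain t1 where t1: "t1 < t" "y1 \<notin> R t1" "y1 \<in> R (Suc t1)" using R_birth[OF y1] by blast
    obtain x1 Q1 where s1: "row_source t1 y1 x1 Q1" using src[of t1 y1] t1 by auto
    obtain x2 Q2 where s2: "row_source t y2 x2 Q2" using src[of t y2] y2 by auto
    have no1: "D + int \<rho> < \<bar>b - y1\<bar>" if "b \<in> R t1" for b
    proof (rule ccontr)
      assume "\<not> ?thesis"
      then have "\<bar>b - y1\<bar> \<le> W" using W0 by linarith
      moreover have "b \<in> R t" using that R_mono[of t1 t] t1(1) by auto
      ultimately have "b = y1" using limited_unique(1)[OF lim[of t]] y1 by simp
      then show False using that t1(2) by simp
    qed
    show False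
      by (rule no_two_rows[OF lim _ _ s1 s2 _ c no1]) (use y1 y2 t1 in auto)
  qed
  show False
  proof (cases "y1 \<in> R t \<or> y2 \<in> R t")
    case True
    have "\<not> (y1 \<in> R t \<and> y2 \<in> R t)"
    proof
      assume "y1 \<in> R t \<and> y2 \<in> R t"
      then have "{y1, y2} \<subseteq> near W (R t) a" using y by (auto simp: near_def)
      then have "card {y1, y2} \<le> card (near W (R t) a)" by (rule card_mono[rotated]) simp
      moreover have "card (near W (R t) a) < 2" using lim[of t] by (simp add: limited_def)
      ultimately show False using y12(2) by simp
    qed
    moreover have "\<bar>y1 - y2\<bar> \<le> 2 * W" "\<bar>y2 - y1\<bar> \<le> 2 * W" using y by linarith+
    ultimately show ?thesis using True no_old[of y1 y2] no_old[of y2 y1] y by blast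
  next
    case False
    have no: "D + int \<rho> < \<bar>b - z\<bar>" if b: "b \<in> R t" and z: "z \<in> {y1, y2}" for b z
    proof (rule ccontr)
      assume "\<not> ?thesis"
      then have "\<bar>b - z\<bar> \<le> 2 * W" using W0 by linarith
      then show False using no_old[of b z] b z False y by blast
    qed
    obtain x1 Q1 where s1: "row_source t y1 x1 Q1" using src[of t y1] y False by auto
    obtain x2 Q2 where s2: "row_source t y2 x2 Q2" using src[of t y2] y False by auto
    show False
      by (rule no_two_rows[OF lim _ _ s1 s2 y12(2)]) (use y no in auto)
  qed
qed

end

context two_two_growth
begin

lemma origin_never_occupied_two_two: "(0, 0) \<notin> \<xi> t"
proof
  interpret T: two_two_growth \<rho> r s2 s1 "\<lambda>t. (\<xi> t)\<inverse>" \<gamma> K N n m W by (rule converse_two_two)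
  have TR: "T.limited U k i \<longleftrightarrow> limited U k i" for U k i
    unfolding T.limited_def limited_def by auto
  have lim: "limited W 2 i" for i
  proof (induction i rule: less_induct)
    case (less i)
    show ?case
    proof (cases i)
      case 0
      then show ?thesis using limited_0[of 2 W] by simp
    next
      case (Suc j)
      have "card (near W (R (Suc j)) a) < 2" for a
        by (rule at_most_one_row_Suc) (use less Suc in auto)
      moreover have "card (near W (good_rows \<rho> r (\<lambda>t. (\<xi> t)\<inverse>) (Suc j)) a) < 2" for a
        by (rule T.at_most_one_row_Suc) (use less Suc TR in auto)
      ultimately show ?thesis unfolding limited_def Suc by simp
    qed
  qed
  then have lim': "limited (int \<rho>) m i" for i using limited_\<rho> by blast
  have le: "\<gamma> \<le> real (r + 1 - m)" using r s unfolding \<gamma>r by (simp add: of_nat_diff)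
  assume 0: "(0, 0) \<in> \<xi> t"
  have "0 \<notin> R t" by (rule zero_not_in_R[OF lim' le])
  moreover have "0 \<notin> C t" using T.zero_not_in_R[of t] le lim' TR by simp
  ultimately show False using origin_off[OF lim' 0] by (simp add: off_def)
qed

end

section \<open>The energy of an ancestry of lines\<close>

text \<open>A line \<open>(True, y)\<close> is the row at height \<open>y\<close>, a line \<open>(False, x)\<close> the column at \<open>x\<close>.\<close>
type_synonym line = "bool \<times> int"

definition covered :: "int \<Rightarrow> int set \<Rightarrow> int \<Rightarrow> bool" where
  "covered U L x \<longleftrightarrow> (\<exists>a\<in>L. \<bar>x - a\<bar> \<le> U)"

lemma covered_mono: "covered U L x \<Longrightarrow> U \<le> U' \<Longrightarrow> L \<subseteq> L' \<Longrightarrow> covered U' L' x"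
  unfolding covered_def by force

lemma covered_near: "covered U L x \<Longrightarrow> \<bar>y - x\<bar> \<le> d \<Longrightarrow> covered (U + d) L y"
  unfolding covered_def by force

definition cost :: "(bool \<Rightarrow> int set) \<Rightarrow> nat" where
  "cost L = card (L True - {0}) + card (L False - {0})"

text \<open>Here 0 is counted as well, since the number N in \<open>sparse\<close> limits all
  coordinates.\<close>

definition places :: "(bool \<Rightarrow> int set) \<Rightarrow> nat" where
  "places L = card (L True) + card (L False)"

text \<open>\<open>gain k\<close> is the energy that a new line of kind k leaves over when its
  ancestry is paid for, and \<delta> is a further surplus for every line. By \<open>budget\<close>,
  a line with m helpers lives on its own points if its location is already covered; otherwise its
  points and the gains of m new helpers together pay \<gamma> for the location. By
  \<open>lim\<close>, that many helpers near one point would outweigh the cost of the point.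
  \<open>no_big\<close> is sparseness for boundedly many coordinates. B bounds an ancestry: its
  energy starts no lower than -\<gamma>, must stay negative, and rises by \<delta> per line.\<close>

locale line_history =
  fixes good :: "line set" and ord :: "line \<Rightarrow> nat" and loc :: "line \<Rightarrow> int"
    and helpers :: "line \<Rightarrow> line set" and pts :: "line \<Rightarrow> (int \<times> int) set"
    and \<rho> :: nat and thr lim :: "bool \<Rightarrow> nat" and gain :: "bool \<Rightarrow> real" and \<gamma> \<delta> :: real and B lim_max :: nat
  assumes helpers: "l \<in> good \<Longrightarrow> finite (helpers l)" "l \<in> good \<Longrightarrow> helpers l \<subseteq> good"
      "l \<in> good \<Longrightarrow> l' \<in> helpers l \<Longrightarrow> fst l' = (\<not> fst l) \<and> ord l' < ord l \<and> \<bar>snd l' - loc l\<bar> \<le> int \<rho>"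
    and pts: "l \<in> good \<Longrightarrow> finite (pts l)" "l \<in> good \<Longrightarrow> thr (fst l) \<le> card (pts l) + card (helpers l)"
    and disj: "l \<in> good \<Longrightarrow> l' \<in> good \<Longrightarrow> l \<noteq> l' \<Longrightarrow> pts l \<inter> pts l' = {}"
    and gain: "0 \<le> gain k" "0 < \<delta>" "0 \<le> \<gamma>" "\<gamma> / \<delta> \<le> real B"
    and lim: "1 \<le> lim k" "lim k \<le> lim_max" "\<gamma> \<le> real (lim k) * (gain (\<not> k) + \<delta>)"
    and budget: "m < lim k \<Longrightarrow> gain k + \<delta> \<le> real (thr k) - real m"
      "m < lim k \<Longrightarrow> gain k + \<delta> \<le> real (thr k) - real m + real m * gain (\<not> k) - \<gamma>"
    and no_big: "finite G \<Longrightarrow> G \<subseteq> good \<Longrightarrow> (\<Union>l\<in>G. pts l) \<noteq> {} \<Longrightarrow>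
      (\<And>l. l \<in> G \<Longrightarrow> covered U (L (fst l)) (snd l) \<and> covered U (L (\<not> fst l)) (loc l)) \<Longrightarrow>
      (\<And>k. finite (L k)) \<Longrightarrow> U \<le> int \<rho> * (1 + 4 * (1 + int lim_max * int B)) \<Longrightarrow> places L \<le> 2 + lim_max * B \<Longrightarrow>
      real (card (\<Union>l\<in>G. pts l)) < \<gamma> * real (cost L)"
begin

definition anc :: "line \<Rightarrow> line set" where
  "anc l = {l'. (l, l') \<in> {(a, b). b \<in> helpers a}\<^sup>*}"

lemma anc_self: "l \<in> anc l"
  by (simp add: anc_def)

lemma anc_eq: "anc l = insert l (\<Union>l'\<in>helpers l. anc l')"
  unfolding anc_def by (auto intro: converse_rtrancl_into_rtrancl elim: converse_rtranclE)

lemma anc_good: "l' \<in> anc l \<Longrightarrow> l \<in> good \<Longrightarrow> l' \<in> good \<and> (l' = l \<or> ord l' < ord l)"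
proof -
  assume "l' \<in> anc l"
  then have "(l, l') \<in> {(a, b). b \<in> helpers a}\<^sup>*" by (simp add: anc_def)
  then show "l \<in> good \<Longrightarrow> l' \<in> good \<and> (l' = l \<or> ord l' < ord l)"
  proof (induction rule: rtrancl_induct)
    case (step b c)
    have b: "b \<in> good" "b = l \<or> ord b < ord l" using step.IH step.prems by auto
    have c: "c \<in> helpers b" using step.hyps by simp
    have "c \<in> good" using helpers(2)[OF b(1)] c by blast
    moreover have "ord c < ord b" using helpers(3)[OF b(1) c] by blast
    ultimately show ?case using b(2) by auto
  qed simp
qed

definition closed :: "line set \<Rightarrow> bool" where
  "closed G \<longleftrightarrow> (\<forall>l\<in>G. helpers l \<subseteq> G)"

lemma closed_anc: "closed G \<Longrightarrow> l \<in> G \<Longrightarrow> anc l \<subseteq> G"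
proof
  fix l' assume G: "closed G" "l \<in> G" and "l' \<in> anc l"
  then have "(l, l') \<in> {(a, b). b \<in> helpers a}\<^sup>*" by (simp add: anc_def)
  then show "l' \<in> G" by (induction rule: rtrancl_induct) (use G in \<open>auto simp: closed_def\<close>)
qed

definition valid :: "int \<Rightarrow> line set \<Rightarrow> (bool \<Rightarrow> int set) \<Rightarrow> bool" where
  "valid U G L \<longleftrightarrow> 0 \<le> U \<and> finite G \<and> G \<subseteq> good \<and> closed G \<and> (\<forall>k. finite (L k)) \<and>
     (\<forall>l\<in>G. covered U (L (fst l)) (snd l) \<and> covered U (L (\<not> fst l)) (loc l))"

lemma valid_mono: "valid U G L \<Longrightarrow> U \<le> U' \<Longrightarrow> (\<And>k. L k \<subseteq> L' k) \<Longrightarrow> (\<And>k. finite (L' k)) \<Longrightarrow> valid U' G L'"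
  unfolding valid_def by (meson covered_mono order_trans)

definition energy :: "line set \<Rightarrow> (bool \<Rightarrow> int set) \<Rightarrow> real" where
  "energy G L = real (card (\<Union>l\<in>G. pts l)) - \<gamma> * real (cost L)"

definition extends :: "int \<Rightarrow> line set \<Rightarrow> (bool \<Rightarrow> int set) \<Rightarrow> line set \<Rightarrow> real \<Rightarrow> bool" where
  "extends U G L F e \<longleftrightarrow> (\<exists>L' n. (\<forall>k. L k \<subseteq> L' k) \<and> card (G \<union> F) = card G + n \<and>
     valid (U + 4 * int \<rho> * int n) (G \<union> F) L' \<and>
     energy G L + e + \<delta> * real n \<le> energy (G \<union> F) L' \<and> places L' \<le> places L + n)"

text \<open>Relative to an arbitrary closed G, because ancestries overlap and lines already present
  must not be counted again. The coordinate of l itself is assumed to be covered: whatever uses l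
  has paid for it.\<close>

definition extendible :: "line \<Rightarrow> bool" where
  "extendible l \<longleftrightarrow> (\<forall>U G L. valid U G L \<longrightarrow> l \<notin> G \<longrightarrow> covered U (L (fst l)) (snd l) \<longrightarrow>
     extends U G L (anc l) (gain (fst l)))"

lemma extends_set:
  assumes "finite S" "S \<subseteq> good" "\<And>l. l \<in> S \<Longrightarrow> fst l = k \<and> extendible l"
    and "valid U G L" "S \<inter> G = {}" "\<And>l. l \<in> S \<Longrightarrow> covered U (L k) (snd l)"
  shows "extends U G L (\<Union>l\<in>S. anc l) (real (card S) * gain k)"
  using assms(1,2,3,5,6)
proof (induction "card S" arbitrary: S)
  case 0
  then have "S = {}" by simp
  with assms(4) show ?case
    unfolding extends_def by (intro exI[of _ L] exI[of _ 0]) auto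
next
  case (Suc c)
  then have "S \<noteq> {}" by auto
  \<comment> \<open>The youngest line is added last. It is no ancestor of the others, so it is still
    missing when its turn comes.\<close>
  then obtain l where l: "l \<in> S" "\<And>l'. l' \<in> S \<Longrightarrow> ord l' \<le> ord l"
    using Max_in[of "ord ` S"] Max_ge[of "ord ` S"] Suc.prems(1) by (metis (no_types, lifting) finite_imageI image_iff image_is_empty imageI)
  let ?S = "S - {l}" and ?G = "G \<union> (\<Union>l'\<in>S - {l}. anc l')"
  have c: "card ?S = c" using Suc.hyps(2) l(1) Suc.prems(1) by simp
  have "extends U G L (\<Union>l\<in>?S. anc l) (real (card ?S) * gain k)"
    by (rule Suc.hyps(1)) (use Suc.prems c in auto)
  then obtain L1 n1 where 1: "\<And>k. L k \<subseteq> L1 k" "card ?G = card G + n1"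
      "valid (U + 4 * int \<rho> * int n1) ?G L1"
      "energy G L + real c * gain k + \<delta> * real n1 \<le> energy ?G L1" "places L1 \<le> places L + n1"
    unfolding extends_def c by blast
  have "l \<notin> anc l'" if "l' \<in> ?S" for l'
  proof
    assume "l \<in> anc l'"
    then have "l = l' \<or> ord l < ord l'" using anc_good[of l l'] Suc.prems(2) that by blast
    then show False using l(2)[of l'] that by auto
  qed
  then have "l \<notin> ?G" using l(1) Suc.prems(4) by blast
  moreover have "covered (U + 4 * int \<rho> * int n1) (L1 k) (snd l)"
    by (rule covered_mono[OF Suc.prems(5)[OF l(1)] _ 1(1)]) simp
  ultimately have "extends (U + 4 * int \<rho> * int n1) ?G L1 (anc l) (gain k)"
    using Suc.prems(3)[OF l(1)] 1(3) unfolding extendible_def by blast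
  then obtain L2 n2 where 2: "\<And>k. L1 k \<subseteq> L2 k" "card (?G \<union> anc l) = card ?G + n2"
      "valid (U + 4 * int \<rho> * int n1 + 4 * int \<rho> * int n2) (?G \<union> anc l) L2"
      "energy ?G L1 + gain k + \<delta> * real n2 \<le> energy (?G \<union> anc l) L2" "places L2 \<le> places L1 + n2"
    unfolding extends_def by blast
  have G: "G \<union> (\<Union>l\<in>S. anc l) = ?G \<union> anc l" using l(1) by blast
  show ?case
    unfolding extends_def G
  proof (intro exI[of _ L2] exI[of _ "n1 + n2"] conjI allI)
    show "L k \<subseteq> L2 k" for k using 1(1) 2(1) by blast
    show "card (?G \<union> anc l) = card G + (n1 + n2)" using 1(2) 2(2) by simp
    show "valid (U + 4 * int \<rho> * int (n1 + n2)) (?G \<union> anc l) L2"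
      using 2(3) by (simp add: algebra_simps)
    show "places L2 \<le> places L + (n1 + n2)" using 1(5) 2(5) by simp
    have "real (card S) * gain k = real c * gain k + gain k"
      using Suc.hyps(2)[symmetric] by (simp add: algebra_simps)
    then show "energy G L + real (card S) * gain k + \<delta> * real (n1 + n2) \<le> energy (?G \<union> anc l) L2"
      using 1(4) 2(4) by (simp add: distrib_left)
  qed
qed

lemma finite_Union_pts: "finite G \<Longrightarrow> G \<subseteq> good \<Longrightarrow> finite (\<Union>l\<in>G. pts l)"
  using pts(1) by blast

lemma add_line:
  assumes G: "valid U G L" and l: "l \<in> good" "l \<notin> G" "helpers l \<subseteq> G"
    and cov: "covered U (L (fst l)) (snd l)" "covered U (L (\<not> fst l)) (loc l)"
  shows "valid U (insert l G) L" "card (insert l G) = card G + 1"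
    "energy G L + (real (thr (fst l)) - real (card (helpers l))) \<le> energy (insert l G) L"
proof -
  show "valid U (insert l G) L"
    using G l cov unfolding valid_def closed_def by blast
  have fin: "finite G" "G \<subseteq> good" using G unfolding valid_def by blast+
  then show "card (insert l G) = card G + 1" using l(2) by simp
  have "pts l \<inter> (\<Union>l\<in>G. pts l) = {}" using disj[OF l(1)] fin(2) l(2) by blast
  then have "card (\<Union>l\<in>insert l G. pts l) = card (pts l) + card (\<Union>l\<in>G. pts l)"
    using finite_Union_pts[OF fin] pts(1)[OF l(1)] by (simp add: card_Un_disjoint)
  moreover have "real (thr (fst l)) \<le> real (card (pts l) + card (helpers l))"
    using pts(2)[OF l(1)] by (rule of_nat_mono)
  ultimately show "energy G L + (real (thr (fst l)) - real (card (helpers l))) \<le> energy (insert l G) L"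
    unfolding energy_def by simp
qed

text \<open>
  If the location of the new line is covered, its own points pay for it.  Otherwise covering it
  costs \<open>\<gamma>\<close>, but then none of its helpers was present, and their gains pay for that.
\<close>
lemma extendible_step:
  assumes l: "l \<in> good" and small: "card (helpers l) < lim (fst l)"
    and ext: "\<And>l'. l' \<in> helpers l \<Longrightarrow> extendible l'"
  shows "extendible l"
  unfolding extendible_def
proof (intro allI impI)
  fix U G L assume G: "valid U G L" and lG: "l \<notin> G" and cov: "covered U (L (fst l)) (snd l)"
  define k where "k = fst l"
  define a where "a = loc l"
  have U0: "0 \<le> U" and finL: "\<And>k. finite (L k)" and clG: "closed G" using G unfolding valid_def by blast+
  have S: "fst l' = (\<not> k) \<and> ord l' < ord l \<and> \<bar>snd l' - a\<bar> \<le> int \<rho>" if "l' \<in> helpers l" for l'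
    using helpers(3)[OF l that] by (simp add: k_def a_def)
  have l_notin: "l \<notin> anc l'" if "l' \<in> helpers l" for l'
    using anc_good[of l l'] helpers(2)[OF l] S[OF that] that by fastforce
  have anc_sub: "G \<union> anc l = insert l (G \<union> (\<Union>l'\<in>helpers l - G. anc l'))"
    using closed_anc[OF clG] by (subst anc_eq) blast
  \<comment> \<open>i is the number of coordinates, 0 or 1, that are bought to cover the location
    a.\<close>
  have finish: "extends U G L (anc l) (gain k)"
    if L0: "\<And>k. L k \<subseteq> L0 k" "\<And>k. finite (L0 k)" "places L0 \<le> places L + i" "i \<le> 1"
      "energy G L - \<gamma> * real i \<le> energy G L0" "covered (U + int \<rho>) (L0 (\<not> k)) a"
      and gn: "gain k + \<delta> \<le> real (thr k) - real (card (helpers l)) + real (card (helpers l - G)) * gain (\<not> k) - \<gamma> * real i"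
    for L0 i
  proof -
    let ?U = "U + 2 * int \<rho>"
    have "valid ?U G L0" by (rule valid_mono[OF G]) (use L0 in auto)
    moreover have "covered ?U (L0 (\<not> k)) (snd l')" if "l' \<in> helpers l - G" for l'
      using covered_near[OF L0(6), of "snd l'" "int \<rho>"] S[of l'] that by (simp add: algebra_simps)
    moreover have "fst l' = (\<not> k) \<and> extendible l'" if "l' \<in> helpers l - G" for l'
      using ext S that by blast
    moreover have "finite (helpers l - G)" "helpers l - G \<subseteq> good" "(helpers l - G) \<inter> G = {}"
      using helpers(1,2)[OF l] by auto
    ultimately have "extends ?U G L0 (\<Union>l'\<in>helpers l - G. anc l') (real (card (helpers l - G)) * gain (\<not> k))"
      by (intro extends_set)
    then obtain L1 n where 1: "\<And>k. L0 k \<subseteq> L1 k"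
        "card (G \<union> (\<Union>l'\<in>helpers l - G. anc l')) = card G + n"
        "valid (?U + 4 * int \<rho> * int n) (G \<union> (\<Union>l'\<in>helpers l - G. anc l')) L1"
        "energy G L0 + real (card (helpers l - G)) * gain (\<not> k) + \<delta> * real n \<le>
           energy (G \<union> (\<Union>l'\<in>helpers l - G. anc l')) L1" "places L1 \<le> places L0 + n"
      unfolding extends_def by blast
    let ?G = "G \<union> (\<Union>l'\<in>helpers l - G. anc l')"
    have v: "valid (U + 4 * int \<rho> * int (n + 1)) ?G L1"
      by (rule valid_mono[OF 1(3)]) (use 1(3) in \<open>auto simp: valid_def algebra_simps\<close>)
    have nl: "l \<notin> ?G" using lG l_notin by blast
    have sl: "helpers l \<subseteq> ?G" using anc_self by blast
    have c1: "covered (U + 4 * int \<rho> * int (n + 1)) (L1 (fst l)) (snd l)"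
      by (rule covered_mono[OF cov]) (use L0(1) 1(1) in auto)
    have c2: "covered (U + 4 * int \<rho> * int (n + 1)) (L1 (\<not> fst l)) (loc l)"
      by (rule covered_mono[OF L0(6)[unfolded k_def a_def] _ 1(1)]) (simp add: algebra_simps)
    note 2 = add_line[OF v l nl sl c1 c2]
    show ?thesis unfolding extends_def anc_sub
    proof (intro exI[of _ L1] exI[of _ "n + 1"] conjI allI)
      show "L k \<subseteq> L1 k" for k using L0(1) 1(1) by blast
      show "card (insert l ?G) = card G + (n + 1)" using 1(2) 2(2) by simp
      show "valid (U + 4 * int \<rho> * int (n + 1)) (insert l ?G) L1" by (rule 2(1))
      show "places L1 \<le> places L + (n + 1)" using 1(5) L0(3,4) by linarith
      have "\<delta> * real (n + 1) = \<delta> * real n + \<delta>" by (simp add: distrib_left)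
      then show "energy G L + gain k + \<delta> * real (n + 1) \<le> energy (insert l ?G) L1"
        using 1(4) 2(3) L0(5) gn unfolding k_def[symmetric] by linarith
    qed
  qed
  show "extends U G L (anc l) (gain (fst l))"
    unfolding k_def[symmetric]
  proof (cases "covered (U + int \<rho>) (L (\<not> k)) a")
    case True
    have "0 \<le> real (card (helpers l - G)) * gain (\<not> k)" using gain(1) by simp
    then show "extends U G L (anc l) (gain k)"
      using budget(1)[OF small] by (intro finish[of L 0]) (use finL True k_def in auto)
  next
    case False
    \<comment> \<open>A helper in G would have its coordinate covered up to U, and it is within
      \<rho> of a.\<close>
    have "helpers l \<inter> G = {}"
    proof (rule ccontr)
      assume "helpers l \<inter> G \<noteq> {}"
      then obtain l' where l': "l' \<in> helpers l" "l' \<in> G" by blast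
      have fl: "fst l' = (\<not> k)" and d: "\<bar>a - snd l'\<bar> \<le> int \<rho>"
        using S[OF l'(1)] by (auto simp: abs_minus_commute)
      have "covered U (L (fst l')) (snd l')" using G l'(2) unfolding valid_def by blast
      then show False using covered_near[OF _ d] False unfolding fl by blast
    qed
    then have SG: "helpers l - G = helpers l" by blast
    define L0 where "L0 = L(\<not> k := insert a (L (\<not> k)))"
    have c: "card (insert a (L (\<not> k))) \<le> card (L (\<not> k)) + 1" "card (insert a (L (\<not> k)) - {0}) \<le> card (L (\<not> k) - {0}) + 1"
      using finL[of "\<not> k"] by (auto simp: card_insert_if insert_Diff_if)
    have "places L0 \<le> places L + 1" "cost L0 \<le> cost L + 1"
      using c by (cases k; simp add: L0_def places_def cost_def)+
    then have "\<gamma> * real (cost L0) \<le> \<gamma> * real (cost L + 1)"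
      using gain(3) by (intro mult_left_mono of_nat_mono) auto
    then have en: "energy G L - \<gamma> * real 1 \<le> energy G L0"
      unfolding energy_def by (simp add: distrib_left)
    show "extends U G L (anc l) (gain k)"
    proof (rule finish[of L0 1])
      show "L k' \<subseteq> L0 k'" "finite (L0 k')" for k' using finL by (auto simp: L0_def)
      show "covered (U + int \<rho>) (L0 (\<not> k)) a" using U0 by (simp add: L0_def covered_def)
      show "gain k + \<delta> \<le> real (thr k) - real (card (helpers l)) + real (card (helpers l - G)) * gain (\<not> k) - \<gamma> * real 1"
        using budget(2)[OF small] unfolding SG k_def[symmetric] by simp
    qed (use \<open>places L0 \<le> places L + 1\<close> en in auto)
  qed
qed

lemma pts_nonempty:
  assumes "l \<in> good" "card (helpers l) < lim (fst l)"
  shows "pts l \<noteq> {}"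
proof
  assume "pts l = {}"
  then have "thr (fst l) \<le> card (helpers l)" using pts(2)[OF assms(1)] by simp
  then show False using budget(1)[OF assms(2)] gain(1)[of "fst l"] gain(2) by simp
qed

lemma initial_energy:
  fixes a :: int and k :: bool
  defines "L \<equiv> (\<lambda>_ :: bool. {} :: int set)(k := {a})"
  shows "valid (int \<rho>) {} L" "places L = 1" "- \<gamma> \<le> energy {} L" "a = 0 \<Longrightarrow> energy {} L = 0"
proof -
  show "valid (int \<rho>) {} L" by (simp add: valid_def closed_def L_def)
  show "places L = 1" "a = 0 \<Longrightarrow> energy {} L = 0"
    by (cases k; simp add: L_def places_def energy_def cost_def)+
  have "cost L \<le> 1" by (cases k) (auto simp: L_def cost_def card_Diff_singleton_if)
  then have "\<gamma> * real (cost L) \<le> \<gamma> * 1" using gain(3) by (intro mult_left_mono) auto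
  then show "- \<gamma> \<le> energy {} L" by (simp add: energy_def)
qed

text \<open>The bound on \<open>card F\<close> keeps the radius and the number of coordinates within
  the reach of \<open>no_big\<close>.\<close>

lemma closure_energy_negative:
  assumes ext: "extends (int \<rho>) {} L F e" and L: "places L = 1"
    and l: "l \<in> F" "pts l \<noteq> {}" and F: "card F \<le> 1 + c * B" "c \<le> lim_max"
  shows "energy {} L + e + \<delta> * real (card F) < 0"
proof -
  obtain L' where L': "valid (int \<rho> + 4 * int \<rho> * int (card F)) F L'"
      "energy {} L + e + \<delta> * real (card F) \<le> energy F L'" "places L' \<le> 1 + card F"
    using ext L unfolding extends_def by auto
  have le: "card F \<le> 1 + lim_max * B" using F mult_le_mono1[of c lim_max B] by linarith
  then have "int (card F) \<le> 1 + int lim_max * int B" by (metis of_nat_1 of_nat_add of_nat_le_iff of_nat_mult)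
  then have "int \<rho> * (1 + 4 * int (card F)) \<le> int \<rho> * (1 + 4 * (1 + int lim_max * int B))"
    by (intro mult_left_mono) auto
  then have U: "int \<rho> + 4 * int \<rho> * int (card F) \<le> int \<rho> * (1 + 4 * (1 + int lim_max * int B))"
    by (simp add: algebra_simps)
  have ne: "(\<Union>l\<in>F. pts l) \<noteq> {}" using l by blast
  have "places L' \<le> 2 + lim_max * B" using L'(3) le by linarith
  then have "real (card (\<Union>l\<in>F. pts l)) < \<gamma> * real (cost L')"
    by (intro no_big[OF _ _ ne _ _ U]) (use L'(1) in \<open>auto simp: valid_def\<close>)
  then show ?thesis using L'(2) by (simp add: energy_def)
qed

text \<open>
  A line whose helpers have at most \<open>B\<close> ancestors each has boundedly many ancestors, so the
  hypothesis \<open>no_big\<close> applies to it; since energy grows by \<open>\<delta>\<close> with every ancestor, it has in fact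
  at most \<open>B\<close> of them.
\<close>
lemma all_extendible:
  "l \<in> good \<Longrightarrow> card (helpers l) < lim (fst l) \<and> finite (anc l) \<and> card (anc l) \<le> B \<and> extendible l"
proof (induction "ord l" arbitrary: l rule: less_induct)
  case less
  note l = less.prems
  define k where "k = fst l"
  have IH: "card (helpers l') < lim (\<not> k)" "finite (anc l')" "card (anc l') \<le> B" "extendible l'" "l' \<in> good"
    "fst l' = (\<not> k)" "\<bar>snd l' - loc l\<bar> \<le> int \<rho>"
    if "l' \<in> helpers l" for l'
    using less.hyps[of l'] helpers[OF l] that by (auto simp: k_def)
  have card_Union: "finite (\<Union>l'\<in>S. anc l')" "card (\<Union>l'\<in>S. anc l') \<le> card S * B" if "S \<subseteq> helpers l" "finite S" for S
  proof -
    show "finite (\<Union>l'\<in>S. anc l')" using that IH(2) by blast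
    have "card (\<Union>l'\<in>S. anc l') \<le> (\<Sum>l'\<in>S. card (anc l'))" by (rule card_UN_le[OF that(2)])
    also have "\<dots> \<le> (\<Sum>l'\<in>S. B)" by (rule sum_mono) (use that IH(3) in blast)
    finally show "card (\<Union>l'\<in>S. anc l') \<le> card S * B" by simp
  qed
  have small: "card (helpers l) < lim k"
  proof (rule ccontr)
    assume "\<not> ?thesis"
    then have "lim k \<le> card (helpers l)" by simp
    \<comment> \<open>Only \<open>lim k\<close> helpers are kept, so that their joint ancestry is
      bounded. Starting from the single coordinate \<open>loc l\<close> the energy is at least
      -\<gamma>, and their gains raise it to 0.\<close>
    then obtain S where S: "S \<subseteq> helpers l" "card S = lim k" "finite S" by (rule obtain_subset_with_card_n)
    define L where "L = (\<lambda>_ :: bool. {} :: int set)(\<not> k := {loc l})"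
    note L = initial_energy[where k = "\<not> k" and a = "loc l", folded L_def]
    have ext: "extends (int \<rho>) {} L (\<Union>l'\<in>S. anc l') (real (card S) * gain (\<not> k))"
    proof (rule extends_set[OF S(3)])
      show "S \<subseteq> good" using S(1) IH(5) by blast
      fix l' assume l': "l' \<in> S"
      show "fst l' = (\<not> k) \<and> extendible l'" using IH(4,6) S(1) l' by blast
      have "\<bar>snd l' - loc l\<bar> \<le> int \<rho>" using IH(7) S(1) l' by blast
      then show "covered (int \<rho>) (L (\<not> k)) (snd l')" by (simp add: L_def covered_def)
    qed (use L(1) in simp_all)
    have "S \<noteq> {}" using S(2) lim(1)[of k] by auto
    then obtain l' where l': "l' \<in> S" by blast
    then have pl': "l' \<in> (\<Union>l'\<in>S. anc l')" using anc_self by blast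
    have "l' \<in> helpers l" using l' S(1) by blast
    then have ne: "pts l' \<noteq> {}" using pts_nonempty[of l'] IH by simp
    have card: "card (\<Union>l'\<in>S. anc l') \<le> 1 + lim k * B" using card_Union(2)[OF S(1,3)] S(2) by simp
    have neg: "energy {} L + real (lim k) * gain (\<not> k) + \<delta> * real (card (\<Union>l'\<in>S. anc l')) < 0"
      using closure_energy_negative[OF ext L(2) pl' ne card lim(2)] S(2) by simp
    have "S \<subseteq> (\<Union>l'\<in>S. anc l')" using anc_self by blast
    then have "lim k \<le> card (\<Union>l'\<in>S. anc l')" using card_mono[OF card_Union(1)[OF S(1,3)]] S(2) by metis
    then have "\<delta> * real (lim k) \<le> \<delta> * real (card (\<Union>l'\<in>S. anc l'))" using gain(2) by (intro mult_left_mono) auto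
    then show False using neg L(3) lim(3)[of k] by (simp add: distrib_left mult.commute)
  qed
  have ext: "extendible l" by (rule extendible_step[OF l]) (use small IH k_def in auto)
  have fin: "finite (anc l)" "card (anc l) \<le> 1 + card (helpers l) * B"
    using card_Union[OF order_refl helpers(1)[OF l]] by (subst anc_eq; simp add: card_insert_if)+
  define L where "L = (\<lambda>_ :: bool. {} :: int set)(k := {snd l})"
  note L = initial_energy[where k = k and a = "snd l", folded L_def]
  have "extends (int \<rho>) {} L (anc l) (gain k)"
    using ext[unfolded extendible_def, rule_format, OF L(1)] by (simp add: L_def covered_def k_def)
  moreover have "pts l \<noteq> {}" using pts_nonempty[OF l] small by (simp add: k_def)
  moreover have "card (helpers l) \<le> lim_max" using small lim(2)[of k] by linarith
  ultimately have "energy {} L + gain k + \<delta> * real (card (anc l)) < 0"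
    using closure_energy_negative[OF _ L(2) anc_self _ fin(2)] by blast
  then have "\<delta> * real (card (anc l)) < \<gamma>" using L(3) gain(1)[of k] by linarith
  then have "real (card (anc l)) < \<gamma> / \<delta>" using gain(2) by (simp add: pos_less_divide_eq mult.commute)
  then have "card (anc l) \<le> B" using gain(4) by linarith
  then show ?case using small fin(1) ext by (simp add: k_def)
qed

text \<open>With the free coordinate 0 the energy starts at 0 instead of -\<gamma>, so it cannot
  become negative.\<close>

lemma zero_line_not_good:
  assumes "snd l = 0"
  shows "l \<notin> good"
proof
  assume l: "l \<in> good"
  define k where "k = fst l"
  have a: "card (helpers l) < lim k" "card (anc l) \<le> B" "extendible l"
    using all_extendible[OF l] by (auto simp: k_def)
  define L where "L = (\<lambda>_ :: bool. {} :: int set)(k := {0})"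
  note L = initial_energy[where k = k and a = 0, folded L_def]
  have ext: "extends (int \<rho>) {} L (anc l) (gain k)"
    using a(3)[unfolded extendible_def, rule_format, OF L(1)] assms by (simp add: L_def covered_def k_def)
  have "pts l \<noteq> {}" using pts_nonempty[OF l] a(1) by (simp add: k_def)
  moreover have "card (anc l) \<le> 1 + 1 * B" "1 \<le> lim_max" using a(2) lim(1,2)[of k] by linarith+
  ultimately have "energy {} L + gain k + \<delta> * real (card (anc l)) < 0"
    using closure_energy_negative[OF ext L(2) anc_self] by blast
  moreover have "0 \<le> \<delta> * real (card (anc l))" using gain(2) by (intro mult_nonneg_nonneg) auto
  ultimately show False using L(4) gain(1)[of k] by simp
qed

end

section \<open>The case \<open>s1 = 1\<close>\<close>

definition site :: "bool \<Rightarrow> int \<Rightarrow> int \<Rightarrow> int \<times> int" where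
  "site k a z = (if k then (a, z) else (z, a))"

lemma site_simps [simp]: "site True a z = (a, z)" "site False a z = (z, a)"
  by (simp_all add: site_def)

definition filled :: "nat \<Rightarrow> (int \<times> int) set \<Rightarrow> bool \<Rightarrow> int set \<Rightarrow> int \<Rightarrow> int \<Rightarrow> int set" where
  "filled \<rho> X k L z x = {a. \<bar>a - x\<bar> \<le> int \<rho> \<and> (site k a z \<in> X \<or> a \<in> L)}"

lemma finite_filled [simp]: "finite (filled \<rho> X k L z x)"
  by (simp add: filled_def)

text \<open>Rows are created at odd steps, columns at even ones.\<close>
primrec level :: "nat \<Rightarrow> (int \<times> int) set \<Rightarrow> (bool \<Rightarrow> nat) \<Rightarrow> nat \<Rightarrow> int set" where
  "level \<rho> X thr 0 = {}"
| "level \<rho> X thr (Suc i) = {z. \<exists>x. thr (even i) \<le> card (filled \<rho> X (even i) (level \<rho> X thr i) z x)}"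

locale lines =
  fixes \<rho> :: nat and X :: "(int \<times> int) set" and thr :: "bool \<Rightarrow> nat"
begin

abbreviation "lev \<equiv> level \<rho> X thr"

definition "good = {(k, z). \<exists>i. odd i = k \<and> z \<in> lev i}"
definition "ord l = (LEAST i. odd i = fst l \<and> snd l \<in> lev i)"
definition "before l = lev (ord l - 1)"
definition "loc l = (SOME x. thr (fst l) \<le> card (filled \<rho> X (fst l) (before l) (snd l) x))"
definition "helpers l = {\<not> fst l} \<times> near (int \<rho>) (before l) (loc l)"
text \<open>Sites on older perpendicular lines are left out, so a crossing of two good lines counts
  for at most the older one. This makes the sets of different lines disjoint.\<close>

definition "pts l = (\<lambda>a. site (fst l) a (snd l)) `
   {a. \<bar>a - loc l\<bar> \<le> int \<rho> \<and> site (fst l) a (snd l) \<in> X \<and> a \<notin> before l}"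

text \<open>A level keeps only what follows from the level just before it; levels of equal parity
  nevertheless increase.\<close>

lemma lev_add2: "lev i \<subseteq> lev (i + 2)"
proof (induction i)
  case (Suc i)
  have "card (filled \<rho> X k (lev i) z x) \<le> card (filled \<rho> X k (lev (i + 2)) z x)" for k z x
    by (rule card_mono) (use Suc in \<open>auto simp: filled_def\<close>)
  then have "thr (even i) \<le> card (filled \<rho> X (even i) (lev i) z x) \<Longrightarrow>
      thr (even i) \<le> card (filled \<rho> X (even i) (lev (i + 2)) z x)" for z x
    using le_trans by blast
  moreover have "lev (Suc i + 2) = {z. \<exists>x. thr (even (i + 2)) \<le> card (filled \<rho> X (even (i + 2)) (lev (i + 2)) z x)}"
    using level.simps(2)[of \<rho> X thr "i + 2"] by (simp only: add_Suc)
  ultimately show ?case by auto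
qed simp

lemma lev_mono: "i \<le> j \<Longrightarrow> odd i = odd j \<Longrightarrow> lev i \<subseteq> lev j"
proof (induction "j - i" arbitrary: j rule: less_induct)
  case less
  show ?case
  proof (cases "i = j")
    case False
    then have ij: "i + 2 \<le> j" using less.prems by presburger
    then have "lev i \<subseteq> lev (j - 2)" using less.prems by (intro less.hyps) auto
    also have "\<dots> \<subseteq> lev (j - 2 + 2)" by (rule lev_add2)
    also have "j - 2 + 2 = j" using ij by simp
    finally show ?thesis .
  qed simp
qed

lemma good_common:
  assumes "finite A" "\<And>a. a \<in> A \<Longrightarrow> (k, a) \<in> good"
  shows "\<exists>i. odd i = k \<and> A \<subseteq> lev i"
  using assms
proof (induction A rule: finite_induct)
  case empty
  show ?case by (rule exI[of _ "if k then 1 else 0"]) simp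
next
  case (insert a A)
  then obtain i where i: "odd i = k" "A \<subseteq> lev i" by blast
  obtain j where j: "odd j = k" "a \<in> lev j" using insert.prems[of a] by (auto simp: good_def)
  have "lev i \<subseteq> lev (max i j)" "lev j \<subseteq> lev (max i j)" "odd (max i j) = k"
    using i(1) j(1) lev_mono[of i "max i j"] lev_mono[of j "max i j"] by (auto simp: max_def)
  then show ?case using i j by blast
qed

text \<open>Only finitely many perpendicular lines meet the window, so a single level contains all
  of them that are good.\<close>

lemma good_closed:
  assumes "thr k \<le> card (filled \<rho> X k {a. (\<not> k, a) \<in> good} z x)"
  shows "(k, z) \<in> good"
proof -
  let ?A = "filled \<rho> X k {a. (\<not> k, a) \<in> good} z x"
  have "finite {a \<in> ?A. (\<not> k, a) \<in> good}" by simp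
  then obtain i where i: "odd i = (\<not> k)" "{a \<in> ?A. (\<not> k, a) \<in> good} \<subseteq> lev i"
    using good_common[of "{a \<in> ?A. (\<not> k, a) \<in> good}" "\<not> k"] by blast
  have "?A \<subseteq> filled \<rho> X k (lev i) z x" using i(2) by (auto simp: filled_def)
  then have "card ?A \<le> card (filled \<rho> X k (lev i) z x)" by (rule card_mono[rotated]) simp
  with assms have "thr k \<le> card (filled \<rho> X k (lev i) z x)" by linarith
  moreover have "even i = k" using i(1) by blast
  ultimately have "z \<in> lev (Suc i)" by auto
  then show ?thesis using i(1) unfolding good_def by (auto intro!: exI[of _ "Suc i"])
qed

lemma ord_good:
  assumes "l \<in> good"
  shows "odd (ord l) = fst l" "snd l \<in> lev (ord l)" "1 \<le> ord l"
    "thr (fst l) \<le> card (filled \<rho> X (fst l) (before l) (snd l) (loc l))"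
proof -
  have "\<exists>i. odd i = fst l \<and> snd l \<in> lev i" using assms by (auto simp: good_def)
  then have *: "odd (ord l) = fst l \<and> snd l \<in> lev (ord l)" unfolding ord_def by (rule LeastI_ex)
  then show "odd (ord l) = fst l" "snd l \<in> lev (ord l)" by blast+
  show "1 \<le> ord l" using * by (cases "ord l") auto
  then obtain i where i: "ord l = Suc i" by (cases "ord l") auto
  then have "\<exists>x. thr (fst l) \<le> card (filled \<rho> X (fst l) (before l) (snd l) x)"
    using * by (auto simp: before_def)
  then show "thr (fst l) \<le> card (filled \<rho> X (fst l) (before l) (snd l) (loc l))"
    unfolding loc_def by (rule someI_ex)
qed

lemma helpers_good:
  assumes l: "l \<in> good" and l': "l' \<in> helpers l"
  shows "l' \<in> good" "fst l' = (\<not> fst l)" "ord l' < ord l" "\<bar>snd l' - loc l\<bar> \<le> int \<rho>"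
proof -
  have *: "fst l' = (\<not> fst l)" "snd l' \<in> lev (ord l - 1)" "\<bar>snd l' - loc l\<bar> \<le> int \<rho>"
    using l' by (auto simp: helpers_def near_def before_def)
  have odd: "odd (ord l - 1) = fst l'" using ord_good(1,3)[OF l] *(1) by (cases "ord l") auto
  then have "ord l' \<le> ord l - 1" unfolding ord_def[of l'] using *(2) by (intro Least_le) simp
  then show "ord l' < ord l" using ord_good(3)[OF l] by linarith
  have "\<exists>i. odd i = fst l' \<and> snd l' \<in> lev i" using odd *(2) by blast
  then show "l' \<in> good" unfolding good_def by (simp add: case_prod_beta)
qed (use l' in \<open>auto simp: helpers_def near_def\<close>)

lemma pts_disjoint:
  assumes l: "l \<in> good" and l': "l' \<in> good" and "l \<noteq> l'"
  shows "pts l \<inter> pts l' = {}"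
proof (rule ccontr)
  assume "pts l \<inter> pts l' \<noteq> {}"
  then obtain z where z: "z \<in> pts l" "z \<in> pts l'" by blast
  obtain a where a: "z = site (fst l) a (snd l)" "a \<notin> before l" using z(1) by (auto simp: pts_def)
  obtain b where b: "z = site (fst l') b (snd l')" "b \<notin> before l'" using z(2) by (auto simp: pts_def)
  show False
  proof (cases "fst l = fst l'")
    case True
    then have "snd l = snd l'" using a(1) b(1) by (auto simp: site_def split: if_splits)
    with True \<open>l \<noteq> l'\<close> show False by (simp add: prod_eq_iff)
  next
    case False
    then have ab: "a = snd l'" "b = snd l" using a(1) b(1) by (auto simp: site_def split: if_splits)
    have key: "snd l2 \<in> before l1" if "l1 \<in> good" "l2 \<in> good" "fst l1 \<noteq> fst l2" "ord l2 < ord l1" for l1 l2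
    proof -
      have "odd (ord l1 - 1) = odd (ord l2)"
        using ord_good(1,3)[OF that(1)] ord_good(1)[OF that(2)] that(3) by (cases "ord l1") auto
      then have "lev (ord l2) \<subseteq> lev (ord l1 - 1)" using that(4) by (intro lev_mono) auto
      then show ?thesis using ord_good(2)[OF that(2)] by (auto simp: before_def)
    qed
    have "ord l \<noteq> ord l'" using ord_good(1)[OF l] ord_good(1)[OF l'] False by metis
    then consider "ord l' < ord l" | "ord l < ord l'" by linarith
    then show False
      using key[OF l l'] key[OF l' l] False a(2) b(2) ab by cases auto
  qed
qed

lemma pts_card:
  assumes "l \<in> good"
  shows "thr (fst l) \<le> card (pts l) + card (helpers l)"
proof -
  let ?A = "{a. \<bar>a - loc l\<bar> \<le> int \<rho> \<and> site (fst l) a (snd l) \<in> X \<and> a \<notin> before l}"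
  have "card (filled \<rho> X (fst l) (before l) (snd l) (loc l)) \<le> card (?A \<union> near (int \<rho>) (before l) (loc l))"
    by (rule card_mono) (auto simp: filled_def near_def)
  also have "\<dots> \<le> card ?A + card (near (int \<rho>) (before l) (loc l))" by (rule card_Un_le)
  also have "card ?A = card (pts l)"
    unfolding pts_def by (rule card_image[symmetric]) (auto simp: inj_on_def site_def split: if_splits)
  also have "card (near (int \<rho>) (before l) (loc l)) = card (helpers l)"
    by (simp add: helpers_def card_cartesian_product)
  finally show ?thesis using ord_good(4)[OF assms] by linarith
qed

lemma finite_pts: "finite (pts l)"
  by (simp add: pts_def)

lemma finite_helpers: "finite (helpers l)"
  by (simp add: helpers_def)

lemma pts_sub: "pts l \<subseteq> X"
  by (auto simp: pts_def)

end

text \<open>With d = r - s and q = r - m, multiplication by r^2 turns this into d (q - 1) r - r + q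
  \<ge> 1, which needs q \<ge> 2. That is why rows are restricted to fewer than r - 1
  helpers.\<close>

lemma row_budget:
  fixes r s m :: nat
  assumes "s < r" "m + 2 \<le> r"
  shows "1 + 1 / (real r)\<^sup>2 \<le> real r - real m + real m * (real s / real r - 1 / (real r)\<^sup>2) - real s * (real r - 1) / real r"
proof -
  define d where "d = real r - real s"
  define q where "q = real r - real m"
  have d: "1 \<le> d" and q: "2 \<le> q" and r: "0 < real r" using assms by (auto simp: d_def q_def)
  have "1 * 1 \<le> d * (q - 1)" using d q by (intro mult_mono) auto
  then have "1 * real r \<le> d * (q - 1) * real r" using r by (intro mult_right_mono) auto
  then have "(real r)\<^sup>2 + 1 \<le> (real r)\<^sup>2 + d * (q - 1) * real r - real r + q" using q by linarith
  also have "\<dots> = (real r - real m) * (real r)\<^sup>2 + real m * (real s * real r - 1) - real s * (real r - 1) * real r"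
    by (simp add: d_def q_def power2_eq_square algebra_simps)
  finally have "((real r)\<^sup>2 + 1) / (real r)\<^sup>2 \<le>
      ((real r - real m) * (real r)\<^sup>2 + real m * (real s * real r - 1) - real s * (real r - 1) * real r) / (real r)\<^sup>2"
    using r by (intro divide_right_mono) auto
  then show ?thesis using r by (simp add: add_divide_distrib diff_divide_distrib power2_eq_square right_diff_distrib)
qed

theorem origin_never_occupied_lines:
  fixes r s \<rho> :: nat and X :: "(int \<times> int) set"
  assumes rs: "s < r" "2 \<le> s" "r \<le> \<rho>"
  defines "\<gamma> \<equiv> real s * (real r - 1) / real r"
  defines "B \<equiv> nat \<lceil>\<gamma> * (real r)\<^sup>2\<rceil>"
  assumes sparse: "sparse \<gamma> (int \<rho> * (2 + 4 * (1 + int r * int B))) (2 + r * B) X"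
  shows "(0, 0) \<notin> growth \<rho> (cross_zero_set r 1 s) X t"
proof -
  \<comment> \<open>A column counts as full with s occupied neighbours, whether or not a horizontal
    one is present; this can only enlarge the growth.\<close>
  define thr where "thr k = (if k then r else s)" for k
  define lim where "lim k = (if k then r - 1 else s)" for k
  define \<delta> where "\<delta> = 1 / (real r)\<^sup>2"
  \<comment> \<open>These weights make two conditions tight at \<gamma> = s - s / r: a new column
    that pays for its location leaves s - \<gamma> = s / r, and r - 1 columns outweigh one location,
    as (r - 1) s / r = \<gamma>. The surplus \<delta> is small enough for
    \<open>row_budget\<close>.\<close>
  define gain where "gain k = (if k then 1 else real s / real r - \<delta>)" for k
  have r0: "0 < real r" using rs by simp
  have \<gamma>0: "0 \<le> \<gamma>" using rs by (simp add: \<gamma>_def)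
  interpret L: lines \<rho> X thr .
  interpret H: line_history L.good L.ord L.loc L.helpers L.pts \<rho> thr lim gain \<gamma> \<delta> B r
  proof
    fix l l' assume l: "l \<in> L.good"
    show "finite (L.helpers l)" by (rule L.finite_helpers)
    show "L.helpers l \<subseteq> L.good" using L.helpers_good(1)[OF l] by blast
    show "finite (L.pts l)" by (rule L.finite_pts)
    show "thr (fst l) \<le> card (L.pts l) + card (L.helpers l)" by (rule L.pts_card[OF l])
    show "fst l' = (\<not> fst l) \<and> L.ord l' < L.ord l \<and> \<bar>snd l' - L.loc l\<bar> \<le> int \<rho>" if "l' \<in> L.helpers l"
      using L.helpers_good[OF l that] by blast
    show "L.pts l \<inter> L.pts l' = {}" if "l' \<in> L.good" "l \<noteq> l'"
      by (rule L.pts_disjoint[OF l that])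
  next
    have "1 / (real r)\<^sup>2 \<le> real s / real r"
    proof -
      have "1 / (real r)\<^sup>2 \<le> 1 / real r" using rs by (simp add: power2_eq_square divide_simps)
      also have "\<dots> \<le> real s / real r" using rs by (intro divide_right_mono) auto
      finally show ?thesis .
    qed
    then show "0 \<le> gain k" for k by (simp add: gain_def \<delta>_def)
    show "0 < \<delta>" using r0 by (simp add: \<delta>_def)
    show "0 \<le> \<gamma>" by fact
    have "\<gamma> / \<delta> = \<gamma> * (real r)\<^sup>2" by (simp add: \<delta>_def)
    then show "\<gamma> / \<delta> \<le> real B" unfolding B_def by (simp add: real_nat_ceiling_ge)
    show "1 \<le> lim k" "lim k \<le> r" for k using rs by (auto simp: lim_def)
    have "\<gamma> \<le> real s * (1 + \<delta>)"
    proof -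
      have "\<gamma> = real s - real s / real r" using r0 by (simp add: \<gamma>_def field_simps)
      also have "\<dots> \<le> real s" by simp
      also have "\<dots> \<le> real s * (1 + \<delta>)" by (simp add: \<delta>_def algebra_simps)
      finally show ?thesis .
    qed
    moreover have "\<gamma> = real (r - 1) * (real s / real r)"
      using rs by (simp add: \<gamma>_def of_nat_diff)
    ultimately show "\<gamma> \<le> real (lim k) * (gain (\<not> k) + \<delta>)" for k
      by (cases k) (simp_all add: lim_def gain_def)
  next
    fix k and m :: nat assume m: "m < lim k"
    have sr: "real s / real r \<le> 1" using rs by simp
    have \<delta>1: "\<delta> \<le> 1" using rs by (simp add: \<delta>_def divide_simps)
    show "gain k + \<delta> \<le> real (thr k) - real m"
    proof (cases k)
      case True
      then have "m + 2 \<le> r" using m by (simp add: lim_def)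
      then have "2 \<le> real r - real m" by linarith
      then show ?thesis using True \<delta>1 by (simp add: gain_def thr_def)
    next
      case False
      then have "1 \<le> real s - real m" using m by (simp add: lim_def)
      then show ?thesis using False sr by (simp add: gain_def thr_def)
    qed
    show "gain k + \<delta> \<le> real (thr k) - real m + real m * gain (\<not> k) - \<gamma>"
    proof (cases k)
      case True
      then have "m + 2 \<le> r" using m by (simp add: lim_def)
      from row_budget[OF rs(1) this] True show ?thesis
        by (simp add: gain_def thr_def \<delta>_def \<gamma>_def)
    next
      case False
      have "real s / real r = real s - \<gamma>" using r0 by (simp add: \<gamma>_def field_simps)
      then show ?thesis using False by (simp add: gain_def thr_def)
    qed
  next
    fix G U and L :: "bool \<Rightarrow> int set"
    assume G: "finite G" "G \<subseteq> L.good" "(\<Union>l\<in>G. L.pts l) \<noteq> {}"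
      and cov: "\<And>l. l \<in> G \<Longrightarrow> covered U (L (fst l)) (snd l) \<and> covered U (L (\<not> fst l)) (L.loc l)"
      and L: "\<And>k. finite (L k)" and U: "U \<le> int \<rho> * (1 + 4 * (1 + int r * int B))" and pl: "places L \<le> 2 + r * B"
    have "real (card (\<Union>l\<in>G. L.pts l)) < \<gamma> * real (card (L False - {0}) + card (L True - {0}))"
    proof (rule sparse_less0[OF sparse \<gamma>0 L L])
      show "card (L False) \<le> 2 + r * B" "card (L True) \<le> 2 + r * B"
        using pl by (auto simp: places_def)
      show "(\<Union>l\<in>G. L.pts l) \<subseteq> X" using L.pts_sub by blast
      show "(\<Union>l\<in>G. L.pts l) \<noteq> {}" by fact
      fix a b assume "(a, b) \<in> (\<Union>l\<in>G. L.pts l)"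
      then obtain l where l: "l \<in> G" "(a, b) \<in> L.pts l" by blast
      then obtain c where c: "(a, b) = site (fst l) c (snd l)" "\<bar>c - L.loc l\<bar> \<le> int \<rho>"
        by (auto simp: L.pts_def)
      have 1: "covered U (L (fst l)) (snd l)" using cov[OF l(1)] by blast
      have 2: "covered (U + int \<rho>) (L (\<not> fst l)) c"
        using covered_near[OF _ c(2)] cov[OF l(1)] by blast
      have UK: "U + int \<rho> \<le> int \<rho> * (2 + 4 * (1 + int r * int B))"
        using U by (simp add: distrib_left)
      have 3: "covered (int \<rho> * (2 + 4 * (1 + int r * int B))) (L (\<not> fst l)) c"
        by (rule covered_mono[OF 2 UK order_refl])
      have 4: "covered (int \<rho> * (2 + 4 * (1 + int r * int B))) (L (fst l)) (snd l)"
        by (rule covered_mono[OF 1 _ order_refl]) (use UK in linarith)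
      show "\<exists>x\<in>L False. \<exists>y\<in>L True. \<bar>a - x\<bar> \<le> int \<rho> * (2 + 4 * (1 + int r * int B)) \<and>
          \<bar>b - y\<bar> \<le> int \<rho> * (2 + 4 * (1 + int r * int B))"
        using 3 4 c(1) unfolding covered_def by (cases "fst l") auto
    qed
    then show "real (card (\<Union>l\<in>G. L.pts l)) < \<gamma> * real (cost L)"
      by (simp add: cost_def add.commute)
  qed
  \<comment> \<open>E is stable under the growth: off a good line, the neighbours of a site along
    that line are initial or lie on good crossing lines, so enough of them make the line good by
    \<open>good_closed\<close>.\<close>
  define E where "E = {(x, y). (x, y) \<in> X \<or> (False, x) \<in> L.good \<or> (True, y) \<in> L.good}"
  have E: "growth \<rho> (cross_zero_set r 1 s) X t \<subseteq> E" for t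
  proof (induction t)
    case 0
    then show ?case by (auto simp: E_def)
  next
    case (Suc t)
    show ?case
    proof (rule subsetI, unfold split_paired_all)
      fix x y assume "(x, y) \<in> growth \<rho> (cross_zero_set r 1 s) X (Suc t)"
      then consider "(x, y) \<in> growth \<rho> (cross_zero_set r 1 s) X t"
        | "r \<le> hcount \<rho> (growth \<rho> (cross_zero_set r 1 s) X t) x y"
        | "s \<le> vcount \<rho> (growth \<rho> (cross_zero_set r 1 s) X t) x y"
        unfolding growth_Suc_iff Let_def using rs(1) by linarith
      then show "(x, y) \<in> E"
      proof cases
        case 1
        then show ?thesis using Suc by blast
      next
        case 2
        also have "hcount \<rho> (growth \<rho> (cross_zero_set r 1 s) X t) x y \<le> hcount \<rho> E x y" by (rule hcount_mono[OF Suc])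
        finally have h: "r \<le> hcount \<rho> E x y" .
        show ?thesis
        proof (cases "(True, y) \<in> L.good")
          case False
          have "hcount \<rho> E x y \<le> card (filled \<rho> X True {a. (\<not> True, a) \<in> L.good} y x)"
            unfolding hcount_def by (rule card_mono) (use False in \<open>auto simp: E_def filled_def\<close>)
          then have "(True, y) \<in> L.good" using h by (intro L.good_closed[of True y x]) (simp add: thr_def)
          with False show ?thesis by simp
        qed (simp add: E_def)
      next
        case 3
        also have "vcount \<rho> (growth \<rho> (cross_zero_set r 1 s) X t) x y \<le> vcount \<rho> E x y" by (rule vcount_mono[OF Suc])
        finally have h: "s \<le> vcount \<rho> E x y" .
        show ?thesis
        proof (cases "(False, x) \<in> L.good")
          case False
          have "vcount \<rho> E x y \<le> card (filled \<rho> X False {a. (\<not> False, a) \<in> L.good} x y)"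
            unfolding vcount_def by (rule card_mono) (use False in \<open>auto simp: E_def filled_def\<close>)
          then have "(False, x) \<in> L.good" using h by (intro L.good_closed[of False x y]) (simp add: thr_def)
          with False show ?thesis by simp
        qed (simp add: E_def)
      qed
    qed
  qed
  have "(0, 0) \<notin> X"
  proof
    assume "(0, 0) \<in> X"
    then have "real (card {(0 :: int, 0 :: int)}) < \<gamma> * real (card ({0 :: int} - {0}) + card ({0 :: int} - {0}))"
      by (intro sparse_less0[OF sparse \<gamma>0]) auto
    then show False by simp
  qed
  then have "(0, 0) \<notin> E"
    using H.zero_line_not_good[of "(True, 0)"] H.zero_line_not_good[of "(False, 0)"] by (simp add: E_def)
  then show ?thesis using E by blast
qed

section \<open>The first moment method\<close>

lemma prob_space_initial_law: "prob_space (initial_law p)"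
  unfolding initial_law_def by (intro prob_space_PiM prob_space_measure_pmf)

lemma space_initial_law [simp]: "space (initial_law p) = UNIV"
  by (simp add: initial_law_def space_PiM)

section \<open>Independence of events on disjoint finite sets of sites\<close>

definition depends_on :: "'i set \<Rightarrow> ('i \<Rightarrow> bool) set \<Rightarrow> bool" where
  "depends_on D A \<longleftrightarrow> (\<forall>\<omega> \<omega>'. (\<forall>d\<in>D. \<omega> d = \<omega>' d) \<longrightarrow> (\<omega> \<in> A \<longleftrightarrow> \<omega>' \<in> A))"

text \<open>Reduces an event of the infinite product to the finite product, in which every set is
  measurable.\<close>

lemma depends_on_preimage:
  assumes "depends_on D A"
  shows "A = (\<lambda>\<omega>. restrict \<omega> D) -` {f \<in> PiE D (\<lambda>_. UNIV). f \<in> A}"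
proof -
  have "\<omega> \<in> A \<longleftrightarrow> restrict \<omega> D \<in> A" for \<omega>
    using assms unfolding depends_on_def by (metis restrict_apply')
  then show ?thesis by auto
qed

lemma sets_PiM_finite_bool:
  assumes "finite D"
  shows "sets (\<Pi>\<^sub>M x\<in>D. measure_pmf (bernoulli_pmf p)) = Pow (PiE D (\<lambda>_. UNIV))"
proof -
  have "sets (\<Pi>\<^sub>M x\<in>D. measure_pmf (bernoulli_pmf p)) = sets (\<Pi>\<^sub>M x\<in>D. count_space (UNIV :: bool set))"
    by (rule sets_PiM_cong) auto
  also have "(\<Pi>\<^sub>M x\<in>D. count_space (UNIV :: bool set)) = count_space (PiE D (\<lambda>_. UNIV))"
    by (rule count_space_PiM_finite[OF assms]) simp
  finally show ?thesis by simp
qed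

lemma indep_vars_initial_law:
  "prob_space.indep_vars (initial_law p) (\<lambda>_. measure_pmf (bernoulli_pmf p)) (\<lambda>x \<omega>. \<omega> x) UNIV"
proof -
  interpret prob_space "initial_law p" by (rule prob_space_initial_law)
  have meas: "random_variable (measure_pmf (bernoulli_pmf p)) (\<lambda>\<omega>. \<omega> x)" for x
    unfolding initial_law_def by (rule measurable_component_singleton) simp
  have "distr (initial_law p) (\<Pi>\<^sub>M x\<in>UNIV. measure_pmf (bernoulli_pmf p)) (\<lambda>\<omega>. \<lambda>x\<in>UNIV. \<omega> x) = initial_law p"
  proof -
    have "(\<lambda>\<omega> :: int \<times> int \<Rightarrow> bool. \<lambda>x\<in>UNIV. \<omega> x) = (\<lambda>\<omega>. \<omega>)" by (auto simp: restrict_def)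
    then show ?thesis by (simp only: initial_law_def distr_id)
  qed
  moreover have "distr (initial_law p) (measure_pmf (bernoulli_pmf p)) (\<lambda>\<omega>. \<omega> x) = measure_pmf (bernoulli_pmf p)" for x
    unfolding initial_law_def by (rule distr_PiM_component) (auto intro: prob_space_measure_pmf)
  ultimately show ?thesis
    using meas by (subst indep_vars_iff_distr_eq_PiM) (auto simp: initial_law_def)
qed

lemma depends_on_sets:
  assumes "depends_on D A" "finite D"
  shows "A \<in> sets (initial_law p)"
proof -
  have "(\<lambda>\<omega>. restrict \<omega> D) \<in> initial_law p \<rightarrow>\<^sub>M (\<Pi>\<^sub>M x\<in>D. measure_pmf (bernoulli_pmf p))"
    unfolding initial_law_def by (rule measurable_restrict_subset) simp
  moreover have "{f \<in> PiE D (\<lambda>_. UNIV). f \<in> A} \<in> sets (\<Pi>\<^sub>M x\<in>D. measure_pmf (bernoulli_pmf p))"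
    unfolding sets_PiM_finite_bool[OF assms(2)] by auto
  ultimately have "(\<lambda>\<omega>. restrict \<omega> D) -` {f \<in> PiE D (\<lambda>_. UNIV). f \<in> A} \<inter> space (initial_law p) \<in> sets (initial_law p)"
    by (rule measurable_sets)
  then show ?thesis using depends_on_preimage[OF assms(1)] by simp
qed

lemma prob_Int_depends_on:
  assumes A: "depends_on D A" "finite D" and B: "depends_on E B" "finite E" and "D \<inter> E = {}"
  shows "measure (initial_law p) (A \<inter> B) = measure (initial_law p) A * measure (initial_law p) B"
proof -
  interpret prob_space "initial_law p" by (rule prob_space_initial_law)
  let ?M = "\<lambda>_ :: int \<times> int. measure_pmf (bernoulli_pmf p)"
  have "indep_var (PiM D ?M) (\<lambda>\<omega>. restrict (\<lambda>i. \<omega> i) D) (PiM E ?M) (\<lambda>\<omega>. restrict (\<lambda>i. \<omega> i) E)"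
    by (rule indep_var_restrict[OF indep_vars_initial_law]) (use assms in auto)
  then have "prob ((\<lambda>\<omega>. (restrict \<omega> D, restrict \<omega> E)) -` ({f \<in> PiE D (\<lambda>_. UNIV). f \<in> A} \<times> {f \<in> PiE E (\<lambda>_. UNIV). f \<in> B}) \<inter> space (initial_law p)) =
      prob ((\<lambda>\<omega>. restrict \<omega> D) -` {f \<in> PiE D (\<lambda>_. UNIV). f \<in> A} \<inter> space (initial_law p)) *
      prob ((\<lambda>\<omega>. restrict \<omega> E) -` {f \<in> PiE E (\<lambda>_. UNIV). f \<in> B} \<inter> space (initial_law p))"
    by (rule indep_varD) (auto simp: sets_PiM_finite_bool A(2) B(2))
  also have "(\<lambda>\<omega>. (restrict \<omega> D, restrict \<omega> E)) -` ({f \<in> PiE D (\<lambda>_. UNIV). f \<in> A} \<times> {f \<in> PiE E (\<lambda>_. UNIV). f \<in> B}) =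
      (\<lambda>\<omega>. restrict \<omega> D) -` {f \<in> PiE D (\<lambda>_. UNIV). f \<in> A} \<inter> (\<lambda>\<omega>. restrict \<omega> E) -` {f \<in> PiE E (\<lambda>_. UNIV). f \<in> B}"
    by auto
  finally show ?thesis
    by (simp only: space_initial_law Int_UNIV_right depends_on_preimage[OF A(1), symmetric]
        depends_on_preimage[OF B(1), symmetric])
qed

lemma depends_on_INT:
  fixes A :: "'j \<Rightarrow> ('b \<Rightarrow> bool) set"
  assumes "\<And>j. j \<in> J \<Longrightarrow> depends_on (D j) (A j)"
  shows "depends_on (\<Union>j\<in>J. D j) (\<Inter>j\<in>J. A j)"
  unfolding depends_on_def
proof (intro allI impI)
  fix \<omega> \<omega>' :: "'b \<Rightarrow> bool" assume eq: "\<forall>d\<in>(\<Union>j\<in>J. D j). \<omega> d = \<omega>' d"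
  have "\<omega> \<in> A j \<longleftrightarrow> \<omega>' \<in> A j" if "j \<in> J" for j
    using assms[OF that, unfolded depends_on_def, rule_format, of \<omega> \<omega>'] eq that by blast
  then show "\<omega> \<in> (\<Inter>j\<in>J. A j) \<longleftrightarrow> \<omega>' \<in> (\<Inter>j\<in>J. A j)" by blast
qed

lemma depends_on_Compl: "depends_on D A \<Longrightarrow> depends_on D (- A)"
  unfolding depends_on_def by blast

lemma prob_INT_depends_on:
  assumes "finite J" "\<And>j. j \<in> J \<Longrightarrow> depends_on (D j) (A j)" "\<And>j. j \<in> J \<Longrightarrow> finite (D j)"
    and "disjoint_family_on D J"
  shows "measure (initial_law p) (\<Inter>j\<in>J. A j) = (\<Prod>j\<in>J. measure (initial_law p) (A j))"
  using assms
proof (induction J rule: finite_induct)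
  case empty
  interpret prob_space "initial_law p" by (rule prob_space_initial_law)
  show ?case using prob_space by simp
next
  case (insert j J)
  have "measure (initial_law p) (A j \<inter> (\<Inter>j\<in>J. A j)) = measure (initial_law p) (A j) * measure (initial_law p) (\<Inter>j\<in>J. A j)"
  proof (rule prob_Int_depends_on)
    show "depends_on (D j) (A j)" "finite (D j)" using insert.prems by auto
    show "depends_on (\<Union>j\<in>J. D j) (\<Inter>j\<in>J. A j)" by (rule depends_on_INT) (use insert.prems in auto)
    show "finite (\<Union>j\<in>J. D j)" using insert.hyps insert.prems by auto
    show "D j \<inter> (\<Union>j\<in>J. D j) = {}"
      using insert.prems(3) insert.hyps(2) unfolding disjoint_family_on_def by auto
  qed
  moreover have "measure (initial_law p) (\<Inter>j\<in>J. A j) = (\<Prod>j\<in>J. measure (initial_law p) (A j))"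
    by (rule insert.IH) (use insert.prems in \<open>auto simp: disjoint_family_on_def\<close>)
  ultimately show ?case using insert.hyps by simp
qed

lemma depends_on_all: "depends_on A {\<omega>. \<forall>x\<in>A. \<omega> x}"
  unfolding depends_on_def by blast

lemma prob_all_occupied:
  assumes p: "0 \<le> p" "p \<le> 1" and A: "finite A"
  shows "measure (initial_law p) {\<omega>. \<forall>x\<in>A. \<omega> x} = p ^ card A"
proof -
  interpret prob_space "initial_law p" by (rule prob_space_initial_law)
  have single: "prob {\<omega>. \<omega> x} = p" for x
  proof -
    have "(\<lambda>\<omega>. \<omega> x) \<in> initial_law p \<rightarrow>\<^sub>M measure_pmf (bernoulli_pmf p)"
      unfolding initial_law_def by (rule measurable_component_singleton) simp
    then have "measure (distr (initial_law p) (measure_pmf (bernoulli_pmf p)) (\<lambda>\<omega>. \<omega> x)) {True} = prob {\<omega>. \<omega> x}"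
      by (subst measure_distr) (auto simp: vimage_def)
    moreover have "distr (initial_law p) (measure_pmf (bernoulli_pmf p)) (\<lambda>\<omega>. \<omega> x) = measure_pmf (bernoulli_pmf p)"
      unfolding initial_law_def by (rule distr_PiM_component) (auto intro: prob_space_measure_pmf)
    ultimately show ?thesis using p by (simp add: measure_pmf_single)
  qed
  have "prob (\<Inter>x\<in>A. {\<omega>. \<omega> x}) = (\<Prod>x\<in>A. prob {\<omega>. \<omega> x})"
    by (rule prob_INT_depends_on[OF A, of "\<lambda>x. {x}"]) (auto simp: depends_on_def disjoint_family_on_def)
  also have "(\<Inter>x\<in>A. {\<omega>. \<omega> x}) = {\<omega>. \<forall>x\<in>A. \<omega> x}" by auto
  finally show ?thesis by (simp add: single)
qed

text \<open>Union bound over the subsets of M of size k, of which there are at most 2^m.\<close>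

lemma prob_at_least:
  assumes p: "0 \<le> p" "p \<le> 1" and M: "finite M" "card M \<le> m"
  shows "measure (initial_law p) {\<omega>. k \<le> card (M \<inter> {x. \<omega> x})} \<le> 2 ^ m * p ^ k"
proof -
  interpret prob_space "initial_law p" by (rule prob_space_initial_law)
  let ?\<A> = "{A. A \<subseteq> M \<and> card A = k}"
  have fin: "finite ?\<A>" using M(1) by simp
  have finA: "finite A" if "A \<in> ?\<A>" for A using that M(1) finite_subset by blast
  have "{\<omega>. k \<le> card (M \<inter> {x. \<omega> x})} \<subseteq> (\<Union>A\<in>?\<A>. {\<omega>. \<forall>x\<in>A. \<omega> x})"
  proof
    fix \<omega> assume "\<omega> \<in> {\<omega>. k \<le> card (M \<inter> {x. \<omega> x})}"
    then have "k \<le> card (M \<inter> {x. \<omega> x})" by simp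
    then obtain A where "A \<subseteq> M \<inter> {x. \<omega> x}" "card A = k" by (rule obtain_subset_with_card_n)
    then show "\<omega> \<in> (\<Union>A\<in>?\<A>. {\<omega>. \<forall>x\<in>A. \<omega> x})" by blast
  qed
  moreover have sets: "{\<omega>. \<forall>x\<in>A. \<omega> x} \<in> events" if "A \<in> ?\<A>" for A
    by (rule depends_on_sets[OF depends_on_all finA[OF that]])
  ultimately have "prob {\<omega>. k \<le> card (M \<inter> {x. \<omega> x})} \<le> prob (\<Union>A\<in>?\<A>. {\<omega>. \<forall>x\<in>A. \<omega> x})"
    by (intro finite_measure_mono sets.finite_UN fin)
  also have "\<dots> \<le> (\<Sum>A\<in>?\<A>. prob {\<omega>. \<forall>x\<in>A. \<omega> x})"
    by (rule finite_measure_subadditive_finite[OF fin]) (rule image_subsetI, rule sets)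
  also have "\<dots> = (\<Sum>A\<in>?\<A>. p ^ k)"
  proof (rule sum.cong)
    fix A assume "A \<in> ?\<A>"
    then show "prob {\<omega>. \<forall>x\<in>A. \<omega> x} = p ^ k" using prob_all_occupied[OF p finA] by simp
  qed simp
  also have "\<dots> = real (card M choose k) * p ^ k" using n_subsets[OF M(1), of k] by simp
  also have "\<dots> \<le> real (2 ^ m) * p ^ k"
  proof (intro mult_right_mono of_nat_mono)
    have "card M choose k \<le> 2 ^ card M" by (rule binomial_le_pow2)
    also have "\<dots> \<le> (2 :: nat) ^ m" using M(2) by (intro power_increasing) auto
    finally show "card M choose k \<le> 2 ^ m" .
  qed (use p in simp)
  finally show ?thesis by simp
qed

text \<open>Information travels at most \<rho> per step in each direction.\<close>

lemma growth_local:
  assumes "X \<inter> square (int \<rho> * int t) x y = X' \<inter> square (int \<rho> * int t) x y"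
  shows "(x, y) \<in> growth \<rho> Z X t \<longleftrightarrow> (x, y) \<in> growth \<rho> Z X' t"
  using assms
proof (induction t arbitrary: x y)
  case 0
  have "(x, y) \<in> X \<inter> square 0 x y \<longleftrightarrow> (x, y) \<in> X' \<inter> square 0 x y" using 0 by simp
  then show ?case by simp
next
  case (Suc t)
  have eq: "(a, b) \<in> growth \<rho> Z X t \<longleftrightarrow> (a, b) \<in> growth \<rho> Z X' t"
    if "\<bar>a - x\<bar> \<le> int \<rho>" "\<bar>b - y\<bar> \<le> int \<rho>" for a b
  proof (rule Suc.IH)
    have "square (int \<rho> * int t) a b \<subseteq> square (int \<rho> * int (Suc t)) x y"
    proof (rule subsetI, unfold split_paired_all)
      fix c d assume "(c, d) \<in> square (int \<rho> * int t) a b"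
      then have "\<bar>c - a\<bar> \<le> int \<rho> * int t" "\<bar>d - b\<bar> \<le> int \<rho> * int t" by auto
      moreover have "int \<rho> * int (Suc t) = int \<rho> * int t + int \<rho>" by (simp add: algebra_simps)
      ultimately have "\<bar>c - x\<bar> \<le> int \<rho> * int (Suc t)" "\<bar>d - y\<bar> \<le> int \<rho> * int (Suc t)"
        using that by linarith+
      then show "(c, d) \<in> square (int \<rho> * int (Suc t)) x y" by (simp only: mem_square)
    qed
    then show "X \<inter> square (int \<rho> * int t) a b = X' \<inter> square (int \<rho> * int t) a b" using Suc.prems by blast
  qed
  have "nbhd_h \<rho> (x, y) \<inter> growth \<rho> Z X t = nbhd_h \<rho> (x, y) \<inter> growth \<rho> Z X' t"
    "nbhd_v \<rho> (x, y) \<inter> growth \<rho> Z X t = nbhd_v \<rho> (x, y) \<inter> growth \<rho> Z X' t"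
    using eq by (auto simp: nbhd_h_def nbhd_v_def)
  then show ?case using eq[of x y] by simp
qed

lemma occupied_if_time_le:
  assumes "occupation_time \<rho> Z \<omega> \<le> ereal x"
  shows "0 \<le> x" "(0, 0) \<in> growth \<rho> Z {z. \<omega> z} (nat \<lfloor>x\<rfloor>)"
proof -
  let ?S = "{t. (0, 0) \<in> growth \<rho> Z {z. \<omega> z} t}"
  have "?S \<noteq> {}"
  proof
    assume "?S = {}"
    then have "occupation_time \<rho> Z \<omega> = \<infinity>" unfolding occupation_time_def by (simp add: top_ereal_def)
    then show False using assms by simp
  qed
  then have L: "(LEAST t. t \<in> ?S) \<in> ?S" using LeastI_ex[of "\<lambda>t. t \<in> ?S"] by blast
  define t where "t = (LEAST t. t \<in> ?S)"
  have "ereal (real t) \<le> occupation_time \<rho> Z \<omega>"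
    unfolding occupation_time_def
  proof (rule INF_greatest)
    fix u assume "u \<in> ?S"
    then have "t \<le> u" unfolding t_def by (rule Least_le)
    then show "ereal (real t) \<le> ereal (real u)" by simp
  qed
  then have "ereal (real t) \<le> ereal x" using assms by (rule order_trans)
  then have tx: "real t \<le> x" by simp
  then show "0 \<le> x" by (meson of_nat_0_le_iff order_trans)
  have "t \<le> nat \<lfloor>x\<rfloor>" using tx by (simp add: le_nat_floor)
  then show "(0, 0) \<in> growth \<rho> Z {z. \<omega> z} (nat \<lfloor>x\<rfloor>)"
    using L growth_mono'[of t "nat \<lfloor>x\<rfloor>"] unfolding t_def[symmetric] by blast
qed

section \<open>Union bound over grids of coordinates\<close>

text \<open>Lists, because their number is a plain power; 0 is always inserted, since the
  coordinates of the origin need not be chosen.\<close>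

definition cross_squarees :: "int \<Rightarrow> int list \<Rightarrow> int list \<Rightarrow> (int \<times> int) set" where
  "cross_squarees K xs ys = (\<Union>x\<in>insert 0 (set xs). \<Union>y\<in>insert 0 (set ys). square K x y)"

lemma finite_cross_squarees [simp]: "finite (cross_squarees K xs ys)"
  by (simp add: cross_squarees_def)

lemma card_cross_squarees:
  assumes "length xs \<le> N" "length ys \<le> N"
  shows "card (cross_squarees K xs ys) \<le> (N + 1) * ((N + 1) * (nat (2 * K + 1) * nat (2 * K + 1)))"
proof -
  have c: "card (insert 0 (set zs)) \<le> N + 1" if "length zs \<le> N" for zs :: "int list"
    using card_length[of zs] that by (simp add: card_insert_if)
  have b: "card (square K x y) = nat (2 * K + 1) * nat (2 * K + 1)" for x y
    by (simp add: square_eq card_cartesian_product algebra_simps)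
  have "card (\<Union>y\<in>insert 0 (set ys). square K x y) \<le> (N + 1) * (nat (2 * K + 1) * nat (2 * K + 1))" for x
  proof -
    have "card (\<Union>y\<in>insert 0 (set ys). square K x y) \<le> (\<Sum>y\<in>insert 0 (set ys). card (square K x y))"
      by (rule card_UN_le) simp
    also have "\<dots> = card (insert 0 (set ys)) * (nat (2 * K + 1) * nat (2 * K + 1))"
      by (simp only: b sum_constant of_nat_id)
    also have "\<dots> \<le> (N + 1) * (nat (2 * K + 1) * nat (2 * K + 1))" using c[OF assms(2)] by (rule mult_le_mono1)
    finally show ?thesis .
  qed
  note y = this
  have "card (cross_squarees K xs ys) \<le> (\<Sum>x\<in>insert 0 (set xs). card (\<Union>y\<in>insert 0 (set ys). square K x y))"
    unfolding cross_squarees_def by (rule card_UN_le) simp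
  also have "\<dots> \<le> (\<Sum>x\<in>insert 0 (set xs). (N + 1) * (nat (2 * K + 1) * nat (2 * K + 1)))"
    by (rule sum_mono) (rule y)
  also have "\<dots> = card (insert 0 (set xs)) * ((N + 1) * (nat (2 * K + 1) * nat (2 * K + 1)))" by (simp only: sum_constant of_nat_id)
  also have "\<dots> \<le> (N + 1) * ((N + 1) * (nat (2 * K + 1) * nat (2 * K + 1)))" using c[OF assms(1)] by (rule mult_le_mono1)
  finally show ?thesis .
qed

lemma not_sparse_in_square:
  assumes "\<not> sparse \<gamma> K N (X \<inter> square (int L) 0 0)" and \<gamma>: "0 \<le> \<gamma>"
  obtains xs ys where "set xs \<subseteq> {- int L..int L}" "set ys \<subseteq> {- int L..int L}"
    "length xs \<le> N" "length ys \<le> N" "card (cross_squarees K xs ys \<inter> X) \<noteq> 0"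
    "\<gamma> * real (length xs + length ys) \<le> real (card (cross_squarees K xs ys \<inter> X))"
proof -
  obtain LX LY where L: "finite LX" "finite LY" "card LX \<le> N" "card LY \<le> N"
    and n: "card (X \<inter> square (int L) 0 0 \<inter> (\<Union>x\<in>LX. \<Union>y\<in>LY. square K x y)) \<noteq> 0"
      "\<gamma> * real (card (LX - {0}) + card (LY - {0})) \<le> real (card (X \<inter> square (int L) 0 0 \<inter> (\<Union>x\<in>LX. \<Union>y\<in>LY. square K x y)))"
  proof -
    from assms(1) have "\<exists>LX LY. (finite LX \<and> finite LY \<and> card LX \<le> N \<and> card LY \<le> N) \<and>
      card (X \<inter> square (int L) 0 0 \<inter> (\<Union>x\<in>LX. \<Union>y\<in>LY. square K x y)) \<noteq> 0 \<and>
      \<gamma> * real (card (LX - {0}) + card (LY - {0})) \<le> real (card (X \<inter> square (int L) 0 0 \<inter> (\<Union>x\<in>LX. \<Union>y\<in>LY. square K x y)))"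
      by (simp only: sparse_def Let_def not_all not_imp de_Morgan_disj not_less) 
    then show thesis using that by blast
  qed
  \<comment> \<open>Clamping a coordinate to the window takes it no farther from any point of the
    window and leaves finitely many choices; 0 stays 0.\<close>
  define c where "c x = max (- int L) (min (int L) x)" for x
  obtain lx where lx: "set lx = LX - {0}" "distinct lx" using finite_distinct_list[of "LX - {0}"] L(1) by auto
  obtain ly where ly: "set ly = LY - {0}" "distinct ly" using finite_distinct_list[of "LY - {0}"] L(2) by auto
  have len: "length lx = card (LX - {0})" "length ly = card (LY - {0})"
    using lx ly distinct_card by metis+
  have lenN: "length lx \<le> N" "length ly \<le> N"
    using len L card_Diff1_le[of LX 0] card_Diff1_le[of LY 0] by linarith+
  have clamp: "\<bar>a - c x\<bar> \<le> K" if "\<bar>a - x\<bar> \<le> K" "\<bar>a - 0\<bar> \<le> int L" for a x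
    using that unfolding c_def by linarith
  have c0: "c 0 = 0" by (simp add: c_def)
  have cov: "X \<inter> square (int L) 0 0 \<inter> (\<Union>x\<in>LX. \<Union>y\<in>LY. square K x y) \<subseteq> cross_squarees K (map c lx) (map c ly) \<inter> X"
  proof (rule subsetI, unfold split_paired_all)
    fix a b assume "(a, b) \<in> X \<inter> square (int L) 0 0 \<inter> (\<Union>x\<in>LX. \<Union>y\<in>LY. square K x y)"
    then obtain x y where xy: "(a, b) \<in> X" "\<bar>a - 0\<bar> \<le> int L" "\<bar>b - 0\<bar> \<le> int L" "x \<in> LX" "y \<in> LY"
      "\<bar>a - x\<bar> \<le> K" "\<bar>b - y\<bar> \<le> K" by auto
    have "c x \<in> insert 0 (set (map c lx))" "c y \<in> insert 0 (set (map c ly))"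
      using xy(4,5) lx(1) ly(1) c0 by auto
    moreover have "(a, b) \<in> square K (c x) (c y)" using clamp xy by simp
    ultimately show "(a, b) \<in> cross_squarees K (map c lx) (map c ly) \<inter> X"
      using xy(1) unfolding cross_squarees_def by blast
  qed
  then have le: "card (X \<inter> square (int L) 0 0 \<inter> (\<Union>x\<in>LX. \<Union>y\<in>LY. square K x y)) \<le> card (cross_squarees K (map c lx) (map c ly) \<inter> X)"
    by (rule card_mono[rotated]) simp
  show thesis
  proof (rule that)
    show "set (map c lx) \<subseteq> {- int L..int L}" "set (map c ly) \<subseteq> {- int L..int L}" by (auto simp: c_def)
    show "length (map c lx) \<le> N" "length (map c ly) \<le> N" using lenN by auto
    show "card (cross_squarees K (map c lx) (map c ly) \<inter> X) \<noteq> 0" using n(1) le by linarith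
    show "\<gamma> * real (length (map c lx) + length (map c ly)) \<le> real (card (cross_squarees K (map c lx) (map c ly) \<inter> X))"
      using n(2) le len by simp
  qed
qed

text \<open>a and b are the numbers of coordinates to be chosen in the two directions. The 1 in the
  exponent serves the case a + b = 0, where a violation still means at least one point near the
  origin.\<close>

lemma prob_not_sparse:
  fixes p :: real
  assumes p: "0 \<le> p" "p \<le> 1" and \<gamma>: "0 \<le> \<gamma>"
    and bad: "\<And>\<omega>. \<omega> \<in> E \<Longrightarrow> \<not> sparse \<gamma> K N ({z. \<omega> z} \<inter> square (int L) 0 0)"
  defines "m \<equiv> (N + 1) * ((N + 1) * (nat (2 * K + 1) * nat (2 * K + 1)))"
  shows "measure (initial_law p) E \<le>
    (\<Sum>(a, b)\<in>{..N} \<times> {..N}. real (2 * L + 1) ^ (a + b) * (2 ^ m * p ^ max 1 (nat \<lceil>\<gamma> * real (a + b)\<rceil>)))"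
proof -
  interpret prob_space "initial_law p" by (rule prob_space_initial_law)
  define S where "S = {- int L..int L}"
  define k where "k c = max 1 (nat \<lceil>\<gamma> * real c\<rceil>)" for c :: nat
  define lists where "lists a = {xs. set xs \<subseteq> S \<and> length xs = a}" for a
  define Ev where "Ev a b xs ys = {\<omega>. k (a + b) \<le> card (cross_squarees K xs ys \<inter> {x. \<omega> x})}" for a b :: nat and xs ys
  have finS: "finite S" and cardS: "card S = 2 * L + 1" by (simp_all add: S_def)
  have fin: "finite (lists a)" for a unfolding lists_def by (rule finite_lists_length_eq[OF finS])
  have card: "card (lists a) = (2 * L + 1) ^ a" for a
    unfolding lists_def using card_lists_length_eq[OF finS, of a] by (simp add: cardS)
  have meas: "Ev a b xs ys \<in> events" for a b xs ys
  proof (rule depends_on_sets)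
    show "depends_on (cross_squarees K xs ys) (Ev a b xs ys)"
      unfolding depends_on_def
    proof (intro allI impI)
      fix \<omega> \<omega>' :: "int \<times> int \<Rightarrow> bool" assume "\<forall>d\<in>cross_squarees K xs ys. \<omega> d = \<omega>' d"
      then have "cross_squarees K xs ys \<inter> {x. \<omega> x} = cross_squarees K xs ys \<inter> {x. \<omega>' x}" by blast
      then show "\<omega> \<in> Ev a b xs ys \<longleftrightarrow> \<omega>' \<in> Ev a b xs ys" by (simp add: Ev_def)
    qed
  qed simp
  define Q where "Q ab = (\<Union>(xs, ys)\<in>lists (fst ab) \<times> lists (snd ab). Ev (fst ab) (snd ab) xs ys)" for ab
  have Qm: "Q ab \<in> events" for ab
    unfolding Q_def by (rule sets.finite_UN) (use fin meas in auto)
  have "E \<subseteq> (\<Union>ab\<in>{..N} \<times> {..N}. Q ab)"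
  proof
    fix \<omega> assume "\<omega> \<in> E"
    from not_sparse_in_square[OF bad[OF this] \<gamma>] obtain xs ys where xy:
      "set xs \<subseteq> S" "set ys \<subseteq> S" "length xs \<le> N" "length ys \<le> N"
      "card (cross_squarees K xs ys \<inter> {z. \<omega> z}) \<noteq> 0"
      "\<gamma> * real (length xs + length ys) \<le> real (card (cross_squarees K xs ys \<inter> {z. \<omega> z}))"
      unfolding S_def by blast
    have "\<omega> \<in> Ev (length xs) (length ys) xs ys"
    proof -
      have "1 \<le> card (cross_squarees K xs ys \<inter> {z. \<omega> z})" using xy(5) by linarith
      moreover have "nat \<lceil>\<gamma> * real (length xs + length ys)\<rceil> \<le> card (cross_squarees K xs ys \<inter> {z. \<omega> z})"
        unfolding nat_le_iff ceiling_le_iff using xy(6) by simp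
      ultimately show ?thesis by (simp only: Ev_def k_def mem_Collect_eq max.bounded_iff)
    qed
    then have "\<omega> \<in> Q (length xs, length ys)" using xy(1,2) unfolding Q_def lists_def by auto
    then show "\<omega> \<in> (\<Union>ab\<in>{..N} \<times> {..N}. Q ab)" using xy(3,4) by blast
  qed
  then have "prob E \<le> prob (\<Union>ab\<in>{..N} \<times> {..N}. Q ab)"
    using Qm by (intro finite_measure_mono sets.finite_UN) auto
  also have "\<dots> \<le> (\<Sum>ab\<in>{..N} \<times> {..N}. prob (Q ab))"
    by (rule finite_measure_subadditive_finite) (use Qm in auto)
  also have "\<dots> \<le> (\<Sum>(a, b)\<in>{..N} \<times> {..N}. real (2 * L + 1) ^ (a + b) * (2 ^ m * p ^ k (a + b)))"
  proof (rule sum_mono)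
    fix ab assume "ab \<in> {..N} \<times> {..N}"
    then obtain a b where eq: "ab = (a, b)" and ab: "a \<in> {..N}" "b \<in> {..N}" by blast
    have "prob (Q (a, b)) \<le> (\<Sum>(xs, ys)\<in>lists a \<times> lists b. prob (Ev a b xs ys))"
      unfolding Q_def fst_conv snd_conv case_prod_beta
      by (rule finite_measure_subadditive_finite) (use fin meas in auto)
    also have "\<dots> \<le> (\<Sum>(xs, ys)\<in>lists a \<times> lists b. 2 ^ m * p ^ k (a + b))"
    proof (rule sum_mono)
      fix z assume "z \<in> lists a \<times> lists b"
      then obtain xs ys where z: "z = (xs, ys)" and "length xs \<le> N" "length ys \<le> N"
        using ab by (auto simp: lists_def)
      then show "(case z of (xs, ys) \<Rightarrow> prob (Ev a b xs ys)) \<le> (case z of (xs, ys) \<Rightarrow> 2 ^ m * p ^ k (a + b))"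
        unfolding z prod.case Ev_def m_def by (intro prob_at_least p card_cross_squarees finite_cross_squarees)
    qed
    also have "\<dots> = real (2 * L + 1) ^ (a + b) * (2 ^ m * p ^ k (a + b))"
      by (simp add: card_cartesian_product card power_add case_prod_beta del: of_nat_add)
    finally show "prob (Q ab) \<le> (case ab of (a, b) \<Rightarrow> real (2 * L + 1) ^ (a + b) * (2 ^ m * p ^ k (a + b)))"
      unfolding eq prod.case .
  qed
  finally show ?thesis unfolding k_def .
qed

lemma Limsup_linear_tendsto_0:
  fixes f :: "real \<Rightarrow> real \<Rightarrow> real"
  assumes "\<And>l p. 0 \<le> f l p" "0 \<le> C"
    and "\<And>l. 0 < l \<Longrightarrow> l \<le> 1 \<Longrightarrow> \<forall>\<^sub>F p in at_right 0. f l p \<le> C * l"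
  shows "((\<lambda>l. Limsup (at_right 0) (\<lambda>p. ereal (f l p))) \<longlongrightarrow> 0) (at_right 0)"
proof (rule tendsto_sandwich[of "\<lambda>_. 0" _ _ "\<lambda>l. ereal (C * l)"])
  show "\<forall>\<^sub>F l in at_right 0. 0 \<le> Limsup (at_right 0) (\<lambda>p. ereal (f l p))"
    using assms(1) by (intro always_eventually allI le_Limsup) auto
  have "\<forall>\<^sub>F l :: real in at_right 0. 0 < l \<and> l < 1"
    by (simp add: eventually_at_right_field) (auto intro: exI[of _ 1])
  then show "\<forall>\<^sub>F l in at_right 0. Limsup (at_right 0) (\<lambda>p. ereal (f l p)) \<le> ereal (C * l)"
  proof eventually_elim
    case (elim l)
    then show ?case using assms(3)[of l] by (intro Limsup_bounded) auto
  qed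
  have "((\<lambda>l. C * l) \<longlongrightarrow> C * 0) (at_right 0)" by (intro tendsto_intros)
  then show "((\<lambda>l. ereal (C * l)) \<longlongrightarrow> 0) (at_right 0)"
    by (simp add: zero_ereal_def)
qed simp

text \<open>Up to time x = l p^(-\<gamma>), the summand with c chosen coordinates is of order at
  most (x p^\<gamma>)^c = l^c, hence at most of order l for c \<ge> 1; for c = 0 it is of order p,
  which is eventually below l.\<close>

theorem gtrsim_from_sparse:
  assumes \<gamma>: "0 < \<gamma>"
    and never: "\<And>X t. sparse \<gamma> K N X \<Longrightarrow> (0, 0) \<notin> growth \<rho> Z X t"
  shows "prob_gtrsim initial_law (\<lambda>p. occupation_time \<rho> Z) (\<lambda>p. p powr (- \<gamma>))"
proof -
  define m where "m = (N + 1) * ((N + 1) * (nat (2 * K + 1) * nat (2 * K + 1)))"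
  define k where "k c = max 1 (nat \<lceil>\<gamma> * real c\<rceil>)" for c :: nat
  define C where "C = real ((N + 1) * (N + 1)) * (real (2 * \<rho> + 1) ^ (2 * N) * 2 ^ m)"
  let ?T = "occupation_time \<rho> Z"
  have "\<forall>\<^sub>F p in at_right 0. measure (initial_law p) {\<omega> \<in> space (initial_law p). ?T \<omega> \<le> ereal (l * p powr (- \<gamma>))} \<le> C * l"
    if l: "0 < l" "l \<le> 1" for l
  proof -
    have "filterlim (\<lambda>p::real. p powr (- \<gamma>)) at_top (at_right 0)" using \<gamma> by real_asymp
    then have "\<forall>\<^sub>F p in at_right 0. 1 / l \<le> p powr (- \<gamma>)" by (simp add: filterlim_at_top)
    moreover have "\<forall>\<^sub>F p in at_right 0. 0 < p \<and> p < (min l 1 :: real)"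
      using l by (simp add: eventually_at_right_field) (auto intro: exI[of _ "min l 1"])
    ultimately show ?thesis
    proof eventually_elim
      case (elim p)
      then have p: "0 < p" "p \<le> 1" "p \<le> l" by auto
      define x where "x = l * p powr (- \<gamma>)"
      have x1: "1 \<le> x" using elim(1) l by (simp add: x_def field_simps)
      define L where "L = \<rho> * nat \<lfloor>x\<rfloor>"
      have "measure (initial_law p) {\<omega> \<in> space (initial_law p). ?T \<omega> \<le> ereal x} \<le>
          (\<Sum>(a, b)\<in>{..N} \<times> {..N}. real (2 * L + 1) ^ (a + b) * (2 ^ m * p ^ k (a + b)))"
        unfolding m_def k_def
      proof (rule prob_not_sparse)
        fix \<omega> assume "\<omega> \<in> {\<omega> \<in> space (initial_law p). ?T \<omega> \<le> ereal x}"
        then have "(0, 0) \<in> growth \<rho> Z {z. \<omega> z} (nat \<lfloor>x\<rfloor>)" using occupied_if_time_le(2) by blast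
        then have "(0, 0) \<in> growth \<rho> Z ({z. \<omega> z} \<inter> square (int L) 0 0) (nat \<lfloor>x\<rfloor>)"
          by (subst growth_local[where X' = "{z. \<omega> z}"]) (simp_all add: L_def Int_assoc)
        then show "\<not> sparse \<gamma> K N ({z. \<omega> z} \<inter> square (int L) 0 0)" using never by blast
      qed (use p \<gamma> in auto)
      also have "\<dots> \<le> (\<Sum>(a, b)\<in>{..N} \<times> {..N}. real (2 * \<rho> + 1) ^ (2 * N) * 2 ^ m * l)"
      proof (rule sum_mono)
        fix ab assume "ab \<in> {..N} \<times> {..N}"
        then obtain a b where eq: "ab = (a, b)" and ab: "a \<in> {..N}" "b \<in> {..N}" by blast
        define c where "c = a + b"
        have c: "c \<le> 2 * N" using ab by (simp add: c_def)
        have "real (nat \<lfloor>x\<rfloor>) \<le> x" using x1 by (simp add: of_nat_nat)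
        then have "real L \<le> real \<rho> * x" unfolding L_def of_nat_mult by (intro mult_left_mono) auto
        then have "real (2 * L + 1) \<le> real (2 * \<rho> + 1) * x" using x1 by (simp add: algebra_simps)
        then have "real (2 * L + 1) ^ c \<le> (real (2 * \<rho> + 1) * x) ^ c" by (intro power_mono) auto
        also have "\<dots> = real (2 * \<rho> + 1) ^ c * x ^ c" by (rule power_mult_distrib)
        also have "\<dots> \<le> real (2 * \<rho> + 1) ^ (2 * N) * x ^ c"
          using c x1 by (intro mult_right_mono power_increasing) auto
        finally have 1: "real (2 * L + 1) ^ c \<le> real (2 * \<rho> + 1) ^ (2 * N) * x ^ c" .
        have 2: "x ^ c * p ^ k c \<le> l"
        proof (cases "c = 0")
          case True
          then show ?thesis using p by (simp add: k_def)
        next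
          case False
          have "p ^ k c = p powr real (k c)" using p by (simp add: powr_realpow)
          also have "\<dots> \<le> p powr (\<gamma> * real c)"
            using p unfolding k_def by (intro powr_mono') (auto simp: le_max_iff_disj, linarith)
          finally have "x ^ c * p ^ k c \<le> x ^ c * p powr (\<gamma> * real c)" using x1 by (intro mult_left_mono) auto
          also have "\<dots> = l ^ c"
          proof -
            have "(p powr (- \<gamma>)) ^ c = (p powr (- \<gamma>)) powr real c"
              using p by (intro powr_realpow[symmetric]) auto
            then have "x ^ c = l ^ c * p powr (- \<gamma> * real c)"
              unfolding x_def power_mult_distrib by (simp only: powr_powr)
            then show ?thesis using p by (simp add: powr_add[symmetric] mult.assoc)
          qed
          also have "l ^ c \<le> l ^ 1" using False l by (intro power_decreasing) auto
          finally show ?thesis by simp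
        qed
        have "real (2 * L + 1) ^ c * (2 ^ m * p ^ k c) \<le> real (2 * \<rho> + 1) ^ (2 * N) * x ^ c * (2 ^ m * p ^ k c)"
          using 1 p by (intro mult_right_mono) auto
        also have "\<dots> = real (2 * \<rho> + 1) ^ (2 * N) * 2 ^ m * (x ^ c * p ^ k c)" by (simp only: ac_simps)
        also have "\<dots> \<le> real (2 * \<rho> + 1) ^ (2 * N) * 2 ^ m * l" using 2 by (intro mult_left_mono) auto
        finally show "(case ab of (a, b) \<Rightarrow> real (2 * L + 1) ^ (a + b) * (2 ^ m * p ^ k (a + b))) \<le>
            (case ab of (a, b) \<Rightarrow> real (2 * \<rho> + 1) ^ (2 * N) * 2 ^ m * l)"
          unfolding c_def eq prod.case .
      qed
      also have "\<dots> = C * l" by (simp add: C_def card_cartesian_product algebra_simps)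
      finally show ?case unfolding x_def .
    qed
  qed
  then show ?thesis
    unfolding prob_gtrsim_def by (intro Limsup_linear_tendsto_0[of _ C]) (auto simp: C_def)
qed

section \<open>Nucleation\<close>

text \<open>After k steps the seed has spread by k to both sides inside [lo, hi), because the next
  site on either side sees q occupied sites in succession.\<close>

lemma fill_interval:
  fixes P :: "nat \<Rightarrow> int \<Rightarrow> bool" and q :: nat
  assumes mono: "\<And>t y. P t y \<Longrightarrow> P (Suc t) y"
    and seed: "\<And>y. a \<le> y \<Longrightarrow> y < a + int q \<Longrightarrow> P t0 y" and a: "lo \<le> a" "a + int q \<le> hi"
    and step: "\<And>t y. t0 \<le> t \<Longrightarrow> lo \<le> y \<Longrightarrow> y < hi \<Longrightarrow>
      (\<forall>i. 1 \<le> i \<and> i \<le> int q \<longrightarrow> P t (y - i)) \<or> (\<forall>i. 1 \<le> i \<and> i \<le> int q \<longrightarrow> P t (y + i)) \<Longrightarrow> P (Suc t) y"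
    and y: "lo \<le> y" "y < hi"
  shows "P (t0 + nat (hi - lo)) y"
proof -
  have "\<forall>y. lo \<le> y \<and> y < hi \<and> a - int k \<le> y \<and> y < a + int q + int k \<longrightarrow> P (t0 + k) y" for k
  proof (induction k)
    case 0
    then show ?case using seed by simp
  next
    case (Suc k)
    show ?case
    proof (intro allI impI)
      fix y assume y: "lo \<le> y \<and> y < hi \<and> a - int (Suc k) \<le> y \<and> y < a + int q + int (Suc k)"
      consider "a - int k \<le> y \<and> y < a + int q + int k" | "y = a - int (Suc k)" | "y = a + int q + int k"
        using y by linarith
      then show "P (t0 + Suc k) y"
      proof cases
        case 1
        then show ?thesis using Suc y mono by simp
      next
        case 2
        have "P (t0 + k) (y + i)" if "1 \<le> i \<and> i \<le> int q" for i
          using Suc that 2 y a by simp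
        then show ?thesis using step[of "t0 + k" y] y by simp
      next
        case 3
        have "P (t0 + k) (y - i)" if "1 \<le> i \<and> i \<le> int q" for i
          using Suc that 3 y a by simp
        then show ?thesis using step[of "t0 + k" y] y by simp
      qed
    qed
  qed
  from this[of "nat (hi - lo)"] show ?thesis using y a by simp
qed

lemma run_le_vcount:
  assumes "q \<le> \<rho>" "(\<forall>i. 1 \<le> i \<and> i \<le> int q \<longrightarrow> (x, y - i) \<in> X) \<or> (\<forall>i. 1 \<le> i \<and> i \<le> int q \<longrightarrow> (x, y + i) \<in> X)"
  shows "q \<le> vcount \<rho> X x y"
proof -
  have *: "q \<le> card {b. \<bar>b - y\<bar> \<le> int \<rho> \<and> (x, b) \<in> X}"
    if "inj_on f {1..int q}" "\<And>i. i \<in> {1..int q} \<Longrightarrow> \<bar>f i - y\<bar> \<le> int \<rho> \<and> (x, f i) \<in> X" for f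
  proof -
    have "card (f ` {1..int q}) \<le> card {b. \<bar>b - y\<bar> \<le> int \<rho> \<and> (x, b) \<in> X}"
      by (rule card_mono) (use that(2) in auto)
    then show ?thesis using card_image[OF that(1)] by simp
  qed
  show ?thesis
    using assms(2) unfolding vcount_def
  proof
    assume "\<forall>i. 1 \<le> i \<and> i \<le> int q \<longrightarrow> (x, y - i) \<in> X"
    then show "q \<le> card {b. \<bar>b - y\<bar> \<le> int \<rho> \<and> (x, b) \<in> X}"
      by (intro *[of "\<lambda>i. y - i"]) (use assms(1) in \<open>auto simp: inj_on_def\<close>)
  next
    assume "\<forall>i. 1 \<le> i \<and> i \<le> int q \<longrightarrow> (x, y + i) \<in> X"
    then show "q \<le> card {b. \<bar>b - y\<bar> \<le> int \<rho> \<and> (x, b) \<in> X}"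
      by (intro *[of "\<lambda>i. y + i"]) (use assms(1) in \<open>auto simp: inj_on_def\<close>)
  qed
qed

lemma run_le_hcount:
  assumes "q \<le> \<rho>" "(\<forall>i. 1 \<le> i \<and> i \<le> int q \<longrightarrow> (x - i, y) \<in> X) \<or> (\<forall>i. 1 \<le> i \<and> i \<le> int q \<longrightarrow> (x + i, y) \<in> X)"
  shows "q \<le> hcount \<rho> X x y"
  using run_le_vcount[of q \<rho> y x "X\<inverse>"] assms by simp

locale full_growth =
  fixes \<rho> r s1 s2 :: nat and X :: "(int \<times> int) set"
  assumes s: "s1 < r" "s2 < r" "r \<le> \<rho>"
begin

definition "\<xi> = growth \<rho> (cross_zero_set r s1 s2) X"

lemma \<xi>_0: "\<xi> 0 = X"
  by (simp add: \<xi>_def)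

lemma \<xi>_mono: "t \<le> t' \<Longrightarrow> z \<in> \<xi> t \<Longrightarrow> z \<in> \<xi> t'"
  using growth_mono' unfolding \<xi>_def by blast

lemma \<xi>_Suc:
  "(x, y) \<in> \<xi> (Suc t) \<longleftrightarrow> (x, y) \<in> \<xi> t \<or> r \<le> hcount \<rho> (\<xi> t) x y \<or> r \<le> vcount \<rho> (\<xi> t) x y \<or>
     s1 \<le> hcount \<rho> (\<xi> t) x y \<and> s2 \<le> vcount \<rho> (\<xi> t) x y"
  unfolding \<xi>_def growth_Suc_iff Let_def ..

lemma column_fills:
  assumes seed: "\<And>y. a \<le> y \<Longrightarrow> y < a + int r \<Longrightarrow> (x, y) \<in> \<xi> t0" and a: "lo \<le> a" "a + int r \<le> hi"
    and y: "lo \<le> y" "y < hi"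
  shows "(x, y) \<in> \<xi> (t0 + nat (hi - lo))"
proof (rule fill_interval[where P = "\<lambda>t y. (x, y) \<in> \<xi> t" and q = r])
  fix t y assume "(\<forall>i. 1 \<le> i \<and> i \<le> int r \<longrightarrow> (x, y - i) \<in> \<xi> t) \<or> (\<forall>i. 1 \<le> i \<and> i \<le> int r \<longrightarrow> (x, y + i) \<in> \<xi> t)"
  then have "r \<le> vcount \<rho> (\<xi> t) x y" by (intro run_le_vcount s)
  then show "(x, y) \<in> \<xi> (Suc t)" by (simp add: \<xi>_Suc)
qed (use seed a y \<xi>_mono[of t "Suc t" for t] in auto)

lemma row_fills:
  assumes seed: "\<And>x. a \<le> x \<Longrightarrow> x < a + int r \<Longrightarrow> (x, y) \<in> \<xi> t0" and a: "lo \<le> a" "a + int r \<le> hi"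
    and x: "lo \<le> x" "x < hi"
  shows "(x, y) \<in> \<xi> (t0 + nat (hi - lo))"
proof (rule fill_interval[where P = "\<lambda>t x. (x, y) \<in> \<xi> t" and q = r])
  fix t x assume "(\<forall>i. 1 \<le> i \<and> i \<le> int r \<longrightarrow> (x - i, y) \<in> \<xi> t) \<or> (\<forall>i. 1 \<le> i \<and> i \<le> int r \<longrightarrow> (x + i, y) \<in> \<xi> t)"
  then have "r \<le> hcount \<rho> (\<xi> t) x y" by (intro run_le_hcount s)
  then show "(x, y) \<in> \<xi> (Suc t)" by (simp add: \<xi>_Suc)
qed (use seed a x \<xi>_mono[of t "Suc t" for t] in auto)

lemma assisted_column_fills:
  assumes seed: "\<And>y. a \<le> y \<Longrightarrow> y < a + int s2 \<Longrightarrow> (x, y) \<in> \<xi> t0" and a: "lo \<le> a" "a + int s2 \<le> hi"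
    and left: "\<And>y. lo \<le> y \<Longrightarrow> y < hi \<Longrightarrow> s1 \<le> hcount \<rho> (\<xi> t0) x y"
    and y: "lo \<le> y" "y < hi"
  shows "(x, y) \<in> \<xi> (t0 + nat (hi - lo))"
proof (rule fill_interval[where P = "\<lambda>t y. (x, y) \<in> \<xi> t" and q = s2])
  fix t y assume t: "t0 \<le> t" and y: "lo \<le> y" "y < hi"
    and "(\<forall>i. 1 \<le> i \<and> i \<le> int s2 \<longrightarrow> (x, y - i) \<in> \<xi> t) \<or> (\<forall>i. 1 \<le> i \<and> i \<le> int s2 \<longrightarrow> (x, y + i) \<in> \<xi> t)"
  then have "s2 \<le> vcount \<rho> (\<xi> t) x y" by (intro run_le_vcount) (use s in auto)
  moreover have "hcount \<rho> (\<xi> t0) x y \<le> hcount \<rho> (\<xi> t) x y"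
    using \<xi>_mono[OF t] by (intro hcount_mono) auto
  then have "s1 \<le> hcount \<rho> (\<xi> t) x y" using left[OF y] by linarith
  ultimately show "(x, y) \<in> \<xi> (Suc t)" by (simp add: \<xi>_Suc)
qed (use seed a y \<xi>_mono[of t "Suc t" for t] in auto)

lemma origin_from_columns:
  assumes cols: "\<And>j. j < r \<Longrightarrow> (x0 + int j, 0) \<in> \<xi> t0" and x0: "0 \<le> x0" "x0 + int r \<le> int H"
  shows "(0, 0) \<in> \<xi> (t0 + H)"
proof -
  have "(0, 0) \<in> \<xi> (t0 + nat (int H - 0))"
  proof (rule row_fills[of x0])
    fix x assume "x0 \<le> x" "x < x0 + int r"
    then show "(x, 0) \<in> \<xi> t0" using cols[of "nat (x - x0)"] by simp
  qed (use x0 s in auto)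
  then show ?thesis by simp
qed

end

section \<open>From nuclei to the origin\<close>

text \<open>The s rows and the first s columns fill by themselves. The columns x0 + s, x0 + s + 1,
  ... follow one after another: each has s full columns to its left and starts from its crossings
  with the s full rows. Finally r adjacent full columns fill row 0 back to the origin.\<close>

lemma nucleation_cross:
  fixes X :: "(int \<times> int) set"
  assumes s: "1 \<le> s" "s < r" "r \<le> \<rho>" and M: "r \<le> M"
    and x0: "0 \<le> x0" "x0 + int r \<le> int M" and y0: "0 \<le> y0" "y0 + int r \<le> int M"
    and cols: "\<And>j. j < s \<Longrightarrow> \<exists>a. 0 \<le> a \<and> a + int r \<le> int M \<and> (\<forall>h<r. (x0 + int j, a + int h) \<in> X)"
    and rows: "\<And>j. j < s \<Longrightarrow> \<exists>a. 0 \<le> a \<and> a + int r \<le> int M \<and> (\<forall>h<r. (a + int h, y0 + int j) \<in> X)"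
  shows "(0, 0) \<in> growth \<rho> (cross_zero_set r s s) X (2 * M * (r + 1))"
proof -
  interpret full_growth \<rho> r s s X by standard (use s in auto)
  define H where "H = 2 * M"
  have runs: "(x, y) \<in> X" if "\<forall>h<r. (x, a + int h) \<in> X" "a \<le> y" "y < a + int r" for x a y
    using that(1)[rule_format, of "nat (y - a)"] that(2,3) by simp
  have runs': "(x, y) \<in> X" if "\<forall>h<r. (a + int h, y) \<in> X" "a \<le> x" "x < a + int r" for x a y
    using that(1)[rule_format, of "nat (x - a)"] that(2,3) by simp
  have row: "(x, y0 + int j) \<in> \<xi> H" if j: "j < s" and x: "0 \<le> x" "x < int H" for j x
  proof -
    obtain a where a: "0 \<le> a" "a + int r \<le> int M" "\<forall>h<r. (a + int h, y0 + int j) \<in> X" using rows[OF j] by blast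
    have "(x, y0 + int j) \<in> \<xi> (0 + nat (int H - 0))"
      by (rule row_fills[of a]) (use a x runs' in \<open>auto simp: \<xi>_0 H_def\<close>)
    then show ?thesis by simp
  qed
  have col: "\<forall>y. 0 \<le> y \<and> y < int H \<longrightarrow> (x0 + int j, y) \<in> \<xi> (H * (1 + j))" if "j < r" for j
    using that
  proof (induction j rule: less_induct)
    case (less j)
    show ?case
    proof (cases "j < s")
      case True
      obtain a where a: "0 \<le> a" "a + int r \<le> int M" "\<forall>h<r. (x0 + int j, a + int h) \<in> X" using cols[OF True] by blast
      show ?thesis
      proof (intro allI impI)
        fix y assume y: "0 \<le> y \<and> y < int H"
        have "(x0 + int j, y) \<in> \<xi> (0 + nat (int H - 0))"
          by (rule column_fills[of a]) (use a y runs in \<open>auto simp: \<xi>_0 H_def\<close>)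
        then show "(x0 + int j, y) \<in> \<xi> (H * (1 + j))" by (rule \<xi>_mono[rotated]) simp
      qed
    next
      case False
      show ?thesis
      proof (intro allI impI)
        fix y assume y: "0 \<le> y \<and> y < int H"
        have "(x0 + int j, y) \<in> \<xi> (H * j + nat (int H - 0))"
        proof (rule assisted_column_fills[of y0])
          fix b assume b: "y0 \<le> b" "b < y0 + int s"
          have "(x0 + int j, y0 + int (nat (b - y0))) \<in> \<xi> H"
            by (rule row) (use b x0 less.prems M in \<open>auto simp: H_def\<close>)
          then show "(x0 + int j, b) \<in> \<xi> (H * j)"
            using \<xi>_mono[of H "H * j"] b s False by (cases j) auto
        next
          fix b assume b: "0 \<le> b" "b < int H"
          have "(x0 + int j - i, b) \<in> \<xi> (H * j)" if i: "1 \<le> i \<and> i \<le> int s" for i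
          proof -
            define j' where "j' = j - nat i"
            have j': "j' < j" "x0 + int j - i = x0 + int j'" using i False by (auto simp: j'_def)
            have "(x0 + int j', b) \<in> \<xi> (H * (1 + j'))"
              using less.IH[OF j'(1)] less.prems j'(1) b by simp
            moreover have "H * (1 + j') \<le> H * j" using j'(1) by (intro mult_le_mono2) simp
            ultimately show ?thesis unfolding j'(2) by (rule \<xi>_mono[rotated])
          qed
          then show "s \<le> hcount \<rho> (\<xi> (H * j)) (x0 + int j) b"
            by (intro run_le_hcount) (use s in auto)
        qed (use y y0 s in \<open>auto simp: H_def\<close>)
        then show "(x0 + int j, y) \<in> \<xi> (H * (1 + j))" by (simp add: algebra_simps)
      qed
    qed
  qed
  have "(0, 0) \<in> \<xi> (H * r + H)"
  proof (rule origin_from_columns[of x0])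
    fix j assume j: "j < r"
    have "(x0 + int j, 0) \<in> \<xi> (H * (1 + j))" using col[OF j] M s by (simp add: H_def)
    then show "(x0 + int j, 0) \<in> \<xi> (H * r)" by (rule \<xi>_mono[rotated]) (use j in \<open>intro mult_le_mono2, simp\<close>)
  qed (use x0 in \<open>auto simp: H_def\<close>)
  then show ?thesis unfolding \<xi>_def H_def by (simp add: algebra_simps)
qed

text \<open>The first column fills by itself. As j < r \<le> \<rho>, it is the one horizontal
  neighbour that every other column needs, so their runs of s all grow simultaneously; then row 0
  fills back. These are three stages of length M.\<close>

lemma nucleation_columns:
  fixes X :: "(int \<times> int) set"
  assumes s: "s < r" "2 \<le> r" "r \<le> \<rho>" and M: "r \<le> M" and x0: "0 \<le> x0" "x0 + int r \<le> int M"
    and cols: "\<And>j. j < r \<Longrightarrow> \<exists>a. 0 \<le> a \<and> a + int r \<le> int M \<and>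
      (\<forall>h<(if j = 0 then r else s). (x0 + int j, a + int h) \<in> X)"
  shows "(0, 0) \<in> growth \<rho> (cross_zero_set r 1 s) X (2 * M * (r + 1))"
proof -
  interpret full_growth \<rho> r 1 s X by standard (use s in auto)
  have runs: "(x, y) \<in> X" if "\<forall>h<q. (x, a + int h) \<in> X" "a \<le> y" "y < a + int q" for x a y q
    using that(1)[rule_format, of "nat (y - a)"] that(2,3) by simp
  have first: "(x0, y) \<in> \<xi> M" if "0 \<le> y" "y < int M" for y
  proof -
    obtain a where a: "0 \<le> a" "a + int r \<le> int M" "\<forall>h<r. (x0, a + int h) \<in> X" using cols[of 0] s by auto
    have "(x0, y) \<in> \<xi> (0 + nat (int M - 0))"
      by (rule column_fills[of a]) (use a that runs \<xi>_0 in auto)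
    then show ?thesis by simp
  qed
  have "(x0 + int j, 0) \<in> \<xi> (M + M)" if j: "j < r" for j
  proof (cases "j = 0")
    case True
    then show ?thesis using first[of 0] M s \<xi>_mono[of M "M + M"] by simp
  next
    case False
    obtain a where a: "0 \<le> a" "a + int r \<le> int M" "\<forall>h<s. (x0 + int j, a + int h) \<in> X" using cols[OF j] False by auto
    have "(x0 + int j, 0) \<in> \<xi> (M + nat (int M - 0))"
    proof (rule assisted_column_fills[of a])
      fix y assume "a \<le> y" "y < a + int s"
      then show "(x0 + int j, y) \<in> \<xi> M" using runs[OF a(3)] \<xi>_mono[of 0 M] \<xi>_0 by simp
    next
      fix y assume "0 \<le> y" "y < int M"
      then have "{x0} \<subseteq> {b. \<bar>b - (x0 + int j)\<bar> \<le> int \<rho> \<and> (b, y) \<in> \<xi> M}" using first j s by auto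
      then have "card {x0} \<le> card {b. \<bar>b - (x0 + int j)\<bar> \<le> int \<rho> \<and> (b, y) \<in> \<xi> M}" by (rule card_mono[rotated]) simp
      then show "1 \<le> hcount \<rho> (\<xi> M) (x0 + int j) y" by (simp add: hcount_def)
    qed (use a s M in auto)
    then show ?thesis by simp
  qed
  then have "(0, 0) \<in> \<xi> (M + M + M)" using x0 by (intro origin_from_columns[of x0]) auto
  moreover have "M + M + M \<le> 2 * M * (r + 1)"
    using mult_le_mono2[of 2 "r + 1" "2 * M"] s by simp
  ultimately show ?thesis using \<xi>_mono unfolding \<xi>_def by blast
qed

section \<open>Existence of nuclei\<close>

text \<open>Runs are sought only in the cells from i r to i r + r - 1 of a line, and lines only in
  the blocks b r, ..., b r + J - 1. Disjoint cells and blocks are independent, and only constant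
  factors are lost.\<close>

definition run_event :: "nat \<Rightarrow> bool \<Rightarrow> int \<Rightarrow> nat \<Rightarrow> nat \<Rightarrow> (int \<times> int \<Rightarrow> bool) set" where
  "run_event r k z q i = {\<omega>. \<forall>h<q. \<omega> (site k (int (i * r + h)) z)}"

definition line_event :: "nat \<Rightarrow> nat \<Rightarrow> bool \<Rightarrow> int \<Rightarrow> nat \<Rightarrow> (int \<times> int \<Rightarrow> bool) set" where
  "line_event r n k z q = (\<Union>i<n. run_event r k z q i)"

definition block_event ::
  "nat \<Rightarrow> nat \<Rightarrow> bool \<Rightarrow> nat \<Rightarrow> (nat \<Rightarrow> nat) \<Rightarrow> nat \<Rightarrow> (int \<times> int \<Rightarrow> bool) set" where
  "block_event r n k J q b = (\<Inter>j<J. line_event r n k (int (b * r + j)) (q j))"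

definition nucleus_event ::
  "nat \<Rightarrow> nat \<Rightarrow> bool \<Rightarrow> nat \<Rightarrow> (nat \<Rightarrow> nat) \<Rightarrow> (int \<times> int \<Rightarrow> bool) set" where
  "nucleus_event r n k J q = (\<Union>b<n. block_event r n k J q b)"

lemma site_inj: "site k a z = site k a' z' \<longleftrightarrow> a = a' \<and> z = z'"
  by (auto simp: site_def)

lemma mult_add_unique:
  fixes i j r h h' :: nat
  assumes "i * r + h = j * r + h'" "h < r" "h' < r"
  shows "i = j"
proof -
  have "(i * r + h) div r = i" "(j * r + h') div r = j" using assms(2,3) by auto
  then show ?thesis using assms(1) by simp
qed

lemma depends_on_UN:
  assumes "\<And>j. j \<in> J \<Longrightarrow> depends_on (D j) (A j)"
  shows "depends_on (\<Union>j\<in>J. D j) (\<Union>j\<in>J. A j)"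
proof -
  have "depends_on (\<Union>j\<in>J. D j) (\<Inter>j\<in>J. - A j)"
    by (rule depends_on_INT) (rule depends_on_Compl, rule assms)
  then have "depends_on (\<Union>j\<in>J. D j) (- (\<Inter>j\<in>J. - A j))" by (rule depends_on_Compl)
  then show ?thesis by simp
qed

definition run_sites :: "nat \<Rightarrow> bool \<Rightarrow> int \<Rightarrow> nat \<Rightarrow> (int \<times> int) set" where
  "run_sites r k z i = (\<lambda>h. site k (int (i * r + h)) z) ` {..<r}"

definition line_sites :: "nat \<Rightarrow> nat \<Rightarrow> bool \<Rightarrow> int \<Rightarrow> (int \<times> int) set" where
  "line_sites r n k z = (\<Union>i<n. run_sites r k z i)"

definition block_sites :: "nat \<Rightarrow> nat \<Rightarrow> bool \<Rightarrow> nat \<Rightarrow> nat \<Rightarrow> (int \<times> int) set" where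
  "block_sites r n k J b = (\<Union>j<J. line_sites r n k (int (b * r + j)))"

lemma finite_sites: "finite (run_sites r k z i)" "finite (line_sites r n k z)" "finite (block_sites r n k J b)"
  by (simp_all add: run_sites_def line_sites_def block_sites_def)

lemma run_depends: "q \<le> r \<Longrightarrow> depends_on (run_sites r k z i) (run_event r k z q i)"
  unfolding depends_on_def run_event_def run_sites_def by fastforce

lemma line_depends: "q \<le> r \<Longrightarrow> depends_on (line_sites r n k z) (line_event r n k z q)"
  unfolding line_sites_def line_event_def by (rule depends_on_UN) (rule run_depends)

lemma block_depends: "(\<And>j. j < J \<Longrightarrow> q j \<le> r) \<Longrightarrow> depends_on (block_sites r n k J b) (block_event r n k J q b)"
  unfolding block_sites_def block_event_def by (rule depends_on_INT) (auto intro: line_depends)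

lemma run_sites_disjoint: "disjoint_family_on (run_sites r k z) I"
  unfolding disjoint_family_on_def run_sites_def
proof (intro ballI impI, rule ccontr)
  fix i j assume ij: "i \<noteq> j"
    and "(\<lambda>h. site k (int (i * r + h)) z) ` {..<r} \<inter> (\<lambda>h. site k (int (j * r + h)) z) ` {..<r} \<noteq> {}"
  then obtain u where u: "u \<in> (\<lambda>h. site k (int (i * r + h)) z) ` {..<r}"
    "u \<in> (\<lambda>h. site k (int (j * r + h)) z) ` {..<r}" by blast
  obtain h where h: "h < r" "u = site k (int (i * r + h)) z" using u(1) by blast
  obtain h' where "h' < r" "u = site k (int (j * r + h')) z" using u(2) by blast
  with h have "h < r" "h' < r" "site k (int (i * r + h)) z = site k (int (j * r + h')) z" by simp_all
  then have "i * r + h = j * r + h'" by (simp only: site_inj of_nat_eq_iff)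
  then show False using mult_add_unique[of i r h j h'] \<open>h < r\<close> \<open>h' < r\<close> ij by simp
qed

lemma line_sites_sub: "z \<in> line_sites r n k w \<Longrightarrow> \<exists>a. z = site k a w"
  by (auto simp: line_sites_def run_sites_def)

lemma line_sites_disjoint: "w \<noteq> w' \<Longrightarrow> line_sites r n k w \<inter> line_sites r n k w' = {}"
proof (rule ccontr)
  assume "w \<noteq> w'" "line_sites r n k w \<inter> line_sites r n k w' \<noteq> {}"
  then obtain z where "z \<in> line_sites r n k w" "z \<in> line_sites r n k w'" by blast
  then obtain a a' where "z = site k a w" "z = site k a' w'" using line_sites_sub by meson
  then show False using \<open>w \<noteq> w'\<close> by (simp add: site_inj)
qed

lemma block_sites_disjoint:
  assumes "J \<le> r"
  shows "disjoint_family_on (block_sites r n k J) I"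
  unfolding disjoint_family_on_def
proof (intro ballI impI, rule ccontr)
  fix b c assume bc: "b \<noteq> c" and "block_sites r n k J b \<inter> block_sites r n k J c \<noteq> {}"
  then obtain z j j' where z: "j < J" "j' < J" "z \<in> line_sites r n k (int (b * r + j))" "z \<in> line_sites r n k (int (c * r + j'))"
    by (auto simp: block_sites_def)
  then have "int (b * r + j) = int (c * r + j')" using line_sites_disjoint by blast
  then have "b * r + j = c * r + j'" by (simp only: of_nat_eq_iff)
  then show False using mult_add_unique[of b r j c j'] z(1,2) assms bc by simp
qed

text \<open>The probability of at least one success in independent trials is at least half the
  expected number x of successes, or one half if x is larger than 1.\<close>

lemma half_min_le_exp:
  fixes x :: real assumes "0 \<le> x" shows "min 1 x / 2 \<le> 1 - exp (- x)"
proof -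
  have e: "exp (- x) \<le> 1 / (1 + x)"
    using exp_ge_add_one_self[of x] assms by (simp add: exp_minus field_simps)
  show ?thesis
  proof (cases "x \<le> 1")
    case True
    have "x * x \<le> 1 * x" using True assms by (intro mult_right_mono)
    then have "1 \<le> (1 - x / 2) * (1 + x)" by (simp add: algebra_simps)
    then have "1 / (1 + x) \<le> 1 - x / 2" using assms by (simp add: divide_le_eq)
    then show ?thesis using e True by (simp add: min_def)
  next
    case False
    then have "1 / (1 + x) \<le> 1 / 2" by (intro divide_left_mono) auto
    moreover have "min 1 x = 1" using False by simp
    ultimately show ?thesis using e by linarith
  qed
qed

lemma one_minus_power_le_exp:
  fixes x :: real assumes "0 \<le> x" "x \<le> 1" shows "(1 - x) ^ n \<le> exp (- (real n * x))"
proof -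
  have "(1 - x) ^ n \<le> exp (- x) ^ n"
    using exp_ge_add_one_self[of "- x"] assms by (intro power_mono) auto
  also have "\<dots> = exp (- (real n * x))" by (simp add: exp_of_nat_mult[symmetric])
  finally show ?thesis .
qed

context
  fixes p :: real and r n :: nat
  assumes p: "0 \<le> p" "p \<le> 1"
begin

interpretation prob_space "initial_law p" by (rule prob_space_initial_law)

lemma prob_Compl_depends_on: "depends_on D A \<Longrightarrow> finite D \<Longrightarrow> prob (- A) = 1 - prob A"
  using prob_compl[OF depends_on_sets[of D A p]] by (simp add: Compl_eq_Diff_UNIV)

lemma prob_run: "prob (run_event r k z q i) = p ^ q"
proof -
  have "run_event r k z q i = {\<omega>. \<forall>x\<in>(\<lambda>h. site k (int (i * r + h)) z) ` {..<q}. \<omega> x}"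
    by (auto simp: run_event_def)
  moreover have "card ((\<lambda>h. site k (int (i * r + h)) z) ` {..<q}) = q"
    by (subst card_image) (auto simp: inj_on_def site_inj)
  ultimately show ?thesis using prob_all_occupied[OF p, of "(\<lambda>h. site k (int (i * r + h)) z) ` {..<q}"] by simp
qed

lemma prob_line:
  assumes "q \<le> r"
  shows "min 1 (real n * p ^ q) / 2 \<le> prob (line_event r n k z q)"
proof -
  have pq: "0 \<le> p ^ q" "p ^ q \<le> 1" using p by (auto intro: power_le_one)
  have "prob (- line_event r n k z q) = prob (\<Inter>i<n. - run_event r k z q i)"
    unfolding line_event_def by (simp add: Compl_UN)
  also have "\<dots> = (\<Prod>i<n. prob (- run_event r k z q i))"
    by (rule prob_INT_depends_on[of _ "run_sites r k z"])
      (use assms in \<open>auto intro: depends_on_Compl run_depends finite_sites run_sites_disjoint\<close>)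
  also have "\<dots> = (\<Prod>i<n. 1 - p ^ q)"
    by (rule prod.cong) (use prob_Compl_depends_on[OF run_depends[OF assms] finite_sites(1)] prob_run in auto)
  also have "\<dots> = (1 - p ^ q) ^ n" by simp
  also have "\<dots> \<le> exp (- (real n * p ^ q))" by (rule one_minus_power_le_exp[OF pq])
  finally have "1 - prob (line_event r n k z q) \<le> exp (- (real n * p ^ q))"
    using prob_Compl_depends_on[OF line_depends[OF assms] finite_sites(2)] by simp
  then show ?thesis using half_min_le_exp[of "real n * p ^ q"] pq by simp
qed

lemma prob_block:
  assumes "\<And>j. j < J \<Longrightarrow> q j \<le> r"
  shows "(\<Prod>j<J. min 1 (real n * p ^ q j) / 2) \<le> prob (block_event r n k J q b)"
proof -
  have "(\<Prod>j<J. min 1 (real n * p ^ q j) / 2) \<le> (\<Prod>j<J. prob (line_event r n k (int (b * r + j)) (q j)))"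
    by (rule prod_mono) (use assms prob_line p in auto)
  also have "\<dots> = prob (block_event r n k J q b)"
    unfolding block_event_def
    by (rule prob_INT_depends_on[of _ "\<lambda>j. line_sites r n k (int (b * r + j))", symmetric])
      (use assms line_sites_disjoint in \<open>auto intro: line_depends finite_sites simp: disjoint_family_on_def\<close>)
  finally show ?thesis .
qed

lemma nucleus_depends:
  assumes "\<And>j. j < J \<Longrightarrow> q j \<le> r"
  shows "depends_on (\<Union>b<n. block_sites r n k J b) (nucleus_event r n k J q)"
  unfolding nucleus_event_def by (rule depends_on_UN) (rule block_depends[OF assms])

lemma prob_no_nucleus:
  assumes q: "\<And>j. j < J \<Longrightarrow> q j \<le> r" and J: "J \<le> r"
  shows "prob (- nucleus_event r n k J q) \<le> exp (- (real n * (\<Prod>j<J. min 1 (real n * p ^ q j) / 2)))"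
proof -
  let ?P = "\<Prod>j<J. min 1 (real n * p ^ q j) / 2"
  have P: "0 \<le> ?P" "?P \<le> 1"
    using p by (auto intro!: prod_nonneg prod_le_1)
  have "prob (- nucleus_event r n k J q) = prob (\<Inter>b<n. - block_event r n k J q b)"
    unfolding nucleus_event_def by (simp add: Compl_UN)
  also have "\<dots> = (\<Prod>b<n. prob (- block_event r n k J q b))"
    by (rule prob_INT_depends_on[of _ "block_sites r n k J"])
      (use q J in \<open>auto intro: depends_on_Compl block_depends finite_sites block_sites_disjoint\<close>)
  also have "\<dots> \<le> (\<Prod>b<n. 1 - ?P)"
    by (rule prod_mono) (use prob_Compl_depends_on[OF block_depends[OF q] finite_sites(3)] prob_block[OF q] in auto)
  also have "\<dots> = (1 - ?P) ^ n" by simp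
  also have "\<dots> \<le> exp (- (real n * ?P))" by (rule one_minus_power_le_exp[OF P])
  finally show ?thesis .
qed

end

lemma time_le_if_occupied: "(0, 0) \<in> growth \<rho> Z {z. \<omega> z} t \<Longrightarrow> occupation_time \<rho> Z \<omega> \<le> ereal (real t)"
  unfolding occupation_time_def by (rule INF_lower) simp

text \<open>Horizontal and vertical lines share sites; a union bound over the absence of either kind
  of nucleus avoids their dependence.\<close>

theorem lesssim_from_nuclei:
  assumes \<gamma>: "0 < \<gamma>" and r: "1 \<le> r" and C: "0 < C"
    and q: "\<And>j. j < J \<Longrightarrow> q j \<le> r" and J: "J \<le> r"
    and occupied: "\<And>n \<omega>. 1 \<le> n \<Longrightarrow> \<omega> \<in> nucleus_event r n False J q \<Longrightarrow> \<omega> \<in> nucleus_event r n True J q \<Longrightarrow>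
      (0, 0) \<in> growth \<rho> Z {z. \<omega> z} (2 * (n * r) * (r + 1))"
    and many: "\<And>\<theta>. 1 \<le> \<theta> \<Longrightarrow> \<forall>\<^sub>F p in at_right 0. \<forall>n. \<theta> * p powr (- \<gamma>) \<le> real n \<longrightarrow>
      C * \<theta> \<le> real n * (\<Prod>j<J. min 1 (real n * p ^ q j) / 2)"
  shows "prob_lesssim initial_law (\<lambda>p. occupation_time \<rho> Z) (\<lambda>p. p powr (- \<gamma>))"
proof -
  \<comment> \<open>With x = (l / A) p^(-\<gamma>) and n \<le> 2 x, the time 2 n r (r + 1) is at
    most half of l p^(-\<gamma>).\<close>
  define A where "A = 8 * real r * (real r + 1)"
  have A: "0 < A" using r by (simp add: A_def)
  let ?T = "occupation_time \<rho> Z"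
  let ?f = "\<lambda>l p. measure (initial_law p) {\<omega> \<in> space (initial_law p). ?T \<omega> \<ge> ereal (l * p powr (- \<gamma>))}"
  have bound: "\<forall>\<^sub>F p in at_right 0. ?f l p \<le> 2 * exp (- (C * (l / A)))" if l: "A \<le> l" for l
  proof -
    have l0: "0 < l" "1 \<le> l / A" using A l by auto
    have "filterlim (\<lambda>p::real. p powr (- \<gamma>)) at_top (at_right 0)" using \<gamma> by real_asymp
    then have "\<forall>\<^sub>F p in at_right 0. 1 \<le> (p :: real) powr (- \<gamma>)" by (simp add: filterlim_at_top)
    moreover have "\<forall>\<^sub>F p in at_right 0. 0 < p \<and> p < (1 :: real)"
      by (simp add: eventually_at_right_field) (auto intro: exI[of _ 1])
    ultimately show ?thesis using many[OF l0(2)]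
    proof eventually_elim
      case (elim p)
      then have p: "0 \<le> p" "p \<le> 1" by auto
      interpret prob_space "initial_law p" by (rule prob_space_initial_law)
      define x where "x = l / A * p powr (- \<gamma>)"
      have "1 * 1 \<le> l / A * p powr (- \<gamma>)" using elim(1) l0 by (intro mult_mono) auto
      then have x1: "1 \<le> x" by (simp add: x_def)
      define n where "n = nat \<lceil>x\<rceil>"
      have n: "x \<le> real n" "real n \<le> 2 * x" "1 \<le> n" using x1 unfolding n_def by linarith+
      have less: "real (2 * (n * r) * (r + 1)) < l * p powr (- \<gamma>)"
      proof -
        have "real (2 * (n * r) * (r + 1)) = real n * (2 * real r * (real r + 1))" by (simp add: algebra_simps)
        also have "\<dots> \<le> 2 * x * (2 * real r * (real r + 1))" using n(2) by (intro mult_right_mono) auto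
        also have "\<dots> = x * A / 2" by (simp add: A_def algebra_simps)
        also have "x * A = l * p powr (- \<gamma>)" using A by (simp add: x_def)
        also have "l * p powr (- \<gamma>) / 2 < l * p powr (- \<gamma>)"
        proof -
          have "0 < p powr (- \<gamma>)" using elim(1) by linarith
          then have "0 < l * p powr (- \<gamma>)" by (rule mult_pos_pos[OF l0(1)])
          then show ?thesis by linarith
        qed
        finally show ?thesis .
      qed
      have sub: "{\<omega> \<in> space (initial_law p). ?T \<omega> \<ge> ereal (l * p powr (- \<gamma>))} \<subseteq>
          - nucleus_event r n False J q \<union> - nucleus_event r n True J q"
      proof
        fix \<omega> assume "\<omega> \<in> {\<omega> \<in> space (initial_law p). ?T \<omega> \<ge> ereal (l * p powr (- \<gamma>))}"
        then have T: "ereal (l * p powr (- \<gamma>)) \<le> ?T \<omega>" by simp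
        show "\<omega> \<in> - nucleus_event r n False J q \<union> - nucleus_event r n True J q"
        proof (rule ccontr)
          assume "\<not> ?thesis"
          then have "(0, 0) \<in> growth \<rho> Z {z. \<omega> z} (2 * (n * r) * (r + 1))"
            by (intro occupied n(3)) auto
          then have "?T \<omega> \<le> ereal (real (2 * (n * r) * (r + 1)))" by (rule time_le_if_occupied)
          with T have "ereal (l * p powr (- \<gamma>)) \<le> ereal (real (2 * (n * r) * (r + 1)))" by (rule order_trans)
          with less show False by simp
        qed
      qed
      have meas: "- nucleus_event r n k J q \<in> events" for k
      proof (rule depends_on_sets)
        show "depends_on (\<Union>b<n. block_sites r n k J b) (- nucleus_event r n k J q)"
          by (rule depends_on_Compl[OF nucleus_depends[OF p q]])
      qed (simp add: finite_sites)
      have pr: "prob (- nucleus_event r n k J q) \<le> exp (- (C * (l / A)))" for k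
      proof -
        have "C * (l / A) \<le> real n * (\<Prod>j<J. min 1 (real n * p ^ q j) / 2)"
          using elim(3) n(1) unfolding x_def by blast
        then have "exp (- (real n * (\<Prod>j<J. min 1 (real n * p ^ q j) / 2))) \<le> exp (- (C * (l / A)))" by simp
        with prob_no_nucleus[OF p q J, where n = n and k = k] show ?thesis by (rule order_trans)
      qed
      have "?f l p \<le> prob (- nucleus_event r n False J q \<union> - nucleus_event r n True J q)"
        by (rule finite_measure_mono[OF sub]) (use meas in auto)
      also have "\<dots> \<le> prob (- nucleus_event r n False J q) + prob (- nucleus_event r n True J q)"
        by (rule measure_Un_le) (use meas in auto)
      also have "\<dots> \<le> 2 * exp (- (C * (l / A)))" using pr[of False] pr[of True] by simp
      finally show ?case .
    qed
  qed
  show ?thesis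
    unfolding prob_lesssim_def
  proof (rule tendsto_sandwich[of "\<lambda>_. 0" _ _ "\<lambda>l. ereal (2 * exp (- (C * (l / A))))"])
    show "\<forall>\<^sub>F l in at_top. 0 \<le> Limsup (at_right 0) (\<lambda>p. ereal (?f l p))"
      by (intro always_eventually allI le_Limsup) auto
    have "\<forall>\<^sub>F l in at_top. A \<le> l" by (rule eventually_ge_at_top)
    then show "\<forall>\<^sub>F l in at_top. Limsup (at_right 0) (\<lambda>p. ereal (?f l p)) \<le> ereal (2 * exp (- (C * (l / A))))"
    proof eventually_elim
      case (elim l)
      then show ?case using bound[of l] by (intro Limsup_bounded) auto
    qed
    have "((\<lambda>l. 2 * exp (- (C * (l / A)))) \<longlongrightarrow> 0) at_top" using A C by real_asymp
    then show "((\<lambda>l. ereal (2 * exp (- (C * (l / A))))) \<longlongrightarrow> 0) at_top"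
      by (simp add: zero_ereal_def)
  qed simp
qed

lemma eventually_small_power:
  fixes a :: real assumes "0 < a" shows "\<forall>\<^sub>F p in at_right 0. \<theta> * p powr a \<le> 1"
proof -
  have "((\<lambda>p. \<theta> * p powr a) \<longlongrightarrow> 0) (at_right 0)" using assms by real_asymp
  then have "\<forall>\<^sub>F p in at_right 0. \<theta> * p powr a < 1" by (rule order_tendstoD) simp
  then show ?thesis by eventually_elim simp
qed

text \<open>With n at least of order p^(-\<gamma>), line j of a block has its run with probability
  at least of order p^max(0, q j - \<gamma>). By \<open>balance\<close> the product of these is
  p^\<gamma>, which the number of blocks compensates; a factor \<theta> remains from that
  number.\<close>

lemma many_blocks:
  assumes \<gamma>: "0 < \<gamma>" and \<theta>: "1 \<le> \<theta>"
    and balance: "(\<Sum>j<J. max 0 (real (q j) - \<gamma>)) = \<gamma>"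
  shows "\<forall>\<^sub>F p in at_right 0. \<forall>n. \<theta> * p powr (- \<gamma>) \<le> real n \<longrightarrow>
      (1 / 2) ^ J * \<theta> \<le> real n * (\<Prod>j<J. min 1 (real n * p ^ q j) / 2)"
proof -
  have "\<forall>\<^sub>F p in at_right 0. \<theta> * p powr (real (q j) - \<gamma>) \<le> 1" if "\<gamma> < real (q j)" for j
    using that by (intro eventually_small_power) simp
  then have "\<forall>\<^sub>F p in at_right 0. \<forall>j\<in>{..<J}. \<gamma> < real (q j) \<longrightarrow> \<theta> * p powr (real (q j) - \<gamma>) \<le> 1"
    by (intro eventually_ball_finite) (auto intro: eventually_mono)
  moreover have "\<forall>\<^sub>F p in at_right 0. 0 < p \<and> p < (1 :: real)"
    by (simp add: eventually_at_right_field) (auto intro: exI[of _ 1])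
  ultimately show ?thesis
  proof eventually_elim
    case (elim p)
    then have p: "0 < p" "p \<le> 1" by auto
    show ?case
    proof (intro allI impI)
      fix n assume n: "\<theta> * p powr (- \<gamma>) \<le> real n"
      have line: "p powr max 0 (real (q j) - \<gamma>) \<le> min 1 (real n * p ^ q j)" if j: "j < J" for j
      proof -
        have "\<theta> * p powr (real (q j) - \<gamma>) = \<theta> * p powr (- \<gamma>) * p ^ q j"
          using p by (simp add: powr_realpow[symmetric] powr_add[symmetric])
        also have "\<dots> \<le> real n * p ^ q j" using n p by (intro mult_right_mono) auto
        finally have 1: "\<theta> * p powr (real (q j) - \<gamma>) \<le> real n * p ^ q j" .
        have 2: "1 * p powr (real (q j) - \<gamma>) \<le> \<theta> * p powr (real (q j) - \<gamma>)"
          using \<theta> by (intro mult_right_mono) auto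
        show ?thesis
        proof (cases "\<gamma> < real (q j)")
          case True
          then have "\<theta> * p powr (real (q j) - \<gamma>) \<le> 1" using elim(1) j by blast
          then show ?thesis using 1 2 True by simp
        next
          case False
          then have "p powr 0 \<le> p powr (real (q j) - \<gamma>)" using p by (intro powr_mono') auto
          then have "1 \<le> p powr (real (q j) - \<gamma>)" using p by simp
          then have "1 \<le> real n * p ^ q j" using 1 2 by linarith
          then show ?thesis using False p by (simp add: max_def)
        qed
      qed
      have "(1 / 2) ^ J * \<theta> = \<theta> * p powr (- \<gamma>) * ((1 / 2) ^ J * p powr (\<Sum>j<J. max 0 (real (q j) - \<gamma>)))"
        using p unfolding balance by (simp add: powr_minus field_simps)
      also have "p powr (\<Sum>j<J. max 0 (real (q j) - \<gamma>)) = (\<Prod>j<J. p powr max 0 (real (q j) - \<gamma>))"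
        using p by (simp add: powr_sum)
      also have "(1 / 2) ^ J * (\<Prod>j<J. p powr max 0 (real (q j) - \<gamma>)) = (\<Prod>j<J. p powr max 0 (real (q j) - \<gamma>) / 2)"
        by (simp add: prod_dividef power_divide)
      also have "\<theta> * p powr (- \<gamma>) * \<dots> \<le> real n * (\<Prod>j<J. min 1 (real n * p ^ q j) / 2)"
        using n line p by (intro mult_mono prod_mono) (auto intro!: prod_nonneg)
      finally show "(1 / 2) ^ J * \<theta> \<le> real n * (\<Prod>j<J. min 1 (real n * p ^ q j) / 2)" .
    qed
  qed
qed

section \<open>Powers\<close>

lemma prob_gtrsim_mono:
  assumes "prob_gtrsim initial_law (\<lambda>p. occupation_time \<rho> Z) a"
    and "\<forall>\<^sub>F p in at_right 0. b p \<le> a p"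
  shows "prob_gtrsim initial_law (\<lambda>p. occupation_time \<rho> Z) b"
  unfolding prob_gtrsim_def
proof (rule tendsto_sandwich[OF _ _ tendsto_const assms(1)[unfolded prob_gtrsim_def]])
  let ?f = "\<lambda>c l p. measure (initial_law p) {\<omega> \<in> space (initial_law p). occupation_time \<rho> Z \<omega> \<le> ereal (l * c p)}"
  show "\<forall>\<^sub>F l in at_right 0. 0 \<le> Limsup (at_right 0) (\<lambda>p. ereal (?f b l p))"
    by (intro always_eventually allI le_Limsup) auto
  have "\<forall>\<^sub>F l :: real in at_right 0. 0 < l" by (rule eventually_at_right_less)
  then show "\<forall>\<^sub>F l in at_right 0. Limsup (at_right 0) (\<lambda>p. ereal (?f b l p)) \<le> Limsup (at_right 0) (\<lambda>p. ereal (?f a l p))"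
  proof eventually_elim
    case (elim l)
    show ?case
    proof (rule Limsup_mono, use assms(2) in eventually_elim)
      case (elim p)
      interpret prob_space "initial_law p" by (rule prob_space_initial_law)
      have "l * b p \<le> l * a p" using elim \<open>0 < l\<close> by simp
      then have "{\<omega> \<in> space (initial_law p). occupation_time \<rho> Z \<omega> \<le> ereal (l * b p)} \<subseteq>
          {\<omega> \<in> space (initial_law p). occupation_time \<rho> Z \<omega> \<le> ereal (l * a p)}"
        by (auto elim!: order_trans)
      moreover have "{\<omega> \<in> space (initial_law p). occupation_time \<rho> Z \<omega> \<le> ereal (l * a p)} \<in> events"
        by measurable
      ultimately have "?f b l p \<le> ?f a l p" by (rule finite_measure_mono)
      then show ?case by simp
    qed
  qed
qed

lemma prob_lesssim_mono:
  assumes "prob_lesssim initial_law (\<lambda>p. occupation_time \<rho> Z) a"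
    and "\<forall>\<^sub>F p in at_right 0. a p \<le> b p"
  shows "prob_lesssim initial_law (\<lambda>p. occupation_time \<rho> Z) b"
  unfolding prob_lesssim_def
proof (rule tendsto_sandwich[OF _ _ tendsto_const assms(1)[unfolded prob_lesssim_def]])
  let ?f = "\<lambda>c l p. measure (initial_law p) {\<omega> \<in> space (initial_law p). occupation_time \<rho> Z \<omega> \<ge> ereal (l * c p)}"
  show "\<forall>\<^sub>F l in at_top. 0 \<le> Limsup (at_right 0) (\<lambda>p. ereal (?f b l p))"
    by (intro always_eventually allI le_Limsup) auto
  have "\<forall>\<^sub>F l :: real in at_top. 0 < l" by (rule eventually_gt_at_top)
  then show "\<forall>\<^sub>F l in at_top. Limsup (at_right 0) (\<lambda>p. ereal (?f b l p)) \<le> Limsup (at_right 0) (\<lambda>p. ereal (?f a l p))"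
  proof eventually_elim
    case (elim l)
    show ?case
    proof (rule Limsup_mono, use assms(2) in eventually_elim)
      case (elim p)
      interpret prob_space "initial_law p" by (rule prob_space_initial_law)
      have "l * a p \<le> l * b p" using elim \<open>0 < l\<close> by simp
      then have le: "ereal (l * a p) \<le> ereal (l * b p)" by simp
      have "{\<omega> \<in> space (initial_law p). occupation_time \<rho> Z \<omega> \<ge> ereal (l * b p)} \<subseteq>
          {\<omega> \<in> space (initial_law p). occupation_time \<rho> Z \<omega> \<ge> ereal (l * a p)}"
        using order_trans[OF le] by blast
      moreover have "{\<omega> \<in> space (initial_law p). occupation_time \<rho> Z \<omega> \<ge> ereal (l * a p)} \<in> events"
        by measurable
      ultimately have "?f b l p \<le> ?f a l p" by (rule finite_measure_mono)
      then show ?case by simp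
    qed
  qed
qed

lemma eventually_powr_le:
  "a \<le> b \<Longrightarrow> \<forall>\<^sub>F p in at_right 0. p powr (- a) \<le> (p :: real) powr (- b)"
proof -
  assume "a \<le> b"
  have "\<forall>\<^sub>F p in at_right 0. 0 < p \<and> p < (1 :: real)"
    by (simp add: eventually_at_right_field) (auto intro: exI[of _ 1])
  then show ?thesis by eventually_elim (use \<open>a \<le> b\<close> in \<open>auto intro: powr_mono'\<close>)
qed

lemma lower_powerI:
  assumes "prob_gtrsim initial_law (\<lambda>p. occupation_time \<rho> Z) (\<lambda>p. p powr (- \<gamma>'))" "0 \<le> \<gamma>" "\<gamma> \<le> \<gamma>'"
  shows "lower_power \<rho> Z \<gamma>"
  unfolding lower_power_def
proof (intro conjI allI impI)
  fix \<epsilon> :: real assume "0 < \<epsilon>"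
  show "prob_gtrsim initial_law (\<lambda>p. occupation_time \<rho> Z) (\<lambda>p. p powr (- (\<gamma> - \<epsilon>)))"
    by (rule prob_gtrsim_mono[OF assms(1) eventually_powr_le]) (use assms \<open>0 < \<epsilon>\<close> in simp)
qed fact

lemma upper_powerI:
  assumes "prob_lesssim initial_law (\<lambda>p. occupation_time \<rho> Z) (\<lambda>p. p powr (- \<gamma>))" "0 \<le> \<gamma>"
  shows "upper_power \<rho> Z \<gamma>"
  unfolding upper_power_def
proof (intro conjI allI impI)
  fix \<epsilon> :: real assume "0 < \<epsilon>"
  then show "prob_lesssim initial_law (\<lambda>p. occupation_time \<rho> Z) (\<lambda>p. p powr (- (\<gamma> + \<epsilon>)))"
    by (intro prob_lesssim_mono[OF assms(1) eventually_powr_le]) simp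
qed fact

lemma critical_pureI:
  assumes g: "prob_gtrsim initial_law (\<lambda>p. occupation_time \<rho> Z) (\<lambda>p. p powr (- \<gamma>))"
    and l: "prob_lesssim initial_law (\<lambda>p. occupation_time \<rho> Z) (\<lambda>p. p powr (- \<gamma>))" and "0 \<le> \<gamma>"
  shows "critical_power_exists \<rho> Z \<and> critical_power_pure \<rho> Z \<and> critical_power \<rho> Z = \<gamma>"
proof -
  have c: "is_critical_power \<rho> Z \<gamma>"
    unfolding is_critical_power_def using lower_powerI[OF g] upper_powerI[OF l] \<open>0 \<le> \<gamma>\<close> by simp
  then have "critical_power \<rho> Z = \<gamma>" by (rule critical_power_eqI)
  then show ?thesis
    using c g l unfolding critical_power_exists_def critical_power_pure_def prob_asymp_def by auto
qed

section \<open>Lower and upper bounds for the four cases\<close>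

lemma cross_growth_growth: "cross_growth \<rho> r s1 s2 (growth \<rho> (cross_zero_set r s1 s2) X)"
  by standard (simp_all only: growth_mono growth_Suc_iff Let_def)

lemma gtrsim_limited:
  assumes ml: "1 \<le> m" "2 * m \<le> s1 + 1" "2 * m \<le> s2 + 1" and s: "s1 < r" "s2 < r"
  defines "\<gamma> \<equiv> real (m * (r + 1 - m)) / real (m + 1)"
  shows "prob_gtrsim initial_law (\<lambda>p. occupation_time \<rho> (cross_zero_set r s1 s2)) (\<lambda>p. p powr (- \<gamma>))"
proof (rule gtrsim_from_sparse)
  define n where "n = max 1 (nat \<lceil>2 * \<gamma>\<rceil>)"
  have mr: "m < r" using ml s by linarith
  have "0 < m * (r + 1 - m)" using ml mr by simp
  then have "0 < real (m * (r + 1 - m))" by (simp only: of_nat_0_less_iff)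
  then show \<gamma>0: "0 < \<gamma>" unfolding \<gamma>_def by (rule divide_pos_pos) simp
  fix X t assume sp: "sparse \<gamma> (4 * int \<rho> * (int n + 1)) m X"
  interpret cross_growth \<rho> r s1 s2 "growth \<rho> (cross_zero_set r s1 s2) X" by (rule cross_growth_growth)
  interpret sparse_growth \<rho> r s1 s2 "growth \<rho> (cross_zero_set r s1 s2) X" \<gamma> "4 * int \<rho> * (int n + 1)" m n m
  proof
    show "2 * \<gamma> \<le> real n" unfolding n_def by linarith
    show "1 \<le> n" by (simp add: n_def)
  qed (use sp \<gamma>0 ml s in auto)
  show "(0, 0) \<notin> growth \<rho> (cross_zero_set r s1 s2) X t"
    by (rule origin_never_occupied) (use ml \<gamma>_def in auto)
qed

lemma gtrsim_two_two:
  assumes r: "6 \<le> r"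
  shows "prob_gtrsim initial_law (\<lambda>p. occupation_time \<rho> (cross_zero_set r 2 2)) (\<lambda>p. p powr (- (2 * real r / 3)))"
proof (rule gtrsim_from_sparse)
  define \<gamma> where "\<gamma> = 2 * real r / 3"
  define n where "n = 2 * r"
  define W where "W = 4 * int \<rho> * int n + 3 * int \<rho>"
  show "0 < 2 * real r / 3" using r by simp
  fix X t assume sp: "sparse (2 * real r / 3) (4 * W) 3 X"
  interpret cross_growth \<rho> r 2 2 "growth \<rho> (cross_zero_set r 2 2) X" by (rule cross_growth_growth)
  have W0: "0 \<le> int \<rho> * int n" by simp
  interpret sparse_growth \<rho> r 2 2 "growth \<rho> (cross_zero_set r 2 2) X" \<gamma> "4 * W" 3 n 2
  proof
    show "4 * int \<rho> * (int n + 1) \<le> 4 * W" unfolding W_def distrib_left using W0 by linarith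
  qed (use sp r in \<open>auto simp: \<gamma>_def n_def\<close>)
  interpret two_two_growth \<rho> r 2 2 "growth \<rho> (cross_zero_set r 2 2) X" \<gamma> "4 * W" 3 n 2 W
    by standard (use r in \<open>auto simp: \<gamma>_def W_def D_def\<close>)
  show "(0, 0) \<notin> growth \<rho> (cross_zero_set r 2 2) X t" by (rule origin_never_occupied_two_two)
qed

lemma gtrsim_lines:
  assumes "s < r" "2 \<le> s" "r \<le> \<rho>"
  shows "prob_gtrsim initial_law (\<lambda>p. occupation_time \<rho> (cross_zero_set r 1 s))
    (\<lambda>p. p powr (- (real s * (real r - 1) / real r)))"
proof (rule gtrsim_from_sparse)
  show "0 < real s * (real r - 1) / real r" using assms by simp
qed (rule origin_never_occupied_lines[OF assms])

lemma nucleus_runs: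
  assumes "\<omega> \<in> nucleus_event r n k J q" "J \<le> r" "\<And>j. j < J \<Longrightarrow> q j \<le> r"
  obtains x0 where "0 \<le> x0" "x0 + int r \<le> int (n * r)"
    "\<And>j. j < J \<Longrightarrow> \<exists>a. 0 \<le> a \<and> a + int r \<le> int (n * r) \<and> (\<forall>h<q j. \<omega> (site k (a + int h) (x0 + int j)))"
proof -
  obtain b where b: "b < n" "\<omega> \<in> block_event r n k J q b" using assms(1) by (auto simp: nucleus_event_def)
  have le: "int (i * r) + int r \<le> int (n * r)" if "i < n" for i
  proof -
    have "Suc i * r \<le> n * r" using that by (intro mult_le_mono1) simp
    then have "i * r + r \<le> n * r" by simp
    then show ?thesis by linarith
  qed
  show thesis
  proof (rule that[of "int (b * r)"])
    fix j assume "j < J"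
    then obtain i where i: "i < n" "\<forall>h<q j. \<omega> (site k (int (i * r + h)) (int (b * r + j)))"
      using b(2) by (auto simp: block_event_def line_event_def run_event_def)
    show "\<exists>a. 0 \<le> a \<and> a + int r \<le> int (n * r) \<and> (\<forall>h<q j. \<omega> (site k (a + int h) (int (b * r) + int j)))"
      by (rule exI[of _ "int (i * r)"]) (use i le[OF i(1)] in \<open>simp only: of_nat_add of_nat_0_le_iff simp_thms\<close>)
  qed (use le[OF b(1)] in auto)
qed

text \<open>A block consists of s runs of length r, so the exponent solves s (r - \<gamma>) =
  \<gamma>.\<close>

lemma lesssim_cross:
  assumes s: "1 \<le> s" "s < r" "r \<le> \<rho>"
  shows "prob_lesssim initial_law (\<lambda>p. occupation_time \<rho> (cross_zero_set r s s))
    (\<lambda>p. p powr (- (real r * real s / (real s + 1))))"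
proof (rule lesssim_from_nuclei[where r = r and J = s and q = "\<lambda>_. r" and C = "(1 / 2) ^ s"])
  let ?\<gamma> = "real r * real s / (real s + 1)"
  show \<gamma>: "0 < ?\<gamma>" using s by simp
  show "\<forall>\<^sub>F p in at_right 0. \<forall>n. \<theta> * p powr - ?\<gamma> \<le> real n \<longrightarrow>
      (1 / 2) ^ s * \<theta> \<le> real n * (\<Prod>j<s. min 1 (real n * p ^ r) / 2)" if "1 \<le> \<theta>" for \<theta>
  proof (rule many_blocks[OF \<gamma> that])
    have "real r - ?\<gamma> = real r / (real s + 1)" by (simp add: field_simps)
    moreover have "max 0 (real r / (real s + 1)) = real r / (real s + 1)" by simp
    ultimately show "(\<Sum>j<s. max 0 (real r - ?\<gamma>)) = ?\<gamma>" by simp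
  qed
  fix n \<omega> assume n: "1 \<le> n" and F: "\<omega> \<in> nucleus_event r n False s (\<lambda>_. r)" and T: "\<omega> \<in> nucleus_event r n True s (\<lambda>_. r)"
  obtain x0 where x0: "0 \<le> x0" "x0 + int r \<le> int (n * r)"
    "\<And>j. j < s \<Longrightarrow> \<exists>a. 0 \<le> a \<and> a + int r \<le> int (n * r) \<and> (\<forall>h<r. \<omega> (site False (a + int h) (x0 + int j)))"
    by (rule nucleus_runs[OF F]) (use s in auto)
  obtain y0 where y0: "0 \<le> y0" "y0 + int r \<le> int (n * r)"
    "\<And>j. j < s \<Longrightarrow> \<exists>a. 0 \<le> a \<and> a + int r \<le> int (n * r) \<and> (\<forall>h<r. \<omega> (site True (a + int h) (y0 + int j)))"
    by (rule nucleus_runs[OF T]) (use s in auto)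
  have "r \<le> n * r" using n by simp
  then show "(0, 0) \<in> growth \<rho> (cross_zero_set r s s) {z. \<omega> z} (2 * (n * r) * (r + 1))"
    by (rule nucleation_cross[OF s _ x0(1,2) y0(1,2)]) (use x0(3) y0(3) in simp_all)
qed (use s in auto)

text \<open>\<open>balance\<close> has two regimes. For s \<le> r / 2 it gives \<gamma> = r / 2, and
  a run of s then occurs on a line with probability bounded below. For s > r / 2 such runs are rare
  too, and \<gamma> (r + 1) = r + (r - 1) s.\<close>

lemma lesssim_columns:
  assumes s: "1 \<le> s" "s < r" "r \<le> \<rho>" and \<gamma>: "0 < \<gamma>" "\<gamma> < real r"
    and balance: "real r - \<gamma> + real (r - 1) * max 0 (real s - \<gamma>) = \<gamma>"
  shows "prob_lesssim initial_law (\<lambda>p. occupation_time \<rho> (cross_zero_set r 1 s)) (\<lambda>p. p powr (- \<gamma>))"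
proof (rule lesssim_from_nuclei[where r = r and J = r and q = "\<lambda>j. if j = 0 then r else s" and C = "(1 / 2) ^ r"])
  show "\<forall>\<^sub>F p in at_right 0. \<forall>n. \<theta> * p powr - \<gamma> \<le> real n \<longrightarrow>
      (1 / 2) ^ r * \<theta> \<le> real n * (\<Prod>j<r. min 1 (real n * p ^ (if j = 0 then r else s)) / 2)" if "1 \<le> \<theta>" for \<theta>
  proof (rule many_blocks[OF \<gamma>(1) that])
    obtain r' where r': "r = Suc r'" using s by (cases r) auto
    have "(\<Sum>j<r. max 0 (real (if j = 0 then r else s) - \<gamma>)) = max 0 (real r - \<gamma>) + real r' * max 0 (real s - \<gamma>)"
      unfolding r' by (simp only: sum.lessThan_Suc_shift) simp
    then show "(\<Sum>j<r. max 0 (real (if j = 0 then r else s) - \<gamma>)) = \<gamma>"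
      using balance \<gamma>(2) r' by simp
  qed
  fix n \<omega> assume n: "1 \<le> n" and F: "\<omega> \<in> nucleus_event r n False r (\<lambda>j. if j = 0 then r else s)"
  obtain x0 where x0: "0 \<le> x0" "x0 + int r \<le> int (n * r)"
    "\<And>j. j < r \<Longrightarrow> \<exists>a. 0 \<le> a \<and> a + int r \<le> int (n * r) \<and>
       (\<forall>h<(if j = 0 then r else s). \<omega> (site False (a + int h) (x0 + int j)))"
    by (rule nucleus_runs[OF F]) (use s in auto)
  have r2: "2 \<le> r" using s by linarith
  have rn: "r \<le> n * r" using n by simp
  show "(0, 0) \<in> growth \<rho> (cross_zero_set r 1 s) {z. \<omega> z} (2 * (n * r) * (r + 1))"
    by (rule nucleation_columns[OF s(2) r2 s(3) rn x0(1,2)]) (use x0(3) in \<open>simp only: site_simps mem_Collect_eq\<close>)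
qed (use s \<gamma> in auto)

text \<open>For f(m) = m (r - m + 1) / (m + 1) one has f(m) \<ge> f(m - 1) if and only if m^2 + m
  \<le> r + 2, so the first entry of the minimum is the largest m up to which f does not decrease.
  The second entry keeps 2 m \<le> s, within the range of \<open>gtrsim_limited\<close>.\<close>

lemma part3_lower:
  assumes s: "1 \<le> s" "s < r"
  defines "m \<equiv> real_of_int (min \<lfloor>(- 1 + sqrt (4 * real r + 9)) / 2\<rfloor> \<lfloor>real s / 2\<rfloor>)"
  shows "lower_power \<rho> (cross_zero_set r s s) (m * (real r - m + 1) / (1 + m))"
proof -
  define k where "k = min \<lfloor>(- 1 + sqrt (4 * real r + 9)) / 2\<rfloor> \<lfloor>real s / 2\<rfloor>"
  have "3 \<le> sqrt (4 * real r + 9)" by (rule real_le_rsqrt) simp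
  then have f1: "1 \<le> \<lfloor>(- 1 + sqrt (4 * real r + 9)) / 2\<rfloor>" by (simp add: le_floor_iff)
  have half: "2 * real_of_int \<lfloor>real s / 2\<rfloor> \<le> real s" by linarith
  show ?thesis
  proof (cases "s = 1")
    case True
    \<comment> \<open>For s = 1 the formula gives the exponent 0, which lies below the exponent r /
      2 that \<open>gtrsim_limited\<close> yields for one row.\<close>
    then have "m = 0" using f1 by (simp add: m_def)
    then show ?thesis
      using lower_powerI[OF gtrsim_limited[of 1 s s r \<rho>], of 0] s by simp
  next
    case False
    then have "1 \<le> \<lfloor>real s / 2\<rfloor>" using s by (simp add: le_floor_iff)
    then have k1: "1 \<le> k" using f1 by (simp add: k_def)
    have "2 * real_of_int k \<le> real s" using half unfolding k_def by linarith
    then have k2: "2 * k \<le> int s" by linarith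
    have mk: "m = real_of_int k" unfolding m_def k_def ..
    define m' where "m' = nat k"
    have m': "1 \<le> m'" "2 * m' \<le> s" "m = real m'" "m' \<le> r"
      using k1 k2 s mk by (auto simp: m'_def)
    have "m * (real r - m + 1) / (1 + m) = real (m' * (r + 1 - m')) / real (m' + 1)"
    proof -
      have "real (r + 1 - m') = real r - real m' + 1" using m'(4) by (simp add: of_nat_diff)
      then show ?thesis unfolding m'(3) of_nat_mult by (simp add: add.commute)
    qed
    moreover have "lower_power \<rho> (cross_zero_set r s s) (real (m' * (r + 1 - m')) / real (m' + 1))"
      by (rule lower_powerI[OF gtrsim_limited]) (use m' s in auto)
    ultimately show ?thesis by simp
  qed
qed

theorem theorem1p4:
  fixes r s1 s2 \<rho> :: nat and Z :: "(nat \<times> nat) set"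
  assumes "1 \<le> s1" and "s1 < r" and "1 \<le> s2" and "s2 < r" and "r \<le> \<rho>"
    and "zero_set Z" and "minimal_counts Z = {(0, r), (s1, s2), (r, 0)}"
  shows
    "(\<forall>s. s1 = 1 \<and> s2 = s \<and> real s \<le> real r / 2 \<longrightarrow>
        critical_power_exists \<rho> Z \<and> critical_power_pure \<rho> Z \<and>
        critical_power \<rho> Z = real r / 2) \<and>
     (s1 = 2 \<and> s2 = 2 \<and> r \<ge> 6 \<longrightarrow>
        critical_power_exists \<rho> Z \<and> critical_power_pure \<rho> Z \<and>
        critical_power \<rho> Z = 2 * real r / 3) \<and>
     (\<forall>s. s1 = s \<and> s2 = s \<longrightarrow>
        (let m = real_of_int (min \<lfloor>(- 1 + sqrt (4 * real r + 9)) / 2\<rfloor> \<lfloor>real s / 2\<rfloor>)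
         in lower_power \<rho> Z (m * (real r - m + 1) / (1 + m))) \<and>
        upper_power \<rho> Z (real r * real s / (real s + 1))) \<and>
     (\<forall>s. s1 = 1 \<and> s2 = s \<and> real s > real r / 2 \<longrightarrow>
        lower_power \<rho> Z (real s - real s / real r) \<and>
        upper_power \<rho> Z (real s + 1 - (2 * real s + 1) / (real r + 1)) \<and>
        \<bar>(real s + 1 - (2 * real s + 1) / (real r + 1)) - (real s - real s / real r)\<bar> \<le> 1 / 2)"
proof -
  have Z: "Z = cross_zero_set r s1 s2"
    unfolding cross_zero_set_def
    by (rule iffD1[OF zero_set_with_three_minimal_counts[OF assms(1-4)] conjI[OF assms(6,7)]])
  have r0: "0 < real r" using assms(2) by simp
  have part1: "critical_power_exists \<rho> Z \<and> critical_power_pure \<rho> Z \<and> critical_power \<rho> Z = real r / 2"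
    if s: "s1 = 1" "s2 = s" "real s \<le> real r / 2" for s
  proof (rule critical_pureI)
    \<comment> \<open>The bound with m = 1, whose exponent is 1 * r / 2: even a single good row near
      a given place is too expensive.\<close>
    show "prob_gtrsim initial_law (\<lambda>p. occupation_time \<rho> Z) (\<lambda>p. p powr - (real r / 2))"
      using gtrsim_limited[of 1 s1 s2 r \<rho>] assms(1-4) by (simp add: Z)
    show "prob_lesssim initial_law (\<lambda>p. occupation_time \<rho> Z) (\<lambda>p. p powr - (real r / 2))"
      unfolding Z s(1) by (rule lesssim_columns) (use assms s r0 in auto)
  qed simp
  have part2: "critical_power_exists \<rho> Z \<and> critical_power_pure \<rho> Z \<and> critical_power \<rho> Z = 2 * real r / 3"
    if s: "s1 = 2" "s2 = 2" "6 \<le> r"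
  proof (rule critical_pureI)
    show "prob_gtrsim initial_law (\<lambda>p. occupation_time \<rho> Z) (\<lambda>p. p powr - (2 * real r / 3))"
      unfolding Z s(1,2) by (rule gtrsim_two_two[OF s(3)])
    show "prob_lesssim initial_law (\<lambda>p. occupation_time \<rho> Z) (\<lambda>p. p powr - (2 * real r / 3))"
      using lesssim_cross[of 2 r \<rho>] s assms(5) by (simp add: Z mult.commute)
  qed simp
  have part4: "lower_power \<rho> Z (real s - real s / real r) \<and>
        upper_power \<rho> Z (real s + 1 - (2 * real s + 1) / (real r + 1)) \<and>
        \<bar>(real s + 1 - (2 * real s + 1) / (real r + 1)) - (real s - real s / real r)\<bar> \<le> 1 / 2"
    if s: "s1 = 1" "s2 = s" "real s > real r / 2" for s
  proof (intro conjI)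
    have sr: "s < r" "r + 1 \<le> 2 * s" using s assms(4) by linarith+
    have s2: "2 \<le> s" using sr by linarith
    have eq: "real s - real s / real r = real s * (real r - 1) / real r" using r0 by (simp add: field_simps)
    have le1: "real s / real r \<le> real s * 1" using s2 sr by (simp add: divide_le_eq)
    show "lower_power \<rho> Z (real s - real s / real r)"
      unfolding Z s(1,2)
      by (rule lower_powerI[OF gtrsim_lines[OF sr(1) s2 assms(5)]]) (use eq le1 in auto)
    define \<gamma> where "\<gamma> = real s + 1 - (2 * real s + 1) / (real r + 1)"
    have \<gamma>: "\<gamma> * (real r + 1) = real s * (real r - 1) + real r"
      using r0 by (simp add: \<gamma>_def field_simps)
    \<comment> \<open>This is the regime of rare runs: the maximum in the balance equation is s -
      \<gamma>.\<close>
    have "\<gamma> \<le> real s"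
    proof (rule ccontr)
      assume "\<not> \<gamma> \<le> real s"
      then have "real s * (real r + 1) < \<gamma> * (real r + 1)" using r0 by (intro mult_strict_right_mono) auto
      then show False unfolding \<gamma> using sr(2) by (simp add: algebra_simps)
    qed
    have \<gamma>0: "0 < \<gamma>"
    proof (rule ccontr)
      assume "\<not> 0 < \<gamma>"
      then have "\<gamma> * (real r + 1) \<le> 0" using r0 by (simp add: mult_nonpos_nonneg)
      moreover have "0 \<le> real s * (real r - 1)" using sr by (intro mult_nonneg_nonneg) auto
      ultimately show False unfolding \<gamma> using r0 by linarith
    qed
    have "prob_lesssim initial_law (\<lambda>p. occupation_time \<rho> Z) (\<lambda>p. p powr - \<gamma>)"
      unfolding Z s(1,2)
    proof (rule lesssim_columns)
      have "real (r - 1) = real r - 1" using sr by (simp add: of_nat_diff)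
      then show "real r - \<gamma> + real (r - 1) * max 0 (real s - \<gamma>) = \<gamma>"
        using \<open>\<gamma> \<le> real s\<close> \<gamma> by (simp add: algebra_simps)
    qed (use s2 sr assms(5) \<gamma>0 \<open>\<gamma> \<le> real s\<close> in auto)
    then show "upper_power \<rho> Z \<gamma>" by (rule upper_powerI) (use \<gamma>0 in simp)
    have rr: "0 < real r * (real r + 1)" using r0 by simp
    have d: "\<gamma> - (real s - real s / real r) = ((real r)\<^sup>2 - real r * real s + real s) / (real r * (real r + 1))"
      using r0 unfolding \<gamma>_def by (simp add: field_simps power2_eq_square)
    \<comment> \<open>With denominators cleared, the bound 1 / 2 follows from r + 1 \<le> 2 s, and
      nonnegativity below from s < r.\<close>
    have "(real r - 1) * (real r + 1) \<le> (real r - 1) * (2 * real s)"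
      using sr by (intro mult_left_mono) linarith+
    then have "((real r)\<^sup>2 - real r * real s + real s) * 2 \<le> real r * (real r + 1)"
      using sr by (simp add: algebra_simps power2_eq_square)
    then have "((real r)\<^sup>2 - real r * real s + real s) / (real r * (real r + 1)) \<le> 1 / 2"
      using rr by (simp add: divide_le_eq)
    moreover have "real r * real s \<le> real r * real r" using sr by (intro mult_left_mono) auto
    then have "0 \<le> ((real r)\<^sup>2 - real r * real s + real s) / (real r * (real r + 1))"
      using rr by (intro divide_nonneg_pos) (auto simp: power2_eq_square)
    ultimately show "\<bar>\<gamma> - (real s - real s / real r)\<bar> \<le> 1 / 2" unfolding d by (simp only: abs_of_nonneg)
  qed
  have part3: "lower_power \<rho> Z (m * (real r - m + 1) / (1 + m))"
      "upper_power \<rho> Z (real r * real s / (real s + 1))"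
    if s: "s1 = s" "s2 = s" and m: "m = real_of_int (min \<lfloor>(- 1 + sqrt (4 * real r + 9)) / 2\<rfloor> \<lfloor>real s / 2\<rfloor>)" for s m
  proof -
    have sr: "1 \<le> s" "s < r" using s assms(1,2) by auto
    show "lower_power \<rho> Z (m * (real r - m + 1) / (1 + m))"
      unfolding Z s m by (rule part3_lower[OF sr])
    show "upper_power \<rho> Z (real r * real s / (real s + 1))"
      unfolding Z s by (rule upper_powerI[OF lesssim_cross[OF sr assms(5)]]) simp
  qed
  show ?thesis
    unfolding Let_def using part1 part2 part3[OF _ _ refl] part4 by blast
qed

end
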